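(* Every tropical curve of genus at least two has a Weierstrass point.
   Context: A tropical curve $\Gamma$ is a compact connected metric graph, obtained from a finite connected graph $G=(V,E)$ (loops and multiple edges allowed) by identifying each edge with a closed interval of positive length; its genus is $g=|E|-|V|+1$. A divisor is a finite formal integer combination of points. A rational function is a continuous piecewise linear $f:\Gamma\to\mathbb R$ with integer slopes and finitely many pieces on each edge; $\mathrm{div}(f)=\sum_v\mathrm{ord}_v(f)(v)$ with $\mathrm{ord}_v(f)$ the sum of outgoing slopes at $v$; $D\sim D'$ if $D-D'=\mathrm{div}(f)$; $|D|=\{E\ge0:E\sim D\}$; $r(D)=\min\{\deg(E):E\ge 0,\ |D-E|=\emptyset\}-1$. A point $P\in\Gamma$ is a Weierstrass point if $r(g(P))\ge1$, where $g$ is the genus. *)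

theory Defs
  imports
    Complex_Main
    "HOL-Library.Poly_Mapping"
    "Graph_Theory.Digraph_Component"
begin

(* The direction of an arc carries no meaning beyond fixing the parametrisation of the
   corresponding edge by {0..len e}.  The qualified name selects connectedness of the underlying
   undirected graph (which includes non-emptiness), not topological connectedness. *)
locale tropical_curve = fin_digraph G for G :: "('a, 'b) pre_digraph" +
  fixes len :: "'b \<Rightarrow> real"
  assumes graph_connected: "Digraph_Component.connected G"
    and len_pos: "e \<in> arcs G \<Longrightarrow> 0 < len e"

datatype ('a, 'b) curve_point = Vertex 'a | Inner 'b real

context tropical_curve
begin

definition genus :: int where
  "genus = int (card (arcs G)) - int (card (verts G)) + 1"

definition points :: "('a, 'b) curve_point set" where
  "points = Vertex ` verts G \<union> {Inner e t | e t. e \<in> arcs G \<and> 0 < t \<and> t < len e}"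

(* The gluing map {0..len e} -> points of the edge e. *)
definition edge_point :: "'b \<Rightarrow> real \<Rightarrow> ('a, 'b) curve_point" where
  "edge_point e t =
     (if t = 0 then Vertex (tail G e) else if t = len e then Vertex (head G e) else Inner e t)"

(* The curve carries the quotient topology of the disjoint union of its edges, so a function on
   it is continuous iff its pullback to every edge is.  Only the values on points matter. *)
definition rational_function :: "(('a, 'b) curve_point \<Rightarrow> real) \<Rightarrow> bool" where
  "rational_function f \<longleftrightarrow>
     (\<forall>e\<in>arcs G.
        continuous_on {0..len e} (\<lambda>t. f (edge_point e t)) \<and>
        (\<exists>B. finite B \<and>
           (\<forall>a b. {a<..<b} \<subseteq> {0..len e} - B \<longrightarrow>
              (\<exists>(m::int) (c::real). \<forall>t\<in>{a<..<b}. f (edge_point e t) = of_int m * t + c))))"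

(* A triple (e, t, s) stands for leaving the point edge_point e t along e, with t increasing if
   s = 1 and decreasing if s = -1.  A loop thus contributes two directions at its vertex. *)
definition directions :: "('a, 'b) curve_point \<Rightarrow> ('b \<times> real \<times> real) set" where
  "directions P =
     {(e, t, s) | e t s. e \<in> arcs G \<and> edge_point e t = P \<and>
        (s = 1 \<and> 0 \<le> t \<and> t < len e \<or> s = -1 \<and> 0 < t \<and> t \<le> len e)}"

definition outgoing_slope ::
    "(('a, 'b) curve_point \<Rightarrow> real) \<Rightarrow> 'b \<times> real \<times> real \<Rightarrow> int" where
  "outgoing_slope f = (\<lambda>(e, t, s).
     THE m::int. \<forall>\<^sub>F h in at_right 0.
       f (edge_point e (t + s * h)) = f (edge_point e t) + of_int m * h)"

definition ord_at :: "('a, 'b) curve_point \<Rightarrow> (('a, 'b) curve_point \<Rightarrow> real) \<Rightarrow> int" where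
  "ord_at P f = (\<Sum>d\<in>directions P. outgoing_slope f d)"

definition divisor :: "(('a, 'b) curve_point \<Rightarrow>\<^sub>0 int) \<Rightarrow> bool" where
  "divisor D \<longleftrightarrow> Poly_Mapping.keys D \<subseteq> points"

definition degree :: "(('a, 'b) curve_point \<Rightarrow>\<^sub>0 int) \<Rightarrow> int" where
  "degree D = (\<Sum>P\<in>Poly_Mapping.keys D. Poly_Mapping.lookup D P)"

definition effective :: "(('a, 'b) curve_point \<Rightarrow>\<^sub>0 int) \<Rightarrow> bool" where
  "effective D \<longleftrightarrow> divisor D \<and> (\<forall>P. 0 \<le> Poly_Mapping.lookup D P)"

(* The index set is finite for every rational function f. *)
definition div_of :: "(('a, 'b) curve_point \<Rightarrow> real) \<Rightarrow> (('a, 'b) curve_point \<Rightarrow>\<^sub>0 int)" where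
  "div_of f = (\<Sum>P\<in>{P \<in> points. ord_at P f \<noteq> 0}. Poly_Mapping.single P (ord_at P f))"

definition lin_equiv ::
    "(('a, 'b) curve_point \<Rightarrow>\<^sub>0 int) \<Rightarrow> (('a, 'b) curve_point \<Rightarrow>\<^sub>0 int) \<Rightarrow> bool" where
  "lin_equiv D D' \<longleftrightarrow> (\<exists>f. rational_function f \<and> D - D' = div_of f)"

definition linear_system ::
    "(('a, 'b) curve_point \<Rightarrow>\<^sub>0 int) \<Rightarrow> (('a, 'b) curve_point \<Rightarrow>\<^sub>0 int) set" where
  "linear_system D = {E. effective E \<and> lin_equiv E D}"

(* The minimum is over a non-empty set, as an effective E of degree exceeding that of D has
   empty linear_system (D - E).  It is taken over nat because degrees of effective divisors are
   non-negative. *)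
definition rank :: "(('a, 'b) curve_point \<Rightarrow>\<^sub>0 int) \<Rightarrow> int" where
  "rank D =
     int (LEAST n. \<exists>E. effective E \<and> degree E = int n \<and> linear_system (D - E) = {}) - 1"

definition weierstrass_point :: "('a, 'b) curve_point \<Rightarrow> bool" where
  "weierstrass_point P \<longleftrightarrow> P \<in> points \<and> rank (Poly_Mapping.single P genus) \<ge> 1"

end

end

theory Submission
  imports Defs "HOL-Analysis.Equivalence_Lebesgue_Henstock_Integration"
begin

text \<open>
  Let \<open>K\<close> be the canonical divisor and \<open>R(K)\<close> the set of rational functions \<open>f\<close> with
  \<open>K + div f \<ge> 0\<close>. The full Riemann--Roch theorem is not needed, only its consequence (1).

  (1) For every effective \<open>E\<close> of degree \<open>g - 1\<close> the divisor \<open>K - E\<close> is equivalent to an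
  effective one. Otherwise choose \<open>D \<sim> K - E\<close> whose set \<open>S\<close> of negative points is as small as
  possible and which is reduced with respect to \<open>S\<close>. Burning a finite model from \<open>S\<close> and comparing
  degrees determines \<open>D\<close> as the divisor of an acyclic orientation, which contradicts
  \<open>D \<sim> K - E\<close> at the last burnt point where the function realising this equivalence is maximal.
  Consequently \<open>P\<close> is a Weierstrass point as soon as \<open>K + div f \<ge> g P\<close> for some \<open>f\<close> in \<open>R(K)\<close>.

  (2) For a tangent direction \<open>d\<close> let \<open>M d\<close> be the largest outgoing slope along \<open>d\<close> of a function in
  \<open>R(K)\<close>. As \<open>R(K)\<close> is closed under maxima, all directions at \<open>P\<close> attain \<open>M\<close> simultaneously; if there
  is no Weierstrass point, (1) therefore gives \<open>K P + (\<Sum>d. M d) = g - 1\<close> at every \<open>P\<close>. Functions in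
  \<open>R(K)\<close> are convex on edges and slopes are upper semicontinuous in limits, so connectedness of
  an open edge forces the values of \<open>M\<close> at its two ends to sum to at least \<open>g - 1\<close>. Summing over
  the vertices yields \<open>(2 + |E|) (g - 1) \<le> |V| (g - 1)\<close>, which is impossible.
\<close>

section \<open>Piecewise linear functions on an interval\<close>

text \<open>Both halves of the proof then depend on limits: (1) needs a maximal function to produce
  a reduced divisor, and (2) needs extremal slopes to survive when the point moves along an edge.
  Both rest on one compactness theorem. Its source is that the slopes of sections are integers
  bounded by the degree of the positive part of the divisor: once made convex on an edge, a section
  is a maximum of finitely many affine functions, one for each possible slope, and is thus encoded
  by finitely many bounded reals. In (1) the usual base point of a reduced divisor is replaced by
  the whole negative set. Its minimality ensures that reducing removes none of its points, so each
  of them can be burnt at the start without any burnt neighbour.\<close>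

definition has_slope :: "(real \<Rightarrow> real) \<Rightarrow> real \<Rightarrow> real \<Rightarrow> int \<Rightarrow> bool" where
  "has_slope \<phi> t s m \<longleftrightarrow> (\<forall>\<^sub>F h in at_right 0. \<phi> (t + s * h) = \<phi> t + of_int m * h)"

definition slope :: "(real \<Rightarrow> real) \<Rightarrow> real \<Rightarrow> real \<Rightarrow> int" where
  "slope \<phi> t s = (THE m. has_slope \<phi> t s m)"

text \<open>Only one-sided linearity with integer slopes near each point is demanded. Continuity and
  finiteness of the set of breakpoints follow from compactness of the interval
  (\<open>pl_imp_canon\<close>), while closure under sums and maxima can be checked germ by
  germ.\<close>

definition pl :: "real \<Rightarrow> (real \<Rightarrow> real) \<Rightarrow> bool" where
  "pl L \<phi> \<longleftrightarrow> (\<forall>t. 0 \<le> t \<and> t < L \<longrightarrow> (\<exists>m. has_slope \<phi> t 1 m)) \<and>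
             (\<forall>t. 0 < t \<and> t \<le> L \<longrightarrow> (\<exists>m. has_slope \<phi> t (-1) m))"

text \<open>Both slopes point away from \<open>t\<close>, so this is the order of the function at an
  interior point of an edge; it is nonnegative exactly where the function is convex.\<close>

definition kink :: "(real \<Rightarrow> real) \<Rightarrow> real \<Rightarrow> int" where
  "kink \<phi> t = slope \<phi> t 1 + slope \<phi> t (-1)"

lemma has_slope_iff:
  "has_slope \<phi> t s m \<longleftrightarrow> (\<exists>\<delta>>0. \<forall>h. 0 \<le> h \<and> h < \<delta> \<longrightarrow> \<phi> (t + s * h) = \<phi> t + of_int m * h)"
proof -
  have "has_slope \<phi> t s m \<longleftrightarrow> (\<exists>\<delta>>0. \<forall>h>0. h < \<delta> \<longrightarrow> \<phi> (t + s * h) = \<phi> t + of_int m * h)"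
    unfolding has_slope_def eventually_at_right_field ..
  moreover have "(\<forall>h>0. h < \<delta> \<longrightarrow> \<phi> (t + s * h) = \<phi> t + of_int m * h) \<longleftrightarrow>
     (\<forall>h. 0 \<le> h \<and> h < \<delta> \<longrightarrow> \<phi> (t + s * h) = \<phi> t + of_int m * h)" if "\<delta> > 0" for \<delta>
    using that by (force simp: le_less)
  ultimately show ?thesis by blast
qed

lemma has_slopeI:
  assumes "\<delta> > 0" "\<And>h. 0 < h \<Longrightarrow> h < \<delta> \<Longrightarrow> \<phi> (t + s * h) = \<phi> t + of_int m * h"
  shows "has_slope \<phi> t s m"
  unfolding has_slope_def eventually_at_right_field using assms by blast

lemma has_slope_mono:
  assumes "has_slope \<phi> t s m" "has_slope \<psi> t s k" "\<phi> t \<le> \<psi> t + c" "\<psi> t + c \<le> \<phi> t"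
    and "\<forall>\<^sub>F h in at_right 0. \<psi> (t + s * h) + c \<le> \<phi> (t + s * h)"
  shows "k \<le> m"
proof -
  have "\<forall>\<^sub>F h in at_right (0::real). k \<le> m"
    using assms(1,2)[unfolded has_slope_def] assms(5) eventually_at_right_less[of 0]
  proof eventually_elim
    case (elim h)
    then have "of_int k * h \<le> of_int m * h" using assms(3,4) by linarith
    then show ?case using elim(4) by simp
  qed
  then show ?thesis by (simp add: eventually_const_iff)
qed

lemma has_slope_unique: "has_slope \<phi> t s m \<Longrightarrow> has_slope \<phi> t s k \<Longrightarrow> m = k"
  by (rule antisym; rule has_slope_mono[of \<phi> t s _ \<phi> _ 0]; simp)

lemma slope_eq: "has_slope \<phi> t s m \<Longrightarrow> slope \<phi> t s = m"
  unfolding slope_def using has_slope_unique by blast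

lemma has_slope_slope: "has_slope \<phi> t s m \<Longrightarrow> has_slope \<phi> t s (slope \<phi> t s)"
  using slope_eq by metis

lemma has_slope_cong:
  assumes "has_slope \<phi> t s m" "\<phi> t = \<psi> t" "\<forall>\<^sub>F h in at_right 0. \<phi> (t + s * h) = \<psi> (t + s * h)"
  shows "has_slope \<psi> t s m"
  using assms(1,3) unfolding has_slope_def by eventually_elim (use assms(2) in auto)

lemma has_slope_add:
  assumes "has_slope \<phi> t s m" "has_slope \<psi> t s k"
  shows "has_slope (\<lambda>t. \<phi> t + \<psi> t) t s (m + k)"
  using assms unfolding has_slope_def by eventually_elim (simp add: algebra_simps)

lemma has_slope_diff:
  assumes "has_slope \<phi> t s m" "has_slope \<psi> t s k"
  shows "has_slope (\<lambda>t. \<phi> t - \<psi> t) t s (m - k)"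
  using assms unfolding has_slope_def by eventually_elim (simp add: algebra_simps)

lemma has_slope_sum:
  assumes "finite B" "\<And>p. p \<in> B \<Longrightarrow> has_slope (\<phi> p) t s (k p)"
  shows "has_slope (\<lambda>t. \<Sum>p\<in>B. \<phi> p t) t s (\<Sum>p\<in>B. k p)"
  using assms
proof (induction B rule: finite_induct)
  case empty
  then show ?case by (simp add: has_slope_def)
next
  case (insert p B)
  then show ?case using has_slope_add[of "\<phi> p" t s "k p"] by simp
qed

lemma has_slope_affine:
  "has_slope (\<lambda>t. c + of_int m * t) t 1 m" "has_slope (\<lambda>t. c + of_int m * t) t (-1) (-m)"
  unfolding has_slope_def by (simp_all add: algebra_simps)

lemma has_slope_const: "has_slope (\<lambda>t. c) t s 0"
  unfolding has_slope_def by simp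

lemma has_slope_max:
  assumes "has_slope \<phi> t s m" "has_slope \<psi> t s k"
  shows "\<exists>j. has_slope (\<lambda>t. max (\<phi> t) (\<psi> t)) t s j"
proof -
  have *: "has_slope (\<lambda>t. max (\<phi> t) (\<psi> t)) t s m"
    if "has_slope \<phi> t s m" "has_slope \<psi> t s k" "\<psi> t < \<phi> t" for \<phi> \<psi> m k
  proof -
    obtain d where d: "d > 0" "\<And>h. 0 \<le> h \<Longrightarrow> h < d \<Longrightarrow> \<phi> (t + s * h) = \<phi> t + of_int m * h"
      using \<open>has_slope \<phi> t s m\<close> unfolding has_slope_iff by blast
    obtain d' where d': "d' > 0" "\<And>h. 0 \<le> h \<Longrightarrow> h < d' \<Longrightarrow> \<psi> (t + s * h) = \<psi> t + of_int k * h"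
      using \<open>has_slope \<psi> t s k\<close> unfolding has_slope_iff by blast
    \<comment> \<open>Each function changes by at most its absolute slope times \<open>h\<close>, so
      the gap at \<open>t\<close> cannot close before this bound; the extra 1 keeps the denominator
      positive.\<close>
    define \<epsilon> where "\<epsilon> = (\<phi> t - \<psi> t) / (\<bar>of_int m\<bar> + \<bar>of_int k\<bar> + 1)"
    have e0: "\<epsilon> > 0" unfolding \<epsilon>_def using that(3) by (intro divide_pos_pos) auto
    show ?thesis
    proof (rule has_slopeI[of "min d (min d' \<epsilon>)"])
      show "min d (min d' \<epsilon>) > 0" using d(1) d'(1) e0 by simp
      fix h assume h: "0 < h" "h < min d (min d' \<epsilon>)"
      have "h * (\<bar>of_int m\<bar> + \<bar>of_int k\<bar> + 1) < \<phi> t - \<psi> t"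
        using h unfolding \<epsilon>_def by (simp add: pos_less_divide_eq add_nonneg_pos)
      moreover have "of_int (k - m) * h \<le> h * (\<bar>of_int m\<bar> + \<bar>of_int k\<bar> + 1)"
      proof -
        have "of_int (k - m) \<le> (\<bar>of_int m\<bar> + \<bar>of_int k\<bar> + (1::real))" by simp
        then show ?thesis using h(1) by (simp add: mult.commute mult_left_mono)
      qed
      ultimately have "\<psi> t + of_int k * h \<le> \<phi> t + of_int m * h" by (simp add: algebra_simps)
      then show "max (\<phi> (t + s * h)) (\<psi> (t + s * h)) = max (\<phi> t) (\<psi> t) + of_int m * h"
        using d(2)[of h] d'(2)[of h] h that(3) by simp
    qed
  qed
  consider "\<psi> t < \<phi> t" | "\<phi> t < \<psi> t" | "\<phi> t = \<psi> t" by linarith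
  then show ?thesis
  proof cases
    case 1
    then show ?thesis using *[OF assms] by blast
  next
    case 2
    then show ?thesis using *[OF assms(2,1)] by (auto simp: max.commute)
  next
    case 3
    have "has_slope (\<lambda>t. max (\<phi> t) (\<psi> t)) t s (max m k)"
      using assms eventually_at_right_less[of 0] unfolding has_slope_def
    proof eventually_elim
      case (elim h)
      then have "max (of_int m * h) (of_int k * h) = of_int (max m k) * h"
        by (cases "m \<le> k") (auto simp: max_def)
      then show ?case using elim 3 by (simp add: max_add_distrib_right)
    qed
    then show ?thesis ..
  qed
qed

lemma pl_slope:
  assumes "pl L \<phi>"
  shows "0 \<le> t \<Longrightarrow> t < L \<Longrightarrow> has_slope \<phi> t 1 (slope \<phi> t 1)"
    and "0 < t \<Longrightarrow> t \<le> L \<Longrightarrow> has_slope \<phi> t (-1) (slope \<phi> t (-1))"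
  using assms has_slope_slope unfolding pl_def by blast+

lemma pl_cong:
  assumes "pl L \<phi>" "\<And>t. 0 \<le> t \<Longrightarrow> t \<le> L \<Longrightarrow> \<phi> t = \<psi> t"
  shows "pl L \<psi>"
proof -
  have "has_slope \<psi> t 1 m" if "has_slope \<phi> t 1 m" "0 \<le> t" "t < L" for t m
  proof (rule has_slope_cong[OF that(1)])
    show "\<forall>\<^sub>F h in at_right 0. \<phi> (t + 1 * h) = \<psi> (t + 1 * h)"
      unfolding eventually_at_right_field using assms(2) that
      by (intro exI[of _ "L - t"]) auto
  qed (use assms that in auto)
  moreover have "has_slope \<psi> t (-1) m" if "has_slope \<phi> t (-1) m" "0 < t" "t \<le> L" for t m
  proof (rule has_slope_cong[OF that(1)])
    show "\<forall>\<^sub>F h in at_right 0. \<phi> (t + -1 * h) = \<psi> (t + -1 * h)"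
      unfolding eventually_at_right_field using assms(2) that
      by (intro exI[of _ t]) auto
  qed (use assms that in auto)
  ultimately show ?thesis using assms(1) unfolding pl_def by blast
qed

lemma pl_add: "pl L \<phi> \<Longrightarrow> pl L \<psi> \<Longrightarrow> pl L (\<lambda>t. \<phi> t + \<psi> t)"
  unfolding pl_def using has_slope_add by blast

lemma pl_diff: "pl L \<phi> \<Longrightarrow> pl L \<psi> \<Longrightarrow> pl L (\<lambda>t. \<phi> t - \<psi> t)"
  unfolding pl_def using has_slope_diff by blast

lemma pl_max: "pl L \<phi> \<Longrightarrow> pl L \<psi> \<Longrightarrow> pl L (\<lambda>t. max (\<phi> t) (\<psi> t))"
  unfolding pl_def using has_slope_max by blast

lemma pl_affine: "pl L (\<lambda>t. c + of_int m * t)"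
  unfolding pl_def using has_slope_affine by blast

lemma pl_const: "pl L (\<lambda>t. c)"
  using pl_affine[of L c 0] by simp

lemma pl_Max:
  assumes "finite I" "I \<noteq> {}" "\<And>i. i \<in> I \<Longrightarrow> pl L (\<phi> i)"
  shows "pl L (\<lambda>t. Max ((\<lambda>i. \<phi> i t) ` I))"
  using assms
proof (induction I rule: finite_ne_induct)
  case (insert i I)
  then have "(\<lambda>t. Max ((\<lambda>i. \<phi> i t) ` insert i I)) = (\<lambda>t. max (\<phi> i t) (Max ((\<lambda>i. \<phi> i t) ` I)))"
    by auto
  then show ?case using insert pl_max by simp
qed simp

section \<open>Expansion of piecewise linear functions into ramps\<close>

definition canon :: "real \<Rightarrow> int \<Rightarrow> real set \<Rightarrow> (real \<Rightarrow> int) \<Rightarrow> real \<Rightarrow> real" where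
  "canon c m B d t = c + of_int m * t + (\<Sum>p\<in>B. of_int (d p) * max 0 (t - p))"

lemma has_slope_canon:
  assumes "finite B"
  shows "has_slope (canon c m B d) t 1 (m + (\<Sum>p | p \<in> B \<and> p \<le> t. d p))"
    and "has_slope (canon c m B d) t (-1) (- (m + (\<Sum>p | p \<in> B \<and> p < t. d p)))"
proof -
  have r: "has_slope (\<lambda>t. of_int (d p) * max 0 (t - p)) t 1 (if p \<le> t then d p else 0)" for p
    by (rule has_slopeI[of "if p \<le> t then 1 else p - t"]) (auto simp: max_def algebra_simps)
  have l: "has_slope (\<lambda>t. of_int (d p) * max 0 (t - p)) t (-1) (if p < t then - d p else 0)" for p
    by (rule has_slopeI[of "if p < t then t - p else 1"]) (auto simp: max_def algebra_simps)
  have "canon c m B d = (\<lambda>t. (c + of_int m * t) + (\<Sum>p\<in>B. of_int (d p) * max 0 (t - p)))"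
    unfolding canon_def by auto
  then show "has_slope (canon c m B d) t 1 (m + (\<Sum>p | p \<in> B \<and> p \<le> t. d p))"
    and "has_slope (canon c m B d) t (-1) (- (m + (\<Sum>p | p \<in> B \<and> p < t. d p)))"
    using has_slope_add[OF has_slope_affine(1)[of c m t] has_slope_sum[OF assms r[of _]]]
     has_slope_add[OF has_slope_affine(2)[of c m t] has_slope_sum[OF assms l[of _]]]
    by (simp_all add: sum.If_cases[OF assms] Int_def sum_negf)
qed

lemma pl_canon: "finite B \<Longrightarrow> pl L (canon c m B d)"
  unfolding pl_def using has_slope_canon by blast

lemma canon_glue:
  assumes "finite B1" "B1 \<subseteq> {x<..<y}" "\<And>t. t \<in> {x..y} \<Longrightarrow> \<phi> t = canon c1 m1 B1 d1 t"
    and "finite B2" "B2 \<subseteq> {y<..<z}" "\<And>t. t \<in> {y..z} \<Longrightarrow> \<phi> t = canon c2 m2 B2 d2 t"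
    and "x < y" "y < z"
  shows "\<exists>c m B d. finite B \<and> B \<subseteq> {x<..<z} \<and> (\<forall>t\<in>{x..z}. \<phi> t = canon c m B d t)"
proof -
  \<comment> \<open>At \<open>y\<close> the slope passes from \<open>m1 + sum d1 B1\<close>, the
    final slope of the left piece, to \<open>m2\<close>.\<close>
  define d where "d p = (if p \<in> B1 then d1 p else if p = y then m2 - m1 - sum d1 B1 else d2 p)" for p
  have disj: "y \<notin> B1" "y \<notin> B2" "B1 \<inter> B2 = {}" using assms(2,5) by force+
  have eq: "canon c1 m1 (B1 \<union> insert y B2) d t = c1 + of_int m1 * t + (\<Sum>p\<in>B1. of_int (d1 p) * max 0 (t - p))
     + of_int (m2 - m1 - sum d1 B1) * max 0 (t - y) + (\<Sum>p\<in>B2. of_int (d2 p) * max 0 (t - p))" for t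
  proof -
    have "(\<Sum>p\<in>B1. of_int (d p) * max 0 (t - p)) = (\<Sum>p\<in>B1. of_int (d1 p) * max 0 (t - p))"
      by (rule sum.cong) (auto simp: d_def)
    moreover have "(\<Sum>p\<in>B2. of_int (d p) * max 0 (t - p)) = (\<Sum>p\<in>B2. of_int (d2 p) * max 0 (t - p))"
      by (rule sum.cong) (use disj in \<open>auto simp: d_def\<close>)
    ultimately show ?thesis
      unfolding canon_def using assms(1,4) disj
      by (subst sum.union_disjoint) (auto simp: d_def)
  qed
  have "\<phi> t = canon c1 m1 (B1 \<union> insert y B2) d t" if t: "t \<in> {x..z}" for t
  proof (cases "t \<le> y")
    case True
    have "(\<Sum>p\<in>B2. of_int (d2 p) * max 0 (t - p)) = 0"
      by (rule sum.neutral) (use True assms(5) in force)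
    then show ?thesis using assms(3)[of t] t True unfolding eq by (simp add: canon_def)
  next
    case False
    have 1: "(\<Sum>p\<in>B1. of_int (d1 p) * max 0 (t' - p)) = (\<Sum>p\<in>B1. of_int (d1 p) * (y - p)) + of_int (sum d1 B1) * (t' - y)"
      if "t' \<ge> y" for t'
    proof -
      have "(\<Sum>p\<in>B1. of_int (d1 p) * max 0 (t' - p)) = (\<Sum>p\<in>B1. of_int (d1 p) * (y - p) + of_int (d1 p) * (t' - y))"
      proof (rule sum.cong)
        fix p assume "p \<in> B1"
        then have "p < y" using assms(2) by auto
        then show "of_int (d1 p) * max 0 (t' - p) = of_int (d1 p) * (y - p) + of_int (d1 p) * (t' - y)"
          using that by (simp add: algebra_simps)
      qed simp
      then show ?thesis by (simp add: sum.distrib sum_distrib_right)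
    qed
    have 2: "(\<Sum>p\<in>B2. of_int (d2 p) * max 0 (y - p)) = 0"
      by (rule sum.neutral) (use assms(5) in force)
    have "\<phi> y = c1 + of_int m1 * y + (\<Sum>p\<in>B1. of_int (d1 p) * (y - p))"
      using assms(3)[of y] assms(7) 1[of y] by (simp add: canon_def)
    moreover have "\<phi> y = c2 + of_int m2 * y"
      using assms(6)[of y] assms(8) 2 by (simp add: canon_def)
    moreover have "\<phi> t = c2 + of_int m2 * t + (\<Sum>p\<in>B2. of_int (d2 p) * max 0 (t - p))"
      using assms(6)[of t] t False by (simp add: canon_def)
    ultimately show ?thesis unfolding eq using 1[of t] False by (simp add: algebra_simps)
  qed
  moreover have "finite (B1 \<union> insert y B2)" "B1 \<union> insert y B2 \<subseteq> {x<..<z}"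
    using assms by auto
  ultimately show ?thesis by blast
qed

text \<open>Near each point local linearity gives an expansion without breakpoints on either side,
  and expansions can be glued at a common end. Bisection with \<open>Bolzano\<close> makes this
  global, so compactness turns local linearity into finitely many breakpoints.\<close>

lemma pl_imp_canon:
  assumes "pl L \<phi>" "0 \<le> L"
  shows "\<exists>c m B d. finite B \<and> B \<subseteq> {0<..<L} \<and> (\<forall>t\<in>{0..L}. \<phi> t = canon c m B d t)"
proof -
  define Q where "Q x y \<longleftrightarrow> (0 \<le> x \<and> x \<le> y \<and> y \<le> L \<longrightarrow>
     (\<exists>c m B d. finite B \<and> B \<subseteq> {x<..<y} \<and> (\<forall>t\<in>{x..y}. \<phi> t = canon c m B d t)))" for x y
  have Q_trans: "Q x z" if "Q x y" "Q y z" "x \<le> y" "y \<le> z" for x y z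
  proof (cases "0 \<le> x \<and> z \<le> L \<and> x < y \<and> y < z")
    case True
    obtain c1 m1 B1 d1 where
      1: "finite B1" "B1 \<subseteq> {x<..<y}" "\<And>t. t \<in> {x..y} \<Longrightarrow> \<phi> t = canon c1 m1 B1 d1 t"
      using \<open>Q x y\<close> True unfolding Q_def by auto
    obtain c2 m2 B2 d2 where
      2: "finite B2" "B2 \<subseteq> {y<..<z}" "\<And>t. t \<in> {y..z} \<Longrightarrow> \<phi> t = canon c2 m2 B2 d2 t"
      using \<open>Q y z\<close> True unfolding Q_def by auto
    from canon_glue[OF 1 2] True show ?thesis unfolding Q_def by blast
  next
    case False
    then show ?thesis using that unfolding Q_def by (cases "x = y"; cases "y = z") auto
  qed
  have Q_lin: "Q x y" if "\<And>t. t \<in> {x..y} \<Longrightarrow> \<phi> t = c + of_int m * t" for x y c m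
    unfolding Q_def using that by (intro impI exI[of _ c] exI[of _ m] exI[of _ "{}"]) (auto simp: canon_def)
  have "Q 0 L"
  proof (rule Bolzano[OF assms(2)])
    show "\<And>a b c. Q a b \<Longrightarrow> Q b c \<Longrightarrow> a \<le> b \<Longrightarrow> b \<le> c \<Longrightarrow> Q a c" by (rule Q_trans)
    fix x assume x: "0 \<le> x" "x \<le> L"
    have "\<exists>d>0. \<forall>y. x \<le> y \<and> y - x < d \<longrightarrow> Q x y"
    proof (cases "x < L")
      case True
      then have "has_slope \<phi> x 1 (slope \<phi> x 1)" using pl_slope(1)[OF assms(1)] x by simp
      then obtain m d where d: "d > 0" "\<And>h. 0 \<le> h \<Longrightarrow> h < d \<Longrightarrow> \<phi> (x + 1 * h) = \<phi> x + of_int m * h"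
        unfolding has_slope_iff by blast
      have "Q x y" if "x \<le> y \<and> y - x < d" for y
      proof (rule Q_lin[of _ _ "\<phi> x - of_int m * x" m])
        fix t assume "t \<in> {x..y}"
        then show "\<phi> t = \<phi> x - of_int m * x + of_int m * t"
          using d(2)[of "t - x"] that by (simp add: algebra_simps)
      qed
      then show ?thesis using d(1) by blast
    next
      case False
      then have "Q x y" if "x \<le> y" for y
        using Q_lin[of x x "\<phi> x" 0] that x unfolding Q_def by force
      then show ?thesis by (intro exI[of _ 1]) auto
    qed
    then obtain d1 where d1: "d1 > 0" "\<And>y. x \<le> y \<Longrightarrow> y - x < d1 \<Longrightarrow> Q x y" by blast
    have "\<exists>d>0. \<forall>y. y \<le> x \<and> x - y < d \<longrightarrow> Q y x"
    proof (cases "0 < x")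
      case True
      then have "has_slope \<phi> x (-1) (slope \<phi> x (-1))" using pl_slope(2)[OF assms(1)] x by simp
      then obtain m d where d: "d > 0" "\<And>h. 0 \<le> h \<Longrightarrow> h < d \<Longrightarrow> \<phi> (x + -1 * h) = \<phi> x + of_int m * h"
        unfolding has_slope_iff by blast
      have "Q y x" if "y \<le> x \<and> x - y < d" for y
      proof (rule Q_lin[of _ _ "\<phi> x + of_int m * x" "-m"])
        fix t assume "t \<in> {y..x}"
        then show "\<phi> t = \<phi> x + of_int m * x + of_int (-m) * t"
          using d(2)[of "x - t"] that by (simp add: algebra_simps)
      qed
      then show ?thesis using d(1) by blast
    next
      case False
      then have "Q y x" if "y \<le> x" for y
        using Q_lin[of x x "\<phi> x" 0] that x unfolding Q_def by force
      then show ?thesis by (intro exI[of _ 1]) auto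
    qed
    then obtain d2 where d2: "d2 > 0" "\<And>y. y \<le> x \<Longrightarrow> x - y < d2 \<Longrightarrow> Q y x" by blast
    show "\<exists>d>0. \<forall>a b. a \<le> x \<and> x \<le> b \<and> b - a < d \<longrightarrow> Q a b"
    proof (intro exI[of _ "min d1 d2"] conjI allI impI)
      fix a b assume "a \<le> x \<and> x \<le> b \<and> b - a < min d1 d2"
      then show "Q a b" using Q_trans[OF d2(2)[of a] d1(2)[of b]] by auto
    qed (use d1 d2 in auto)
  qed
  then show ?thesis unfolding Q_def using assms(2) by simp
qed

lemma slope_cong:
  assumes "\<And>t. 0 \<le> t \<Longrightarrow> t \<le> L \<Longrightarrow> \<phi> t = \<psi> t" "has_slope \<phi> t s m"
    and "s = 1 \<and> 0 \<le> t \<and> t < L \<or> s = -1 \<and> 0 < t \<and> t \<le> L"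
  shows "has_slope \<psi> t s m"
proof (rule has_slope_cong[OF assms(2)])
  show "\<phi> t = \<psi> t" using assms by auto
  show "\<forall>\<^sub>F h in at_right 0. \<phi> (t + s * h) = \<psi> (t + s * h)"
    unfolding eventually_at_right_field using assms(3)
  proof
    assume "s = 1 \<and> 0 \<le> t \<and> t < L"
    then show "\<exists>b>0. \<forall>y>0. y < b \<longrightarrow> \<phi> (t + s * y) = \<psi> (t + s * y)"
      using assms(1) by (intro exI[of _ "L - t"]) auto
  next
    assume "s = -1 \<and> 0 < t \<and> t \<le> L"
    then show "\<exists>b>0. \<forall>y>0. y < b \<longrightarrow> \<phi> (t + s * y) = \<psi> (t + s * y)"
      using assms(1) by (intro exI[of _ t]) auto
  qed
qed

text \<open>The ramp expansion with its coefficients identified intrinsically as the initial slope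
  and the kinks of the function itself. \<open>B\<close> may contain points of kink 0.\<close>

definition pl_form :: "real \<Rightarrow> (real \<Rightarrow> real) \<Rightarrow> real set \<Rightarrow> bool" where
  "pl_form L \<phi> B \<longleftrightarrow> finite B \<and> B \<subseteq> {0<..<L} \<and>
     (\<forall>t. 0 \<le> t \<longrightarrow> t \<le> L \<longrightarrow>
       \<phi> t = \<phi> 0 + of_int (slope \<phi> 0 1) * t + (\<Sum>p\<in>B. of_int (kink \<phi> p) * max 0 (t - p))) \<and>
     (\<forall>t. 0 \<le> t \<longrightarrow> t < L \<longrightarrow> slope \<phi> t 1 = slope \<phi> 0 1 + (\<Sum>p | p \<in> B \<and> p \<le> t. kink \<phi> p)) \<and>
     (\<forall>t. 0 < t \<longrightarrow> t \<le> L \<longrightarrow> slope \<phi> t (-1) = - (slope \<phi> 0 1 + (\<Sum>p | p \<in> B \<and> p < t. kink \<phi> p))) \<and>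
     (\<forall>t. 0 < t \<longrightarrow> t < L \<longrightarrow> t \<notin> B \<longrightarrow> kink \<phi> t = 0)"

lemma pl_canonical_form:
  assumes "pl L \<phi>" "0 < L"
  shows "\<exists>B. pl_form L \<phi> B"
proof -
  obtain c m B d where B: "finite B" "B \<subseteq> {0<..<L}" and
    eq: "\<And>t. t \<in> {0..L} \<Longrightarrow> \<phi> t = canon c m B d t"
    using pl_imp_canon[OF assms(1)] assms(2) by auto
  have r: "slope \<phi> t 1 = m + (\<Sum>p | p \<in> B \<and> p \<le> t. d p)" if "0 \<le> t" "t < L" for t
    by (rule slope_eq, rule slope_cong[OF _ has_slope_canon(1)[OF B(1)], where L = L])
      (use eq that in auto)
  have l: "slope \<phi> t (-1) = - (m + (\<Sum>p | p \<in> B \<and> p < t. d p))" if "0 < t" "t \<le> L" for t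
    by (rule slope_eq, rule slope_cong[OF _ has_slope_canon(2)[OF B(1)], where L = L])
      (use eq that in auto)
  have "{p. p \<in> B \<and> p \<le> 0} = {}" using B(2) by auto
  then have m: "slope \<phi> 0 1 = m" using r[of 0] assms(2) by (simp only: sum.empty)
  have k: "kink \<phi> t = (if t \<in> B then d t else 0)" if "0 < t" "t < L" for t
  proof -
    have "{p. p \<in> B \<and> p \<le> t} = (if t \<in> B then insert t {p. p \<in> B \<and> p < t} else {p. p \<in> B \<and> p < t})"
      by (auto simp: order_le_less)
    then show ?thesis unfolding kink_def using r[of t] l[of t] that B(1) by simp
  qed
  have k': "kink \<phi> p = d p" if "p \<in> B" for p using k[of p] that B(2) by auto
  have c: "\<phi> 0 = c"
  proof -
    have "(\<Sum>p\<in>B. of_int (d p) * max 0 (0 - p)) = 0" by (rule sum.neutral) (use B(2) in force)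
    then show ?thesis using eq[of 0] assms(2) unfolding canon_def by simp
  qed
  show ?thesis
    unfolding pl_form_def
  proof (intro exI[of _ B] conjI allI impI)
    fix t assume t: "0 \<le> t" "t \<le> L"
    show "\<phi> t = \<phi> 0 + of_int (slope \<phi> 0 1) * t + (\<Sum>p\<in>B. of_int (kink \<phi> p) * max 0 (t - p))"
      using eq[of t] t unfolding m c canon_def by (simp add: k' cong: sum.cong)
  next
    fix t assume "0 \<le> t" "t < L"
    then show "slope \<phi> t 1 = slope \<phi> 0 1 + (\<Sum>p | p \<in> B \<and> p \<le> t. kink \<phi> p)"
      using r[of t] sum.cong[of "{p. p \<in> B \<and> p \<le> t}" _ "kink \<phi>" d] k' unfolding m by auto
  next
    fix t assume "0 < t" "t \<le> L"
    then show "slope \<phi> t (-1) = - (slope \<phi> 0 1 + (\<Sum>p | p \<in> B \<and> p < t. kink \<phi> p))"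
      using l[of t] sum.cong[of "{p. p \<in> B \<and> p < t}" _ "kink \<phi>" d] k' unfolding m by auto
  qed (use B k in auto)
qed

lemma pl_finite_kinks:
  assumes "pl L \<phi>" "0 < L"
  shows "finite {t. 0 < t \<and> t < L \<and> kink \<phi> t \<noteq> 0}"
proof -
  obtain B where "finite B" "B \<subseteq> {0<..<L}" "\<And>t. 0 < t \<Longrightarrow> t < L \<Longrightarrow> t \<notin> B \<Longrightarrow> kink \<phi> t = 0"
    using pl_canonical_form[OF assms] unfolding pl_form_def by blast
  then show ?thesis by (auto intro: finite_subset[of _ B])
qed

text \<open>Passing a breakpoint adds its kink to the slope, so the slope leaving 0 plus all kinks
  is the slope arriving at \<open>L\<close>, and this is minus the slope leaving \<open>L\<close>
  backwards. It is the contribution of one edge to the degree of a principal divisor.\<close>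

lemma pl_kinks_sum:
  assumes "pl L \<phi>" "0 < L" "finite T" "T \<subseteq> {0<..<L}"
    and "\<And>t. 0 < t \<Longrightarrow> t < L \<Longrightarrow> kink \<phi> t \<noteq> 0 \<Longrightarrow> t \<in> T"
  shows "slope \<phi> 0 1 + slope \<phi> L (-1) + (\<Sum>t\<in>T. kink \<phi> t) = 0"
proof -
  obtain B where form: "pl_form L \<phi> B" using pl_canonical_form[OF assms(1,2)] by blast
  have B: "finite B" "B \<subseteq> {0<..<L}" and
    eq: "\<And>t. 0 \<le> t \<Longrightarrow> t \<le> L \<Longrightarrow>
       \<phi> t = \<phi> 0 + of_int (slope \<phi> 0 1) * t + (\<Sum>p\<in>B. of_int (kink \<phi> p) * max 0 (t - p))" and
    r: "\<And>t. 0 \<le> t \<Longrightarrow> t < L \<Longrightarrow> slope \<phi> t 1 = slope \<phi> 0 1 + (\<Sum>p | p \<in> B \<and> p \<le> t. kink \<phi> p)" and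
    l: "\<And>t. 0 < t \<Longrightarrow> t \<le> L \<Longrightarrow> slope \<phi> t (-1) = - (slope \<phi> 0 1 + (\<Sum>p | p \<in> B \<and> p < t. kink \<phi> p))" and
    nk: "\<And>t. 0 < t \<Longrightarrow> t < L \<Longrightarrow> t \<notin> B \<Longrightarrow> kink \<phi> t = 0"
    using form unfolding pl_form_def by blast+
  note B = B l[OF assms(2) order_refl] nk
  have "{p. p \<in> B \<and> p < L} = B" using B(2) by auto
  moreover have "sum (kink \<phi>) B = sum (kink \<phi>) (B \<inter> T)" "sum (kink \<phi>) T = sum (kink \<phi>) (B \<inter> T)"
    by (rule sum.mono_neutral_right; use B assms(3-) in force)+
  ultimately show ?thesis using B(3) by simp
qed

lemma pl_linear_between:
  assumes "pl L \<phi>" "0 < L" "0 \<le> a" "a < b" "b \<le> L"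
    and "\<And>t. a < t \<Longrightarrow> t < b \<Longrightarrow> kink \<phi> t = 0"
  shows "\<And>t. a \<le> t \<Longrightarrow> t \<le> b \<Longrightarrow> \<phi> t = \<phi> a + of_int (slope \<phi> a 1) * (t - a)"
    and "slope \<phi> b (-1) = - slope \<phi> a 1"
proof -
  obtain B where form: "pl_form L \<phi> B" using pl_canonical_form[OF assms(1,2)] by blast
  have B: "finite B" "B \<subseteq> {0<..<L}" and
    eq: "\<And>t. 0 \<le> t \<Longrightarrow> t \<le> L \<Longrightarrow>
       \<phi> t = \<phi> 0 + of_int (slope \<phi> 0 1) * t + (\<Sum>p\<in>B. of_int (kink \<phi> p) * max 0 (t - p))" and
    r: "\<And>t. 0 \<le> t \<Longrightarrow> t < L \<Longrightarrow> slope \<phi> t 1 = slope \<phi> 0 1 + (\<Sum>p | p \<in> B \<and> p \<le> t. kink \<phi> p)" and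
    l: "\<And>t. 0 < t \<Longrightarrow> t \<le> L \<Longrightarrow> slope \<phi> t (-1) = - (slope \<phi> 0 1 + (\<Sum>p | p \<in> B \<and> p < t. kink \<phi> p))" and
    nk: "\<And>t. 0 < t \<Longrightarrow> t < L \<Longrightarrow> t \<notin> B \<Longrightarrow> kink \<phi> t = 0"
    using form unfolding pl_form_def by blast+
  have "(\<Sum>p | p \<in> B \<and> p < b. kink \<phi> p) = (\<Sum>p | p \<in> B \<and> p \<le> a. kink \<phi> p)"
  proof (rule sum.mono_neutral_right)
    show "\<forall>p\<in>{p. p \<in> B \<and> p < b} - {p. p \<in> B \<and> p \<le> a}. kink \<phi> p = 0"
    proof
      fix p assume "p \<in> {p. p \<in> B \<and> p < b} - {p. p \<in> B \<and> p \<le> a}"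
      then show "kink \<phi> p = 0" using assms(6)[of p] by (cases "p \<le> a") auto
    qed
  qed (use B assms(4) in auto)
  then show "slope \<phi> b (-1) = - slope \<phi> a 1" using l[of b] r[of a] assms by simp
  fix t assume t: "a \<le> t" "t \<le> b"
  have "(\<Sum>p\<in>B. of_int (kink \<phi> p) * max 0 (t - p)) - (\<Sum>p\<in>B. of_int (kink \<phi> p) * max 0 (a - p))
     = (\<Sum>p\<in>B. of_int (kink \<phi> p) * (max 0 (t - p) - max 0 (a - p)))"
    by (simp add: sum_subtractf algebra_simps)
  also have "\<dots> = (\<Sum>p | p \<in> B \<and> p \<le> a. of_int (kink \<phi> p) * (t - a))"
  proof (rule sum.mono_neutral_cong_right)
    show "\<forall>p\<in>B - {p. p \<in> B \<and> p \<le> a}. of_int (kink \<phi> p) * (max 0 (t - p) - max 0 (a - p)) = (0::real)"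
    proof
      fix p assume "p \<in> B - {p. p \<in> B \<and> p \<le> a}"
      then show "of_int (kink \<phi> p) * (max 0 (t - p) - max 0 (a - p)) = (0::real)"
        using assms(6)[of p] t by (cases "p < b") auto
    qed
  qed (use B t in auto)
  also have "\<dots> = of_int (\<Sum>p | p \<in> B \<and> p \<le> a. kink \<phi> p) * (t - a)"
    by (simp add: sum_distrib_right)
  finally show "\<phi> t = \<phi> a + of_int (slope \<phi> a 1) * (t - a)"
    using eq[of t] eq[of a] r[of a] assms t by (simp add: algebra_simps)
qed

text \<open>With nonnegative kinks the function is affine plus nonnegative multiples of ramps, and
  each ramp lies above its supporting lines at \<open>t\<close>.\<close>

lemma pl_convex:
  assumes "pl L \<phi>" "0 < L" "\<And>t. 0 < t \<Longrightarrow> t < L \<Longrightarrow> 0 \<le> kink \<phi> t" "0 \<le> t" "t \<le> L" "0 \<le> u" "u \<le> L"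
  shows "t < L \<Longrightarrow> \<phi> t + of_int (slope \<phi> t 1) * (u - t) \<le> \<phi> u"
    and "0 < t \<Longrightarrow> \<phi> t + of_int (slope \<phi> t (-1)) * (t - u) \<le> \<phi> u"
proof -
  obtain B where form: "pl_form L \<phi> B" using pl_canonical_form[OF assms(1,2)] by blast
  have B: "finite B" "B \<subseteq> {0<..<L}" and
    eq: "\<And>t. 0 \<le> t \<Longrightarrow> t \<le> L \<Longrightarrow>
       \<phi> t = \<phi> 0 + of_int (slope \<phi> 0 1) * t + (\<Sum>p\<in>B. of_int (kink \<phi> p) * max 0 (t - p))" and
    r: "\<And>t. 0 \<le> t \<Longrightarrow> t < L \<Longrightarrow> slope \<phi> t 1 = slope \<phi> 0 1 + (\<Sum>p | p \<in> B \<and> p \<le> t. kink \<phi> p)" and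
    l: "\<And>t. 0 < t \<Longrightarrow> t \<le> L \<Longrightarrow> slope \<phi> t (-1) = - (slope \<phi> 0 1 + (\<Sum>p | p \<in> B \<and> p < t. kink \<phi> p))" and
    nk: "\<And>t. 0 < t \<Longrightarrow> t < L \<Longrightarrow> t \<notin> B \<Longrightarrow> kink \<phi> t = 0"
    using form unfolding pl_form_def by blast+
  have k: "0 \<le> kink \<phi> p" if "p \<in> B" for p using assms(3) B(2) that by auto
  have diff: "\<phi> u - \<phi> t = of_int (slope \<phi> 0 1) * (u - t)
      + (\<Sum>p\<in>B. of_int (kink \<phi> p) * (max 0 (u - p) - max 0 (t - p)))"
    using eq[of u] eq[of t] assms by (simp add: sum_subtractf algebra_simps)
  \<comment> \<open>\<open>C\<close> collects the ramps counted with slope 1 at \<open>t\<close>. A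
    ramp that breaks at \<open>t\<close> itself may be counted or not: counting it yields the right
    slope, omitting it the left one.\<close>
  have main: "(\<Sum>p\<in>B. of_int (kink \<phi> p) * (max 0 (u - p) - max 0 (t - p))) \<ge> of_int (\<Sum>p\<in>C. kink \<phi> p) * (u - t)"
    if "C \<subseteq> B" "\<And>p. p \<in> C \<Longrightarrow> p \<le> t" "\<And>p. p \<in> B - C \<Longrightarrow> t \<le> p" for C
  proof -
    have "of_int (\<Sum>p\<in>C. kink \<phi> p) * (u - t) = (\<Sum>p\<in>C. of_int (kink \<phi> p) * (u - t))"
      by (simp add: sum_distrib_right)
    also have "\<dots> = (\<Sum>p\<in>B. of_int (kink \<phi> p) * (if p \<in> C then u - t else 0))"
      using that(1) B(1) by (intro sum.mono_neutral_cong_left) auto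
    also have "\<dots> \<le> (\<Sum>p\<in>B. of_int (kink \<phi> p) * (max 0 (u - p) - max 0 (t - p)))"
    proof (intro sum_mono mult_left_mono)
      fix p assume "p \<in> B"
      then show "(if p \<in> C then u - t else 0) \<le> max 0 (u - p) - max 0 (t - p)"
        using that(2)[of p] that(3)[of p] by (cases "p \<in> C") auto
    qed (use k in auto)
    finally show ?thesis .
  qed
  show "\<phi> t + of_int (slope \<phi> t 1) * (u - t) \<le> \<phi> u" if "t < L"
  proof -
    have "of_int (\<Sum>p | p \<in> B \<and> p \<le> t. kink \<phi> p) * (u - t) \<le>
        (\<Sum>p\<in>B. of_int (kink \<phi> p) * (max 0 (u - p) - max 0 (t - p)))"
      by (rule main) auto
    moreover have "of_int (slope \<phi> t 1) * (u - t) = of_int (slope \<phi> 0 1) * (u - t)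
        + of_int (\<Sum>p | p \<in> B \<and> p \<le> t. kink \<phi> p) * (u - t)"
      unfolding r[OF assms(4) that] by (simp only: of_int_add distrib_right)
    ultimately show ?thesis using diff by linarith
  qed
  show "\<phi> t + of_int (slope \<phi> t (-1)) * (t - u) \<le> \<phi> u" if "0 < t"
  proof -
    have "of_int (\<Sum>p | p \<in> B \<and> p < t. kink \<phi> p) * (u - t) \<le>
        (\<Sum>p\<in>B. of_int (kink \<phi> p) * (max 0 (u - p) - max 0 (t - p)))"
      by (rule main) auto
    moreover have neg: "of_int (- (x + y)) * (t - u) = of_int x * (u - t) + of_int y * (u - t)" for x y
      by (simp add: algebra_simps)
    have "of_int (slope \<phi> t (-1)) * (t - u) = of_int (slope \<phi> 0 1) * (u - t)
        + of_int (\<Sum>p | p \<in> B \<and> p < t. kink \<phi> p) * (u - t)"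
      unfolding l[OF that assms(5)] by (rule neg)
    ultimately show ?thesis using diff by linarith
  qed
qed

lemma pl_continuous:
  assumes "pl L \<phi>" "0 \<le> L"
  shows "continuous_on {0..L} \<phi>"
proof -
  obtain c m B d where "\<And>t. t \<in> {0..L} \<Longrightarrow> \<phi> t = canon c m B d t"
    using pl_imp_canon[OF assms] by blast
  moreover have "continuous_on {0..L} (canon c m B d)"
    unfolding canon_def by (intro continuous_intros)
  ultimately show ?thesis using continuous_on_cong by metis
qed

lemma has_slope_linear:
  assumes "a < b" "\<And>u. a \<le> u \<Longrightarrow> u \<le> b \<Longrightarrow> \<phi> u = c + of_int m * u"
  shows "has_slope \<phi> a 1 m" "has_slope \<phi> b (-1) (- m)"
proof -
  show "has_slope \<phi> a 1 m"
    by (rule has_slopeI[of "b - a"]) (use assms in \<open>auto simp: algebra_simps\<close>)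
  show "has_slope \<phi> b (-1) (- m)"
    by (rule has_slopeI[of "b - a"]) (use assms in \<open>auto simp: algebra_simps\<close>)
qed

lemma continuous_linear_closure:
  fixes \<phi> :: "real \<Rightarrow> real"
  assumes "continuous_on {a..b} \<phi>" "a < b" "\<And>u. a < u \<Longrightarrow> u < b \<Longrightarrow> \<phi> u = of_int m * u + c"
    and "a \<le> u" "u \<le> b"
  shows "\<phi> u = c + of_int m * u"
proof -
  have "\<phi> u - of_int m * u = c"
  proof (rule continuous_constant_on_closure[of "{a<..<b}" "\<lambda>u. \<phi> u - of_int m * u"])
    show "continuous_on (closure {a<..<b}) (\<lambda>u. \<phi> u - of_int m * u)"
      using assms(1,2) by (auto intro!: continuous_intros)
  qed (use assms in auto)
  then show ?thesis by simp
qed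

lemma pl_lipschitz:
  assumes "pl L \<phi>" "\<And>t. 0 \<le> t \<Longrightarrow> t < L \<Longrightarrow> \<bar>slope \<phi> t 1\<bar> \<le> C"
    and "\<And>t. 0 < t \<Longrightarrow> t \<le> L \<Longrightarrow> \<bar>slope \<phi> t (-1)\<bar> \<le> C"
    and "0 \<le> t" "t \<le> u" "u \<le> L"
  shows "\<bar>\<phi> u - \<phi> t\<bar> \<le> of_int C * (u - t)"
proof -
  define Q where "Q x y \<longleftrightarrow> (0 \<le> x \<and> x \<le> y \<and> y \<le> L \<longrightarrow> \<bar>\<phi> y - \<phi> x\<bar> \<le> of_int C * (y - x))" for x y
  have Q_trans: "Q a c" if "Q a b" "Q b c" "a \<le> b" "b \<le> c" for a b c
  proof -
    have "of_int C * (c - a) = of_int C * (c - b) + of_int C * (b - a)" by (simp add: algebra_simps)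
    then show ?thesis using that unfolding Q_def by auto
  qed
  have "Q t u"
  proof (rule Bolzano[OF assms(5)])
    show "\<And>a b c. Q a b \<Longrightarrow> Q b c \<Longrightarrow> a \<le> b \<Longrightarrow> b \<le> c \<Longrightarrow> Q a c" by (rule Q_trans)
    fix x assume x: "t \<le> x" "x \<le> u"
    have bnd: "\<bar>of_int m * h\<bar> \<le> of_int C * h" if "\<bar>m\<bar> \<le> C" "0 \<le> h" for m and h :: real
    proof -
      have "\<bar>of_int m\<bar> \<le> (of_int C :: real)" using that(1) by linarith
      then show ?thesis using that(2) by (simp add: abs_mult mult_right_mono)
    qed
    have "\<exists>d>0. \<forall>y. x \<le> y \<and> y - x < d \<longrightarrow> Q x y"
    proof (cases "x < L")
      case True
      then have s: "has_slope \<phi> x 1 (slope \<phi> x 1)" using pl_slope(1)[OF assms(1)] x assms(4) by simp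
      then obtain d where d: "d > 0" "\<And>h. 0 \<le> h \<Longrightarrow> h < d \<Longrightarrow> \<phi> (x + 1 * h) = \<phi> x + of_int (slope \<phi> x 1) * h"
        unfolding has_slope_iff by blast
      have "Q x y" if "x \<le> y \<and> y - x < d" for y
        using d(2)[of "y - x"] that bnd[of "slope \<phi> x 1" "y - x"] assms(2)[of x] x True assms(4) unfolding Q_def
        by simp
      then show ?thesis using d(1) by blast
    next
      case False
      have "Q x y" if "x \<le> y" for y
        unfolding Q_def
      proof
        assume "0 \<le> x \<and> x \<le> y \<and> y \<le> L"
        then have "y = x" using False by linarith
        then show "\<bar>\<phi> y - \<phi> x\<bar> \<le> of_int C * (y - x)" by simp
      qed
      then show ?thesis by (intro exI[of _ 1]) auto
    qed
    then obtain d1 where d1: "d1 > 0" "\<And>y. x \<le> y \<Longrightarrow> y - x < d1 \<Longrightarrow> Q x y" by blast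
    have "\<exists>d>0. \<forall>y. y \<le> x \<and> x - y < d \<longrightarrow> Q y x"
    proof (cases "0 < x")
      case True
      then have "has_slope \<phi> x (-1) (slope \<phi> x (-1))" using pl_slope(2)[OF assms(1)] x assms(6) by simp
      then obtain d where d: "d > 0" "\<And>h. 0 \<le> h \<Longrightarrow> h < d \<Longrightarrow> \<phi> (x + -1 * h) = \<phi> x + of_int (slope \<phi> x (-1)) * h"
        unfolding has_slope_iff by blast
      have "Q y x" if "y \<le> x \<and> x - y < d" for y
        using d(2)[of "x - y"] that bnd[of "slope \<phi> x (-1)" "x - y"] assms(3)[of x] x True assms(6) unfolding Q_def
        by simp
      then show ?thesis using d(1) by blast
    next
      case False
      have "Q y x" if "y \<le> x" for y
        unfolding Q_def
      proof
        assume "0 \<le> y \<and> y \<le> x \<and> x \<le> L"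
        then have "y = x" using False by linarith
        then show "\<bar>\<phi> x - \<phi> y\<bar> \<le> of_int C * (x - y)" by simp
      qed
      then show ?thesis by (intro exI[of _ 1]) auto
    qed
    then obtain d2 where d2: "d2 > 0" "\<And>y. y \<le> x \<Longrightarrow> x - y < d2 \<Longrightarrow> Q y x" by blast
    show "\<exists>d>0. \<forall>a b. a \<le> x \<and> x \<le> b \<and> b - a < d \<longrightarrow> Q a b"
    proof (intro exI[of _ "min d1 d2"] conjI allI impI)
      fix a b assume "a \<le> x \<and> x \<le> b \<and> b - a < min d1 d2"
      then show "Q a b" using Q_trans[OF d2(2)[of a] d1(2)[of b]] by auto
    qed (use d1 d2 in auto)
  qed
  then show ?thesis unfolding Q_def using assms by simp
qed

section \<open>Rational functions on a tropical curve\<close>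

context tropical_curve
begin

abbreviation pull :: "(('a, 'b) curve_point \<Rightarrow> real) \<Rightarrow> 'b \<Rightarrow> real \<Rightarrow> real" where
  "pull f e t \<equiv> f (edge_point e t)"

lemma outgoing_slope_eq: "outgoing_slope f (e, t, s) = slope (pull f e) t s"
  unfolding outgoing_slope_def slope_def has_slope_def by simp

lemma edge_point_Vertex_iff:
  "edge_point e t = Vertex v \<longleftrightarrow> t = 0 \<and> tail G e = v \<or> t \<noteq> 0 \<and> t = len e \<and> head G e = v"
  unfolding edge_point_def by auto

lemma edge_point_Inner_iff:
  "edge_point e t = Inner e' t' \<longleftrightarrow> e = e' \<and> t = t' \<and> t \<noteq> 0 \<and> t \<noteq> len e"
  unfolding edge_point_def by auto

lemma edge_point_in_points: "e \<in> arcs G \<Longrightarrow> 0 \<le> t \<Longrightarrow> t \<le> len e \<Longrightarrow> edge_point e t \<in> points"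
  unfolding edge_point_def points_def by auto

lemma directions_iff:
  "(e, t, s) \<in> directions P \<longleftrightarrow> e \<in> arcs G \<and> edge_point e t = P \<and>
     (s = 1 \<and> 0 \<le> t \<and> t < len e \<or> s = -1 \<and> 0 < t \<and> t \<le> len e)"
  unfolding directions_def by auto

lemma directions_Inner:
  assumes "e \<in> arcs G" "0 < t" "t < len e"
  shows "directions (Inner e t) = {(e, t, 1), (e, t, -1)}"
  using assms by (auto simp: directions_iff edge_point_Inner_iff)

lemma directions_Vertex:
  "directions (Vertex v) =
     (\<lambda>e. (e, 0, 1)) ` {e \<in> arcs G. tail G e = v} \<union> (\<lambda>e. (e, len e, -1)) ` {e \<in> arcs G. head G e = v}"
  using len_pos by (fastforce simp: directions_iff edge_point_Vertex_iff)

lemma points_cases: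
  assumes "P \<in> points"
  obtains v where "v \<in> verts G" "P = Vertex v"
  | e t where "e \<in> arcs G" "0 < t" "t < len e" "P = Inner e t"
  using assms unfolding points_def by auto

lemma finite_directions: "P \<in> points \<Longrightarrow> finite (directions P)"
  by (erule points_cases) (auto simp: directions_Vertex directions_Inner)

lemma sum_directions_Vertex:
  fixes \<phi> :: "_ \<Rightarrow> 'c::comm_monoid_add"
  shows "(\<Sum>d\<in>directions (Vertex v). \<phi> d) =
     (\<Sum>e | e \<in> arcs G \<and> tail G e = v. \<phi> (e, 0, 1)) + (\<Sum>e | e \<in> arcs G \<and> head G e = v. \<phi> (e, len e, -1))"
proof -
  have "(\<Sum>d\<in>directions (Vertex v). \<phi> d) =
     (\<Sum>d\<in>(\<lambda>e. (e, 0, 1)) ` {e \<in> arcs G. tail G e = v}. \<phi> d) +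
     (\<Sum>d\<in>(\<lambda>e. (e, len e, -1)) ` {e \<in> arcs G. head G e = v}. \<phi> d)"
    unfolding directions_Vertex by (rule sum.union_disjoint) auto
  then show ?thesis by (simp add: sum.reindex inj_on_def)
qed

lemma sum_directions_verts:
  fixes \<phi> :: "_ \<Rightarrow> 'c::comm_monoid_add"
  shows "(\<Sum>v\<in>verts G. \<Sum>d\<in>directions (Vertex v). \<phi> d) = (\<Sum>e\<in>arcs G. \<phi> (e, 0, 1) + \<phi> (e, len e, -1))"
proof -
  have "(\<Sum>v\<in>verts G. \<Sum>e | e \<in> arcs G \<and> tail G e = v. \<phi> (e, 0, 1)) = (\<Sum>e\<in>arcs G. \<phi> (e, 0, 1))"
    by (rule sum.group) auto
  moreover have "(\<Sum>v\<in>verts G. \<Sum>e | e \<in> arcs G \<and> head G e = v. \<phi> (e, len e, -1)) = (\<Sum>e\<in>arcs G. \<phi> (e, len e, -1))"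
    by (rule sum.group) auto
  ultimately show ?thesis by (simp add: sum_directions_Vertex sum.distrib)
qed

text \<open>Continuity extends the affine formula from an open piece to its ends, which yields
  one-sided slopes at the exceptional points; conversely the finitely many kinks serve as the
  exceptional set.\<close>

lemma rational_iff: "rational_function f \<longleftrightarrow> (\<forall>e\<in>arcs G. pl (len e) (pull f e))"
proof
  assume f: "rational_function f"
  show "\<forall>e\<in>arcs G. pl (len e) (pull f e)"
  proof
    fix e assume e: "e \<in> arcs G"
    let ?\<phi> = "pull f e" and ?L = "len e"
    obtain B where c: "continuous_on {0..?L} ?\<phi>" and B: "finite B" and
      lin: "\<And>a b. {a<..<b} \<subseteq> {0..?L} - B \<Longrightarrow> \<exists>(m::int) (c::real). \<forall>t\<in>{a<..<b}. ?\<phi> t = of_int m * t + c"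
      using f e unfolding rational_function_def by blast
    have seg: "has_slope ?\<phi> a 1 (slope ?\<phi> a 1) \<and> has_slope ?\<phi> b (-1) (slope ?\<phi> b (-1))"
      if ab: "0 \<le> a" "a < b" "b \<le> ?L" "{a<..<b} \<inter> B = {}" for a b
    proof -
      have "{a<..<b} \<subseteq> {0..?L} - B" using ab by auto
      from lin[OF this] obtain m c where mc: "\<And>t. t \<in> {a<..<b} \<Longrightarrow> ?\<phi> t = of_int m * t + c" by blast
      have "?\<phi> u = c + of_int m * u" if "a \<le> u" "u \<le> b" for u
        by (rule continuous_linear_closure[where a = a and b = b])
          (use mc that ab continuous_on_subset[OF c] in auto)
      then show ?thesis using has_slope_linear[of a b ?\<phi> c m] ab(2) has_slope_slope by blast
    qed
    show "pl ?L ?\<phi>"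
      unfolding pl_def
    proof (intro conjI allI impI)
      fix t assume t: "0 \<le> t \<and> t < ?L"
      \<comment> \<open>The next exceptional point after \<open>t\<close>, or the end of the edge if
        there is none.\<close>
      let ?b = "Min (insert ?L {p \<in> B. t < p})"
      have "{t<..<?b} \<inter> B = {}" using B by auto
      moreover have "t < ?b" "?b \<le> ?L" using B t by auto
      ultimately show "\<exists>m. has_slope ?\<phi> t 1 m" using seg[of t ?b] t by auto
    next
      fix t assume t: "0 < t \<and> t \<le> ?L"
      let ?a = "Max (insert 0 {p \<in> B. p < t})"
      have "{?a<..<t} \<inter> B = {}" using B by auto
      moreover have "?a < t" "0 \<le> ?a" using B t by auto
      ultimately show "\<exists>m. has_slope ?\<phi> t (-1) m" using seg[of ?a t] t by auto
    qed
  qed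
next
  assume f: "\<forall>e\<in>arcs G. pl (len e) (pull f e)"
  show "rational_function f"
    unfolding rational_function_def
  proof (intro ballI conjI)
    fix e assume e: "e \<in> arcs G"
    let ?\<phi> = "pull f e" and ?L = "len e"
    have pl: "pl ?L ?\<phi>" and L: "0 < ?L" using f e len_pos by auto
    show "continuous_on {0..?L} ?\<phi>" using pl_continuous[OF pl] L by simp
    obtain B where B: "finite B" "\<And>t. 0 < t \<Longrightarrow> t < ?L \<Longrightarrow> t \<notin> B \<Longrightarrow> kink ?\<phi> t = 0"
      using pl_finite_kinks[OF pl L] by blast
    show "\<exists>B. finite B \<and> (\<forall>a b. {a<..<b} \<subseteq> {0..?L} - B \<longrightarrow>
              (\<exists>(m::int) (c::real). \<forall>t\<in>{a<..<b}. ?\<phi> t = of_int m * t + c))"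
    proof (intro exI[of _ B] conjI allI impI)
      fix a b assume ab: "{a<..<b} \<subseteq> {0..?L} - B"
      show "\<exists>(m::int) (c::real). \<forall>t\<in>{a<..<b}. ?\<phi> t = of_int m * t + c"
      proof (cases "a < b")
        case True
        \<comment> \<open>The hypothesis controls only the open interval; passing to closures places
          \<open>a\<close> and \<open>b\<close> in the edge as well.\<close>
        then have "closure {a<..<b} \<subseteq> {0..?L}" using ab by (intro closure_minimal) auto
        then have le: "0 \<le> a" "b \<le> ?L" using True by auto
        have "?\<phi> t = of_int (slope ?\<phi> a 1) * t + (?\<phi> a - of_int (slope ?\<phi> a 1) * a)"
          if "t \<in> {a<..<b}" for t
        proof -
          have "?\<phi> t = ?\<phi> a + of_int (slope ?\<phi> a 1) * (t - a)"
          proof (rule pl_linear_between(1)[OF pl L le(1) True le(2)])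
            fix u assume "a < u" "u < b"
            then have "u \<in> {a<..<b}" by simp
            then have "u \<notin> B" using ab by blast
            then show "kink ?\<phi> u = 0" using B(2)[of u] \<open>a < u\<close> \<open>u < b\<close> le by simp
          qed (use that in auto)
          then show ?thesis by (simp add: algebra_simps)
        qed
        then show ?thesis by blast
      qed simp
    qed (rule B(1))
  qed
qed

lemma rational_pl: "rational_function f \<Longrightarrow> e \<in> arcs G \<Longrightarrow> pl (len e) (pull f e)"
  using rational_iff by blast

lemma rational_add: "rational_function f \<Longrightarrow> rational_function g \<Longrightarrow> rational_function (\<lambda>P. f P + g P)"
  unfolding rational_iff using pl_add by blast

lemma rational_diff: "rational_function f \<Longrightarrow> rational_function g \<Longrightarrow> rational_function (\<lambda>P. f P - g P)"
  unfolding rational_iff using pl_diff by blast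

lemma rational_max: "rational_function f \<Longrightarrow> rational_function g \<Longrightarrow> rational_function (\<lambda>P. max (f P) (g P))"
  unfolding rational_iff using pl_max by blast

lemma rational_const: "rational_function (\<lambda>P. c)"
  unfolding rational_iff using pl_const by blast

lemma has_outgoing_slope:
  assumes "rational_function f" "(e, t, s) \<in> directions P"
  shows "has_slope (pull f e) t s (outgoing_slope f (e, t, s))"
  using assms pl_slope[OF rational_pl] unfolding outgoing_slope_eq directions_iff by auto

lemma outgoing_slope_eqI: "has_slope (pull f e) t s m \<Longrightarrow> outgoing_slope f (e, t, s) = m"
  unfolding outgoing_slope_eq by (rule slope_eq)

lemma outgoing_slope_add:
  assumes "rational_function f" "rational_function g" "d \<in> directions P"
  shows "outgoing_slope (\<lambda>P. f P + g P) d = outgoing_slope f d + outgoing_slope g d"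
proof (cases d)
  case (fields e t s)
  then show ?thesis
    using has_slope_add[OF has_outgoing_slope has_outgoing_slope] assms by (auto intro!: outgoing_slope_eqI)
qed

lemma outgoing_slope_diff:
  assumes "rational_function f" "rational_function g" "d \<in> directions P"
  shows "outgoing_slope (\<lambda>P. f P - g P) d = outgoing_slope f d - outgoing_slope g d"
proof (cases d)
  case (fields e t s)
  then show ?thesis
    using has_slope_diff[OF has_outgoing_slope has_outgoing_slope] assms by (auto intro!: outgoing_slope_eqI)
qed

lemma ord_at_add:
  assumes "rational_function f" "rational_function g"
  shows "ord_at P (\<lambda>P. f P + g P) = ord_at P f + ord_at P g"
  unfolding ord_at_def sum.distrib[symmetric] by (rule sum.cong) (use outgoing_slope_add[OF assms] in auto)

lemma ord_at_diff:
  assumes "rational_function f" "rational_function g"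
  shows "ord_at P (\<lambda>P. f P - g P) = ord_at P f - ord_at P g"
  unfolding ord_at_def sum_subtractf[symmetric] by (rule sum.cong) (use outgoing_slope_diff[OF assms] in auto)

lemma outgoing_slope_const: "outgoing_slope (\<lambda>P. c) d = 0"
  by (cases d) (auto intro!: outgoing_slope_eqI has_slope_const)

lemma ord_at_const: "ord_at P (\<lambda>P. c) = 0"
  unfolding ord_at_def by (simp add: outgoing_slope_const)

lemma ord_at_Inner:
  assumes "e \<in> arcs G" "0 < t" "t < len e"
  shows "ord_at (Inner e t) f = kink (pull f e) t"
  unfolding ord_at_def directions_Inner[OF assms] kink_def by (simp add: outgoing_slope_eq)

lemma outgoing_slope_mono:
  assumes "rational_function f" "rational_function g" "d \<in> directions P"
    and "\<And>Q. Q \<in> points \<Longrightarrow> g Q + c \<le> f Q" "f P = g P + c"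
  shows "outgoing_slope g d \<le> outgoing_slope f d"
proof (cases d)
  case (fields e t s)
  then have d: "(e, t, s) \<in> directions P" using assms by simp
  have "\<forall>\<^sub>F h in at_right 0. pull g e (t + s * h) + c \<le> pull f e (t + s * h)"
    unfolding eventually_at_right_field using d
    by (intro exI[of _ "if s = 1 then len e - t else t"])
      (auto intro!: assms(4) edge_point_in_points simp: directions_iff)
  moreover have "edge_point e t = P" using d by (simp add: directions_iff)
  ultimately show ?thesis
    using has_slope_mono[OF has_outgoing_slope[OF assms(1) d] has_outgoing_slope[OF assms(2) d]] assms(5)
    unfolding fields by auto
qed

text \<open>If \<open>f\<close> touches \<open>g + c\<close> from above at \<open>P\<close>, it
  rises at least as fast in every direction. This handles both the order of a maximum of functions
  and, with constant \<open>g\<close>, points where a function is minimal.\<close>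

lemma ord_at_mono:
  assumes "rational_function f" "rational_function g"
    and "\<And>Q. Q \<in> points \<Longrightarrow> g Q + c \<le> f Q" "f P = g P + c"
  shows "ord_at P g \<le> ord_at P f"
  unfolding ord_at_def using outgoing_slope_mono[OF assms(1,2) _ assms(3,4)] by (rule sum_mono)

section \<open>Principal divisors have degree zero\<close>

definition kinks :: "(('a, 'b) curve_point \<Rightarrow> real) \<Rightarrow> 'b \<Rightarrow> real set" where
  "kinks f e = {t. 0 < t \<and> t < len e \<and> kink (pull f e) t \<noteq> 0}"

lemma finite_kinks: "rational_function f \<Longrightarrow> e \<in> arcs G \<Longrightarrow> finite (kinks f e)"
  unfolding kinks_def using pl_finite_kinks[OF rational_pl] len_pos by blast

lemma ord_support_subset:
  "{P \<in> points. ord_at P f \<noteq> 0} \<subseteq> Vertex ` verts G \<union> (\<Union>e\<in>arcs G. Inner e ` kinks f e)"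
proof
  fix P assume P: "P \<in> {P \<in> points. ord_at P f \<noteq> 0}"
  then have "P \<in> points" by simp
  then show "P \<in> Vertex ` verts G \<union> (\<Union>e\<in>arcs G. Inner e ` kinks f e)"
    by (cases rule: points_cases) (use P in \<open>auto simp: ord_at_Inner kinks_def\<close>)
qed

lemma finite_ord_support: "rational_function f \<Longrightarrow> finite {P \<in> points. ord_at P f \<noteq> 0}"
  by (rule finite_subset[OF ord_support_subset]) (simp add: finite_kinks)

text \<open>Regrouping the directions at the vertices by edges leaves one contribution per edge,
  which vanishes by \<open>pl_kinks_sum\<close>. Any finite set containing the support is allowed,
  so that several divisors can be summed over a common set.\<close>

lemma sum_ord_eq_0:
  assumes f: "rational_function f" and X: "finite X" "X \<subseteq> points" "{P \<in> points. ord_at P f \<noteq> 0} \<subseteq> X"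
  shows "(\<Sum>P\<in>X. ord_at P f) = 0"
proof -
  let ?I = "\<Union>e\<in>arcs G. Inner e ` kinks f e"
  let ?Y = "Vertex ` verts G \<union> ?I"
  have finI: "finite ?I" using finite_kinks[OF f] by simp
  have I: "?I \<subseteq> points" unfolding kinks_def points_def by auto
  have "(\<Sum>P\<in>X. ord_at P f) = (\<Sum>P | P \<in> points \<and> ord_at P f \<noteq> 0. ord_at P f)"
    using X by (intro sum.mono_neutral_right) auto
  also have "\<dots> = (\<Sum>P\<in>?Y. ord_at P f)"
  proof (rule sum.mono_neutral_left[OF _ ord_support_subset])
    show "\<forall>P\<in>?Y - {P \<in> points. ord_at P f \<noteq> 0}. ord_at P f = 0"
      using I unfolding points_def by blast
  qed (use finI in auto)
  also have "\<dots> = (\<Sum>v\<in>verts G. ord_at (Vertex v) f) + (\<Sum>P\<in>?I. ord_at P f)"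
    using finI by (subst sum.union_disjoint) (auto simp: sum.reindex inj_on_def)
  also have "(\<Sum>P\<in>?I. ord_at P f) = (\<Sum>e\<in>arcs G. \<Sum>P\<in>Inner e ` kinks f e. ord_at P f)"
    by (rule sum.UNION_disjoint) (auto simp: finite_kinks[OF f])
  also have "\<dots> = (\<Sum>e\<in>arcs G. \<Sum>t\<in>kinks f e. kink (pull f e) t)"
    by (intro sum.cong refl) (auto simp: sum.reindex inj_on_def ord_at_Inner kinks_def intro!: sum.cong)
  also have "(\<Sum>v\<in>verts G. ord_at (Vertex v) f) = (\<Sum>e\<in>arcs G. slope (pull f e) 0 1 + slope (pull f e) (len e) (-1))"
    unfolding ord_at_def sum_directions_verts by (simp add: outgoing_slope_eq)
  finally have "(\<Sum>P\<in>X. ord_at P f) = (\<Sum>e\<in>arcs G. slope (pull f e) 0 1 + slope (pull f e) (len e) (-1)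
      + (\<Sum>t\<in>kinks f e. kink (pull f e) t))"
    by (simp add: sum.distrib)
  also have "\<dots> = 0"
    by (intro sum.neutral ballI pl_kinks_sum rational_pl[OF f] len_pos finite_kinks[OF f]) (auto simp: kinks_def)
  finally show ?thesis .
qed

text \<open>The tropical module \<open>R(D)\<close>. Here \<open>D\<close> is a bare function rather
  than a finitely supported mapping, so \<open>canonical\<close> and truncations of divisors can be
  inserted directly; finiteness of the positive part is a separate hypothesis.\<close>

definition sections :: "(('a, 'b) curve_point \<Rightarrow> int) \<Rightarrow> (('a, 'b) curve_point \<Rightarrow> real) set" where
  "sections D = {f. rational_function f \<and> (\<forall>P\<in>points. 0 \<le> D P + ord_at P f)}"

lemma sections_max:
  assumes "f \<in> sections D" "g \<in> sections D"
  shows "(\<lambda>P. max (f P) (g P)) \<in> sections D"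
proof -
  let ?h = "\<lambda>P. max (f P) (g P)"
  have r: "rational_function f" "rational_function g" "rational_function ?h"
    using assms rational_max unfolding sections_def by auto
  have "0 \<le> D P + ord_at P ?h" if P: "P \<in> points" for P
  proof (cases "g P \<le> f P")
    case True
    have "ord_at P f \<le> ord_at P ?h" by (rule ord_at_mono[OF r(3,1), of 0]) (use True in auto)
    then show ?thesis using assms(1) P unfolding sections_def by force
  next
    case False
    have "ord_at P g \<le> ord_at P ?h" by (rule ord_at_mono[OF r(3,2), of 0]) (use False in auto)
    then show ?thesis using assms(2) P unfolding sections_def by force
  qed
  then show ?thesis using r(3) unfolding sections_def by simp
qed

lemma sections_add_const:
  assumes "f \<in> sections D"
  shows "(\<lambda>P. f P + c) \<in> sections D"
  using assms rational_add[OF _ rational_const] ord_at_add[OF _ rational_const] ord_at_const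
  unfolding sections_def by auto

section \<open>Uniform bounds on the slopes of sections\<close>

definition pos_degree :: "(('a, 'b) curve_point \<Rightarrow> int) \<Rightarrow> int" where
  "pos_degree D = (\<Sum>P | P \<in> points \<and> 0 < D P. D P)"

text \<open>The degree of the divisor of \<open>max (f - f P) 0\<close> vanishes: its positive part contains the rising
  directions at \<open>P\<close>, and its negative part is bounded by \<open>D\<close>.\<close>
lemma outgoing_slope_le:
  assumes fin: "finite {P \<in> points. 0 < D P}" and f: "f \<in> sections D" and P: "P \<in> points" "d \<in> directions P"
  shows "outgoing_slope f d \<le> pos_degree D"
proof -
  define c where "c = f P"
  define h where "h = (\<lambda>Q. max (f Q - c) 0)"
  have rf: "rational_function f" using f unfolding sections_def by simp
  have rh: "rational_function h"
    unfolding h_def by (intro rational_max rational_diff rf rational_const)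
  have pos: "0 \<le> outgoing_slope h d'" if "d' \<in> directions Q" "f Q \<le> c" for d' Q
    using outgoing_slope_mono[OF rh rational_const that(1), of 0 0] that(2) unfolding h_def
    by (simp add: outgoing_slope_const)
  have up: "outgoing_slope f d' \<le> outgoing_slope h d'" if "d' \<in> directions Q" "c \<le> f Q" for d' Q
    by (rule outgoing_slope_mono[OF rh rf that(1), of "- c"]) (use that(2) in \<open>auto simp: h_def\<close>)
  have ge: "- max 0 (D Q) \<le> ord_at Q h" if Q: "Q \<in> points" for Q
  proof (cases "f Q \<le> c")
    case True
    have "0 \<le> ord_at Q h" unfolding ord_at_def using True pos by (intro sum_nonneg) auto
    then show ?thesis by simp
  next
    case False
    then have "ord_at Q f \<le> ord_at Q h" unfolding ord_at_def using up by (intro sum_mono) auto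
    moreover have "0 \<le> D Q + ord_at Q f" using f Q unfolding sections_def by simp
    ultimately show ?thesis by simp
  qed
  have P': "max 0 (outgoing_slope f d) \<le> ord_at P h"
  proof -
    have "max 0 (outgoing_slope f d) \<le> outgoing_slope h d" using up[OF P(2)] pos[OF P(2)] unfolding c_def by simp
    also have "\<dots> \<le> ord_at P h"
      unfolding ord_at_def using P pos[of _ P] finite_directions[OF P(1)] unfolding c_def
      by (intro member_le_sum) auto
    finally show ?thesis .
  qed
  let ?X = "insert P ({Q \<in> points. 0 < D Q} \<union> {Q \<in> points. ord_at Q h \<noteq> 0})"
  have fX: "finite ?X" using fin finite_ord_support[OF rh] by simp
  have "0 = (\<Sum>Q\<in>?X. ord_at Q h)" using sum_ord_eq_0[OF rh fX] P(1) by auto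
  also have "\<dots> = ord_at P h + (\<Sum>Q\<in>?X - {P}. ord_at Q h)"
    by (rule sum.remove[OF fX]) simp
  also have "\<dots> \<ge> max 0 (outgoing_slope f d) + (\<Sum>Q\<in>?X - {P}. - max 0 (D Q))"
    using P' ge P(1) by (intro add_mono sum_mono) auto
  finally have 1: "max 0 (outgoing_slope f d) \<le> (\<Sum>Q\<in>?X - {P}. max 0 (D Q))" by (simp add: sum_negf)
  have "(\<Sum>Q\<in>?X - {P}. max 0 (D Q)) \<le> (\<Sum>Q\<in>?X. max 0 (D Q))"
    using fX by (intro sum_mono2) auto
  also have "\<dots> = (\<Sum>Q | Q \<in> points \<and> 0 < D Q. max 0 (D Q))"
    using fX P(1) by (intro sum.mono_neutral_right) auto
  also have "\<dots> = pos_degree D" unfolding pos_degree_def by (intro sum.cong) auto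
  finally show ?thesis using 1 by simp
qed

text \<open>Only falling slopes are new. Following a direction of slope \<open>m\<close> a little
  way and looking back gives a direction of slope \<open>- m\<close>, to which the upper bound
  applies.\<close>

lemma abs_outgoing_slope_le:
  assumes fin: "finite {P \<in> points. 0 < D P}" and f: "f \<in> sections D" and P: "P \<in> points" "d \<in> directions P"
  shows "\<bar>outgoing_slope f d\<bar> \<le> pos_degree D"
proof -
  obtain e t s where d: "d = (e, t, s)" by (cases d)
  have rf: "rational_function f" using f unfolding sections_def by simp
  have e: "e \<in> arcs G" and s: "s = 1 \<and> 0 \<le> t \<and> t < len e \<or> s = -1 \<and> 0 < t \<and> t \<le> len e"
    using P(2) unfolding d directions_iff by auto
  define m where "m = outgoing_slope f d"
  obtain \<delta> where \<delta>: "\<delta> > 0" "\<And>h. 0 \<le> h \<Longrightarrow> h < \<delta> \<Longrightarrow> pull f e (t + s * h) = pull f e t + of_int m * h"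
    using has_outgoing_slope[OF rf P(2)[unfolded d]] unfolding has_slope_iff d m_def by blast
  define h where "h = min \<delta> (if s = 1 then len e - t else t) / 2"
  have h: "0 < h" "h < \<delta>" "0 < t + s * h" "t + s * h < len e"
    using \<delta>(1) s unfolding h_def by (auto simp: min_def field_simps)
  have "has_slope (pull f e) (t + s * h) (- s) (- m)"
  proof (rule has_slopeI[of h])
    fix h' assume h': "0 < h'" "h' < h"
    have "t + s * h + - s * h' = t + s * (h - h')" by (simp add: algebra_simps)
    then show "pull f e (t + s * h + - s * h') = pull f e (t + s * h) + of_int (- m) * h'"
      using \<delta>(2)[of h] \<delta>(2)[of "h - h'"] h h' by (simp add: algebra_simps)
  qed (use h in auto)
  then have "outgoing_slope f (e, t + s * h, - s) = - m" by (rule outgoing_slope_eqI)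
  moreover have "(e, t + s * h, - s) \<in> directions (edge_point e (t + s * h))"
    unfolding directions_iff using e s h by auto
  moreover have "edge_point e (t + s * h) \<in> points" using e h by (intro edge_point_in_points) auto
  ultimately have "- m \<le> pos_degree D" using outgoing_slope_le[OF fin f] by metis
  then show ?thesis using outgoing_slope_le[OF fin f P] unfolding m_def by simp
qed

lemma sections_lipschitz:
  assumes fin: "finite {P \<in> points. 0 < D P}" and f: "f \<in> sections D" and e: "e \<in> arcs G"
    and "0 \<le> t" "t \<le> len e" "0 \<le> u" "u \<le> len e"
  shows "\<bar>pull f e u - pull f e t\<bar> \<le> of_int (pos_degree D) * \<bar>u - t\<bar>"
proof -
  have rf: "rational_function f" using f unfolding sections_def by simp
  have b: "\<bar>slope (pull f e) t s\<bar> \<le> pos_degree D"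
    if "s = 1 \<and> 0 \<le> t \<and> t < len e \<or> s = -1 \<and> 0 < t \<and> t \<le> len e" for t s
    using abs_outgoing_slope_le[OF fin f edge_point_in_points[OF e, of t], of "(e, t, s)"] that e
    unfolding directions_iff outgoing_slope_eq by auto
  have "\<bar>pull f e y - pull f e x\<bar> \<le> of_int (pos_degree D) * (y - x)" if "0 \<le> x" "x \<le> y" "y \<le> len e" for x y
    by (rule pl_lipschitz[OF rational_pl[OF rf e]]) (use b that in auto)
  from this[of t u] this[of u t] show ?thesis using assms by (cases "t \<le> u") (auto simp: abs_minus_commute)
qed

end

section \<open>Compactness of linear systems\<close>

lemma finite_index_convergent_subsequence:
  fixes x :: "nat \<Rightarrow> 'i \<Rightarrow> real"
  assumes "finite I" "\<And>n i. i \<in> I \<Longrightarrow> \<bar>x n i\<bar> \<le> B i"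
  shows "\<exists>r l. strict_mono r \<and> (\<forall>i\<in>I. (\<lambda>n. x (r n) i) \<longlonglongrightarrow> l i)"
  using assms
proof (induction I rule: finite_induct)
  case empty
  show ?case by (intro exI[of _ id]) (auto simp: strict_mono_def)
next
  case (insert j I)
  then obtain r l where r: "strict_mono r" "\<forall>i\<in>I. (\<lambda>n. x (r n) i) \<longlonglongrightarrow> l i" by blast
  have "bounded (range (\<lambda>n. x (r n) j))"
    using insert.prems[of j] by (auto simp: bounded_iff)
  then obtain a r' where r': "strict_mono r'" "((\<lambda>n. x (r n) j) \<circ> r') \<longlonglongrightarrow> a"
    using bounded_imp_convergent_subsequence by blast
  have "(\<lambda>n. x (r (r' n)) i) \<longlonglongrightarrow> (l(j := a)) i" if "i \<in> insert j I" for i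
    using r'(2) LIMSEQ_subseq_LIMSEQ[OF r(2)[rule_format] r'(1)] that insert.hyps
    by (cases "i = j") (auto simp: o_def)
  moreover have "strict_mono (r \<circ> r')" using r(1) r'(1) by (rule strict_mono_o)
  ultimately show ?case by (intro exI[of _ "r \<circ> r'"] exI[of _ "l(j := a)"] conjI) (auto simp: o_def)
qed

lemma tendsto_Max_image:
  fixes x :: "'i \<Rightarrow> 'n \<Rightarrow> real"
  assumes "finite I" "I \<noteq> {}" "\<And>i. i \<in> I \<Longrightarrow> (x i \<longlongrightarrow> l i) F"
  shows "((\<lambda>n. Max ((\<lambda>i. x i n) ` I)) \<longlongrightarrow> Max (l ` I)) F"
  using assms
proof (induction I rule: finite_ne_induct)
  case (insert i I)
  then have "((\<lambda>n. max (x i n) (Max ((\<lambda>i. x i n) ` I))) \<longlongrightarrow> max (l i) (Max (l ` I))) F"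
    by (intro tendsto_max) auto
  then show ?case using insert by simp
qed simp

lemma has_slope_ge:
  assumes "has_slope \<phi> t s m" "\<epsilon> > 0" "\<And>h. 0 < h \<Longrightarrow> h < \<epsilon> \<Longrightarrow> \<phi> t + of_int k * h \<le> \<phi> (t + s * h)"
  shows "k \<le> m"
proof -
  obtain \<delta> where \<delta>: "\<delta> > 0" "\<And>h. 0 \<le> h \<Longrightarrow> h < \<delta> \<Longrightarrow> \<phi> (t + s * h) = \<phi> t + of_int m * h"
    using assms(1) unfolding has_slope_iff by blast
  define h where "h = min \<delta> \<epsilon> / 2"
  have h: "0 < h" "h < \<delta>" "h < \<epsilon>" using \<delta>(1) assms(2) unfolding h_def by (auto simp: min_def)
  have "of_int k * h \<le> of_int m * h" using \<delta>(2)[of h] assms(3)[of h] h by simp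
  then show ?thesis using h(1) by simp
qed

text \<open>Each value is attained by a supporting line, whose slope is a one-sided slope up to sign
  and hence an integer in \<open>{-C..C}\<close>. So the function is encoded by finitely many
  bounded intercepts, to which Bolzano-Weierstrass applies.\<close>

lemma convex_pl_eq_Max_affine:
  assumes "pl L \<phi>" "0 < L" "\<And>t. 0 < t \<Longrightarrow> t < L \<Longrightarrow> 0 \<le> kink \<phi> t"
    and "\<And>t. 0 \<le> t \<Longrightarrow> t < L \<Longrightarrow> \<bar>slope \<phi> t 1\<bar> \<le> C" "\<bar>slope \<phi> L (-1)\<bar> \<le> C"
    and "\<And>t. 0 \<le> t \<Longrightarrow> t \<le> L \<Longrightarrow> \<bar>\<phi> t\<bar> \<le> B"
  shows "\<exists>c. (\<forall>m\<in>{-C..C}. \<bar>c m\<bar> \<le> B + of_int C * L) \<and>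
    (\<forall>t. 0 \<le> t \<longrightarrow> t \<le> L \<longrightarrow> \<phi> t = Max ((\<lambda>m. of_int m * t + c m) ` {-C..C}))"
proof -
  \<comment> \<open>The largest intercept of a line of slope \<open>m\<close> below the function,
    that is, minus its convex conjugate at \<open>m\<close>.\<close>
  define c where "c m = (INF u\<in>{0..L}. \<phi> u - of_int m * u)" for m
  have C0: "0 \<le> C" using assms(5) by linarith
  have lb: "- (B + of_int C * L) \<le> \<phi> u - of_int m * u" if "m \<in> {-C..C}" "u \<in> {0..L}" for m u
  proof -
    have "of_int m * u \<le> of_int C * L"
      using that C0 assms(2) by (intro mult_mono) auto
    then show ?thesis using assms(6)[of u] that by auto
  qed
  have bdd: "bdd_below ((\<lambda>u. \<phi> u - of_int m * u) ` {0..L})" if "m \<in> {-C..C}" for m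
    using lb[OF that] by (intro bdd_belowI2)
  have le: "c m \<le> \<phi> u - of_int m * u" if "m \<in> {-C..C}" "u \<in> {0..L}" for m u
    unfolding c_def by (rule cINF_lower[OF bdd[OF that(1)] that(2)])
  show ?thesis
  proof (intro exI[of _ c] conjI ballI allI impI)
    fix m assume m: "m \<in> {-C..C}"
    have "- (B + of_int C * L) \<le> c m"
      unfolding c_def using lb[OF m] assms(2) by (intro cINF_greatest) auto
    moreover have "c m \<le> B" using le[OF m, of 0] assms(2) assms(6)[of 0] by auto
    moreover have "0 \<le> of_int C * L" using C0 assms(2) by simp
    ultimately show "\<bar>c m\<bar> \<le> B + of_int C * L" by linarith
  next
    fix t assume t: "0 \<le> t" "t \<le> L"
    have "\<exists>m\<in>{-C..C}. \<forall>u\<in>{0..L}. \<phi> t + of_int m * (u - t) \<le> \<phi> u"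
    proof (cases "t < L")
      case True
      then show ?thesis
        using pl_convex(1)[OF assms(1-3) t] assms(4)[OF t(1) True] by (intro bexI[of _ "slope \<phi> t 1"]) auto
    next
      case False
      then have tL: "t = L" using t by simp
      \<comment> \<open>At the right end only the backward slope exists; as the slope of a line it
        changes sign.\<close>
      have "\<phi> t + of_int (- slope \<phi> t (-1)) * (u - t) \<le> \<phi> u" if "u \<in> {0..L}" for u
        using pl_convex(2)[OF assms(1-3) t] that tL assms(2) by (simp add: algebra_simps)
      then show ?thesis using assms(5) unfolding tL
        by (intro bexI[of _ "- slope \<phi> L (-1)"]) auto
    qed
    then obtain m where m: "m \<in> {-C..C}" "\<And>u. u \<in> {0..L} \<Longrightarrow> \<phi> t + of_int m * (u - t) \<le> \<phi> u" by blast
    have "\<phi> t - of_int m * t \<le> c m"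
      unfolding c_def using m(2) assms(2) by (intro cINF_greatest) (auto simp: algebra_simps)
    then have eq: "\<phi> t = of_int m * t + c m" using le[OF m(1), of t] t by auto
    show "\<phi> t = Max ((\<lambda>m. of_int m * t + c m) ` {-C..C})"
    proof (rule Max_eqI[symmetric])
      show "\<phi> t \<in> (\<lambda>m. of_int m * t + c m) ` {-C..C}" using m(1) eq by blast
      fix y assume "y \<in> (\<lambda>m. of_int m * t + c m) ` {-C..C}"
      then show "y \<le> \<phi> t" using le[of _ t] t by force
    qed simp
  qed
qed

lemma LIMSEQ_le_frequently:
  fixes X Y :: "nat \<Rightarrow> real"
  assumes "X \<longlonglongrightarrow> x" "Y \<longlonglongrightarrow> y" "\<exists>\<^sub>F n in sequentially. X n \<le> Y n"
  shows "x \<le> y"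
proof (rule ccontr)
  assume "\<not> x \<le> y"
  then have "\<forall>\<^sub>F n in sequentially. 0 < X n - Y n"
    by (intro order_tendstoD(1)[OF tendsto_diff[OF assms(1,2)]]) simp
  then have "\<not> (\<exists>\<^sub>F n in sequentially. X n \<le> Y n)"
    unfolding frequently_def by (simp add: not_le)
  then show False using assms(3) by simp
qed

context tropical_curve
begin

section \<open>Uniform oscillation bounds and limits of sections\<close>

lemma vertex_on_arc:
  assumes "arcs G \<noteq> {}" "v \<in> verts G"
  obtains e where "e \<in> arcs G" "v = tail G e \<or> v = head G e"
proof -
  obtain e0 where e0: "e0 \<in> arcs G" using assms by auto
  have "v \<rightarrow>\<^sup>*\<^bsub>with_proj (mk_symmetric G)\<^esub> tail G e0"
    using graph_connected assms(2) e0 unfolding Digraph_Component.connected_def strongly_connected_def by simp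
  then have "(v, tail G e0) \<in> rtrancl_on (verts G) (parcs (mk_symmetric G))"
    unfolding reachable_def by simp
  then show thesis
  proof (cases rule: converse_rtrancl_on_cases)
    case base
    then show ?thesis using that[OF e0] by simp
  next
    case (step w)
    then show ?thesis using that by (auto simp: parcs_mk_symmetric)
  qed
qed

lemma point_on_arc:
  assumes "arcs G \<noteq> {}" "P \<in> points"
  obtains e t where "e \<in> arcs G" "0 \<le> t" "t \<le> len e" "edge_point e t = P"
  using assms(2)
proof (cases rule: points_cases)
  case (1 v)
  then obtain e where e: "e \<in> arcs G" "v = tail G e \<or> v = head G e" using vertex_on_arc assms(1) by blast
  show ?thesis using that[of e 0] that[of e "len e"] e 1 len_pos[OF e(1)] by (auto simp: edge_point_def)
next
  case (2 e t)
  then show ?thesis using that[of e t] by (auto simp: edge_point_def)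
qed

lemma pos_degree_nonneg: "0 \<le> pos_degree D"
  unfolding pos_degree_def by (intro sum_nonneg) auto

text \<open>The Lipschitz constant is common to all sections and any two vertices are joined by a
  path of edges. \<open>M\<close> bounds the change from a point to a vertex of its edge,
  \<open>N\<close> the change between vertices.\<close>

lemma sections_bounded:
  assumes fin: "finite {P \<in> points. 0 < D P}" and ne: "arcs G \<noteq> {}"
  shows "\<exists>B. \<forall>f\<in>sections D. \<forall>P\<in>points. \<forall>Q\<in>points. \<bar>f P - f Q\<bar> \<le> B"
proof -
  let ?C = "of_int (pos_degree D) :: real"
  have arc: "\<bar>pull f e t - pull f e u\<bar> \<le> ?C * len e"
    if f: "f \<in> sections D" and e: "e \<in> arcs G" and tu: "0 \<le> t" "t \<le> len e" "0 \<le> u" "u \<le> len e" for f e t u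
  proof -
    have "\<bar>pull f e t - pull f e u\<bar> \<le> ?C * \<bar>t - u\<bar>" by (rule sections_lipschitz[OF fin f e tu(3,4,1,2)])
    also have "\<dots> \<le> ?C * len e" using pos_degree_nonneg tu by (intro mult_left_mono) auto
    finally show ?thesis .
  qed
  have "\<exists>B. \<forall>f\<in>sections D. \<bar>f (Vertex u) - f (Vertex v)\<bar> \<le> B" if "u \<in> verts G" "v \<in> verts G" for u v
  proof -
    have "(u, v) \<in> rtrancl_on (verts G) (parcs (mk_symmetric G))"
      using graph_connected that unfolding Digraph_Component.connected_def strongly_connected_def reachable_def by simp
    then show ?thesis
    proof (induction rule: rtrancl_on_induct)
      case base
      show ?case by (intro exI[of _ 0]) simp
    next
      case (step v w)
      then obtain B where B: "\<forall>f\<in>sections D. \<bar>f (Vertex u) - f (Vertex v)\<bar> \<le> B" by blast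
      from step obtain e where e: "e \<in> arcs G" "(v, w) = (tail G e, head G e) \<or> (v, w) = (head G e, tail G e)"
        by (auto simp: parcs_mk_symmetric)
      have "\<bar>f (Vertex v) - f (Vertex w)\<bar> \<le> ?C * len e" if "f \<in> sections D" for f
        using arc[OF that e(1), of 0 "len e"] arc[OF that e(1), of "len e" 0] e(2) len_pos[OF e(1)]
        by (auto simp: edge_point_def)
      then have "\<forall>f\<in>sections D. \<bar>f (Vertex u) - f (Vertex w)\<bar> \<le> B + ?C * len e" using B by fastforce
      then show ?case by blast
    qed
  qed
  then obtain b where b: "\<And>u v f. u \<in> verts G \<Longrightarrow> v \<in> verts G \<Longrightarrow> f \<in> sections D \<Longrightarrow>
      \<bar>f (Vertex u) - f (Vertex v)\<bar> \<le> b u v"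
    by metis
  define M where "M = (\<Sum>e\<in>arcs G. ?C * len e)"
  define N where "N = (\<Sum>(u, v)\<in>verts G \<times> verts G. \<bar>b u v\<bar>)"
  have M: "?C * len e \<le> M" if "e \<in> arcs G" for e
    unfolding M_def using that len_pos pos_degree_nonneg[of D]
    by (intro member_le_sum) (auto intro!: mult_nonneg_nonneg simp: less_imp_le)
  have N: "\<bar>f (Vertex u) - f (Vertex v)\<bar> \<le> N" if "u \<in> verts G" "v \<in> verts G" "f \<in> sections D" for u v f
  proof -
    have "b u v \<le> \<bar>b u v\<bar>" by simp
    also have "\<dots> = (case (u, v) of (u, v) \<Rightarrow> \<bar>b u v\<bar>)" by simp
    also have "\<dots> \<le> N" unfolding N_def using that by (intro member_le_sum) auto
    finally show ?thesis using b[OF that] by linarith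
  qed
  have near: "\<exists>v\<in>verts G. \<forall>f\<in>sections D. \<bar>f P - f (Vertex v)\<bar> \<le> M" if P: "P \<in> points" for P
  proof -
    obtain e t where e: "e \<in> arcs G" "0 \<le> t" "t \<le> len e" "edge_point e t = P"
      using point_on_arc[OF ne P] .
    have "\<bar>f P - f (Vertex (tail G e))\<bar> \<le> M" if "f \<in> sections D" for f
      using arc[OF that e(1-3), of 0] len_pos[OF e(1)] M[OF e(1)] e(4) by (simp add: edge_point_def[of e 0])
    moreover have "tail G e \<in> verts G" using e(1) by simp
    ultimately show ?thesis by blast
  qed
  show ?thesis
  proof (intro exI[of _ "M + N + M"] ballI)
    fix f P Q assume f: "f \<in> sections D" and PQ: "P \<in> points" "Q \<in> points"
    from near[OF PQ(1)] near[OF PQ(2)] f obtain u v where "u \<in> verts G" "v \<in> verts G"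
      "\<bar>f P - f (Vertex u)\<bar> \<le> M" "\<bar>f Q - f (Vertex v)\<bar> \<le> M" by blast
    then show "\<bar>f P - f Q\<bar> \<le> M + N + M" using N[of u v f] f by linarith
  qed
qed

text \<open>Added to a section of \<open>D\<close>, it makes the section convex on the edge; convex functions with bounded
  integer slopes are maxima of finitely many affine functions, hence closed under limits.\<close>
definition convexifier :: "(('a, 'b) curve_point \<Rightarrow> int) \<Rightarrow> 'b \<Rightarrow> real \<Rightarrow> real" where
  "convexifier D e = canon 0 0 {p. 0 < p \<and> p < len e \<and> 0 < D (Inner e p)} (\<lambda>p. D (Inner e p))"

lemma convexifier:
  assumes fin: "finite {P \<in> points. 0 < D P}" and e: "e \<in> arcs G"
  shows "pl (len e) (convexifier D e)"
    and "\<bar>slope (convexifier D e) t 1\<bar> \<le> pos_degree D"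
    and "\<bar>slope (convexifier D e) t (-1)\<bar> \<le> pos_degree D"
    and "0 < t \<Longrightarrow> t < len e \<Longrightarrow> D (Inner e t) \<le> kink (convexifier D e) t"
    and "has_slope (convexifier D e) t 1 (slope (convexifier D e) t 1)"
    and "has_slope (convexifier D e) t (-1) (slope (convexifier D e) t (-1))"
proof -
  let ?Z = "{p. 0 < p \<and> p < len e \<and> 0 < D (Inner e p)}"
  let ?d = "\<lambda>p. D (Inner e p)"
  have sub: "Inner e ` ?Z \<subseteq> {P \<in> points. 0 < D P}" using e by (auto simp: points_def)
  have Z: "finite ?Z" using finite_subset[OF sub fin] by (rule finite_imageD) (simp add: inj_on_def)
  note sl = has_slope_canon[OF Z, of 0 0 ?d, folded convexifier_def]
  show "pl (len e) (convexifier D e)" unfolding convexifier_def by (rule pl_canon[OF Z])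
  show "has_slope (convexifier D e) t 1 (slope (convexifier D e) t 1)"
    "has_slope (convexifier D e) t (-1) (slope (convexifier D e) t (-1))"
    using sl has_slope_slope by blast+
  have bound: "0 \<le> sum ?d Y \<and> sum ?d Y \<le> pos_degree D" if "Y \<subseteq> ?Z" for Y
  proof
    show "0 \<le> sum ?d Y" using that by (intro sum_nonneg) auto
    have "sum ?d Y = sum D (Inner e ` Y)" by (simp add: sum.reindex inj_on_def)
    also have "\<dots> \<le> pos_degree D"
      unfolding pos_degree_def using that sub by (intro sum_mono2[OF fin]) auto
    finally show "sum ?d Y \<le> pos_degree D" .
  qed
  show "\<bar>slope (convexifier D e) t 1\<bar> \<le> pos_degree D"
  proof -
    have "{p. p \<in> ?Z \<and> p \<le> t} \<subseteq> ?Z" by blast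
    from bound[OF this] show ?thesis unfolding slope_eq[OF sl(1)] by linarith
  qed
  show "\<bar>slope (convexifier D e) t (-1)\<bar> \<le> pos_degree D"
  proof -
    have "{p. p \<in> ?Z \<and> p < t} \<subseteq> ?Z" by blast
    from bound[OF this] show ?thesis unfolding slope_eq[OF sl(2)] by linarith
  qed
  show "D (Inner e t) \<le> kink (convexifier D e) t" if t: "0 < t" "t < len e"
  proof -
    define Y where "Y = {p. p \<in> ?Z \<and> p < t}"
    have "{p. p \<in> ?Z \<and> p \<le> t} = (if t \<in> ?Z then insert t Y else Y)"
      unfolding Y_def by (auto simp: order_le_less)
    moreover have "finite Y" unfolding Y_def by (rule finite_subset[OF _ Z]) blast
    moreover have "t \<notin> Y" unfolding Y_def by simp
    ultimately have "kink (convexifier D e) t = (if t \<in> ?Z then ?d t else 0)"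
      unfolding kink_def slope_eq[OF sl(1)] slope_eq[OF sl(2)] Y_def[symmetric] by (simp del: mem_Collect_eq)
    then show ?thesis using t by auto
  qed
qed

text \<open>A section plus the \<open>convexifier\<close> is on each edge a maximum of affine
  functions with bounded intercepts. Along a subsequence all intercepts converge, and subtracting
  the \<open>convexifier\<close> from the limit gives \<open>F\<close>. It is again a section
  because slopes can only jump up in the limit: supporting lines of convex functions pass to
  limits.\<close>

lemma sections_compact:
  assumes fin: "finite {P \<in> points. 0 < D P}" and ne: "arcs G \<noteq> {}"
    and f: "\<And>n. f n \<in> sections D" and B: "\<And>n P. P \<in> points \<Longrightarrow> \<bar>f n P\<bar> \<le> B"
  shows "\<exists>F r. strict_mono (r :: nat \<Rightarrow> nat) \<and> F \<in> sections D \<and> (\<forall>P\<in>points. (\<lambda>n. f (r n) P) \<longlonglongrightarrow> F P)"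
proof -
  let ?\<psi> = "convexifier D"
  \<comment> \<open>One \<open>pos_degree D\<close> bounds the slopes of sections, the other those
    of the \<open>convexifier\<close>.\<close>
  define C where "C = 2 * pos_degree D"
  define \<xi> where "\<xi> n e t = pull (f n) e t + ?\<psi> e t" for n e t
  have rf: "rational_function (f n)" for n using f unfolding sections_def by blast
  have sl_f: "has_slope (pull (f n) e) t s (outgoing_slope (f n) (e, t, s))"
    "\<bar>outgoing_slope (f n) (e, t, s)\<bar> \<le> pos_degree D"
    if "e \<in> arcs G" "s = 1 \<and> 0 \<le> t \<and> t < len e \<or> s = -1 \<and> 0 < t \<and> t \<le> len e" for n e t s
  proof -
    have d: "(e, t, s) \<in> directions (edge_point e t)" using that by (simp add: directions_iff)
    show "has_slope (pull (f n) e) t s (outgoing_slope (f n) (e, t, s))" by (rule has_outgoing_slope[OF rf d])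
    show "\<bar>outgoing_slope (f n) (e, t, s)\<bar> \<le> pos_degree D"
      by (rule abs_outgoing_slope_le[OF fin f _ d]) (use that in \<open>auto intro: edge_point_in_points\<close>)
  qed
  have sl: "slope (\<xi> n e) t s = outgoing_slope (f n) (e, t, s) + slope (?\<psi> e) t s"
    if "e \<in> arcs G" "s = 1 \<and> 0 \<le> t \<and> t < len e \<or> s = -1 \<and> 0 < t \<and> t \<le> len e" for n e t s
    unfolding \<xi>_def using has_slope_add[OF sl_f(1)[OF that]] convexifier(5,6)[OF fin that(1)] that(2)
    by (auto intro!: slope_eq)
  have sl_bound: "\<bar>slope (\<xi> n e) t s\<bar> \<le> C"
    if "e \<in> arcs G" "s = 1 \<and> 0 \<le> t \<and> t < len e \<or> s = -1 \<and> 0 < t \<and> t \<le> len e" for n e t s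
    unfolding sl[OF that] C_def using sl_f(2)[OF that, of n] convexifier(2,3)[OF fin that(1), of t] that(2)
    by auto
  have pl_\<xi>: "pl (len e) (\<xi> n e)" if "e \<in> arcs G" for n e
    unfolding \<xi>_def using pl_add[OF rational_pl[OF rf that] convexifier(1)[OF fin that]] .
  have kink_\<xi>: "0 \<le> kink (\<xi> n e) t" if e: "e \<in> arcs G" and t: "0 < t" "t < len e" for n e t
  proof -
    have "kink (\<xi> n e) t = ord_at (Inner e t) (f n) + kink (?\<psi> e) t"
      using sl[OF e, of 1 t n] sl[OF e, of "-1" t n] t
      unfolding ord_at_Inner[OF e t] kink_def outgoing_slope_eq by simp
    moreover have "0 \<le> D (Inner e t) + ord_at (Inner e t) (f n)"
      using f[of n] e t unfolding sections_def points_def by auto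
    ultimately show ?thesis using convexifier(4)[OF fin e t] by simp
  qed
  have "\<exists>b. \<forall>t\<in>{0..len e}. \<bar>?\<psi> e t\<bar> \<le> b" if e: "e \<in> arcs G" for e
    using compact_imp_bounded[OF compact_continuous_image[OF pl_continuous[OF convexifier(1)[OF fin e]]]] len_pos[OF e]
    by (auto simp: bounded_iff)
  then obtain b where b: "\<And>e t. e \<in> arcs G \<Longrightarrow> 0 \<le> t \<Longrightarrow> t \<le> len e \<Longrightarrow> \<bar>?\<psi> e t\<bar> \<le> b e"
    by (metis atLeastAtMost_iff)
  define good where "good n e c \<longleftrightarrow> (\<forall>m\<in>{-C..C}. \<bar>c m\<bar> \<le> (B + b e) + of_int C * len e) \<and>
      (\<forall>t. 0 \<le> t \<longrightarrow> t \<le> len e \<longrightarrow> \<xi> n e t = Max ((\<lambda>m. of_int m * t + c m) ` {-C..C}))" for n e c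
  define c where "c n e = (SOME c. good n e c)" for n e
  have "good n e (c n e)" if e: "e \<in> arcs G" for n e
    unfolding c_def
  proof (rule someI_ex[where P = "good n e"])
    have bd: "\<bar>\<xi> n e t\<bar> \<le> B + b e" if "0 \<le> t" "t \<le> len e" for t
      using B[OF edge_point_in_points[OF e that], of n] b[OF e that] unfolding \<xi>_def by linarith
    show "\<exists>c. good n e c"
      unfolding good_def
    proof (rule convex_pl_eq_Max_affine[where L = "len e" and \<phi> = "\<xi> n e" and C = C and B = "B + b e"])
      show "pl (len e) (\<xi> n e)" by (rule pl_\<xi>[OF e])
      show "0 < len e" by (rule len_pos[OF e])
      show "0 \<le> kink (\<xi> n e) t" if "0 < t" "t < len e" for t by (rule kink_\<xi>[OF e that])
      show "\<bar>slope (\<xi> n e) t 1\<bar> \<le> C" if "0 \<le> t" "t < len e" for t using sl_bound[OF e] that by blast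
      show "\<bar>slope (\<xi> n e) (len e) (-1)\<bar> \<le> C" using sl_bound[OF e] len_pos[OF e] by blast
      show "\<bar>\<xi> n e t\<bar> \<le> B + b e" if "0 \<le> t" "t \<le> len e" for t by (rule bd[OF that])
    qed
  qed
  then have c: "\<And>e n m. e \<in> arcs G \<Longrightarrow> m \<in> {-C..C} \<Longrightarrow> \<bar>c n e m\<bar> \<le> (B + b e) + of_int C * len e"
    "\<And>e n t. e \<in> arcs G \<Longrightarrow> 0 \<le> t \<Longrightarrow> t \<le> len e \<Longrightarrow> \<xi> n e t = Max ((\<lambda>m. of_int m * t + c n e m) ` {-C..C})"
    unfolding good_def by blast+
  obtain r l where r: "strict_mono r" and
    l: "\<forall>i\<in>arcs G \<times> {-C..C}. (\<lambda>n. c (r n) (fst i) (snd i)) \<longlonglongrightarrow> l i"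
    using finite_index_convergent_subsequence[of "arcs G \<times> {-C..C}" "\<lambda>n i. c n (fst i) (snd i)"
        "\<lambda>i. (B + b (fst i)) + of_int C * len (fst i)"] c(1) by auto
  define X where "X e t = Max ((\<lambda>m. of_int m * t + l (e, m)) ` {-C..C})" for e t
  have C: "{-C..C} \<noteq> {}" using pos_degree_nonneg[of D] unfolding C_def by auto
  have lim_\<xi>: "(\<lambda>n. \<xi> (r n) e t) \<longlonglongrightarrow> X e t" if e: "e \<in> arcs G" and t: "0 \<le> t" "t \<le> len e" for e t
  proof -
    have "(\<lambda>n. Max ((\<lambda>m. of_int m * t + c (r n) e m) ` {-C..C})) \<longlonglongrightarrow> X e t"
      unfolding X_def using l e C by (intro tendsto_Max_image tendsto_intros) auto
    then show ?thesis using c(2)[OF e t] by simp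
  qed
  \<comment> \<open>Off \<open>points\<close> the sequence may diverge, and \<open>lim\<close> is
    then an arbitrary value.\<close>
  define F where "F P = lim (\<lambda>n. f (r n) P)" for P
  have lim_f: "(\<lambda>n. pull (f (r n)) e t) \<longlonglongrightarrow> X e t - ?\<psi> e t" if e: "e \<in> arcs G" and t: "0 \<le> t" "t \<le> len e" for e t
    using tendsto_diff[OF lim_\<xi>[OF that] tendsto_const[of "?\<psi> e t"]] unfolding \<xi>_def by simp
  have F_eq: "pull F e t = X e t - ?\<psi> e t" if "e \<in> arcs G" "0 \<le> t" "t \<le> len e" for e t
    unfolding F_def using limI[OF lim_f[OF that]] .
  have limF: "(\<lambda>n. f (r n) P) \<longlonglongrightarrow> F P" if P: "P \<in> points" for P
  proof -
    obtain e t where "e \<in> arcs G" "0 \<le> t" "t \<le> len e" "edge_point e t = P" using point_on_arc[OF ne P] .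
    then show ?thesis using lim_f[of e t] F_eq[of e t] by simp
  qed
  have pl_X: "pl (len e) (X e)" for e
    unfolding X_def by (rule pl_Max[OF _ C]) (simp, subst add.commute, rule pl_affine)
  have rF: "rational_function F"
    unfolding rational_iff
    by (intro ballI pl_cong[OF pl_diff[OF pl_X convexifier(1)[OF fin]]]) (auto simp: F_eq)
  \<comment> \<open>Slopes are integers, so failure means that infinitely many of them are at least
    the slope of \<open>F\<close> plus 1. Their supporting lines, taken after adding the
    \<open>convexifier\<close>, would force this larger slope on the limit.\<close>
  have ev: "\<forall>\<^sub>F n in sequentially. outgoing_slope (f (r n)) d \<le> outgoing_slope F d" if d: "d \<in> directions P" for d P
  proof (rule ccontr)
    assume neg: "\<not> ?thesis"
    obtain e t s where [simp]: "d = (e, t, s)" by (cases d)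
    have e: "e \<in> arcs G" and s: "s = 1 \<and> 0 \<le> t \<and> t < len e \<or> s = -1 \<and> 0 < t \<and> t \<le> len e"
      using d by (auto simp: directions_iff)
    define k where "k = outgoing_slope F d + 1"
    have freq: "\<exists>\<^sub>F n in sequentially. k \<le> outgoing_slope (f (r n)) d"
      using neg unfolding frequently_def k_def by (simp add: not_less add1_zle_eq)
    define \<sigma> where "\<sigma> = slope (?\<psi> e) t s"
    define \<epsilon> where "\<epsilon> = (if s = 1 then len e - t else t)"
    have \<epsilon>: "\<epsilon> > 0" using s unfolding \<epsilon>_def by auto
    have supp: "X e t + of_int (k + \<sigma>) * h \<le> X e (t + s * h)" if h: "0 < h" "h < \<epsilon>" for h
    proof (rule LIMSEQ_le_frequently)
      have th: "0 \<le> t" "t \<le> len e" "0 \<le> t + s * h" "t + s * h \<le> len e"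
        using s h unfolding \<epsilon>_def by (auto split: if_splits)
      show "(\<lambda>n. \<xi> (r n) e (t + s * h)) \<longlonglongrightarrow> X e (t + s * h)" by (rule lim_\<xi>[OF e th(3,4)])
      show "(\<lambda>n. \<xi> (r n) e t + of_int (k + \<sigma>) * h) \<longlonglongrightarrow> X e t + of_int (k + \<sigma>) * h"
        by (intro tendsto_intros lim_\<xi>[OF e th(1,2)])
      show "\<exists>\<^sub>F n in sequentially. \<xi> (r n) e t + of_int (k + \<sigma>) * h \<le> \<xi> (r n) e (t + s * h)"
        using freq
      proof (rule frequently_elim1)
        fix n assume "k \<le> outgoing_slope (f (r n)) d"
        then have "k + \<sigma> \<le> slope (\<xi> (r n) e) t s" unfolding sl[OF e s] \<sigma>_def by simp
        then have "of_int (k + \<sigma>) * h \<le> of_int (slope (\<xi> (r n) e) t s) * h" using h(1) by simp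
        moreover have "\<xi> (r n) e t + of_int (slope (\<xi> (r n) e) t s) * h \<le> \<xi> (r n) e (t + s * h)"
          using s pl_convex[OF pl_\<xi>[OF e] len_pos[OF e] kink_\<xi>[OF e] th, of "r n"] by auto
        ultimately show "\<xi> (r n) e t + of_int (k + \<sigma>) * h \<le> \<xi> (r n) e (t + s * h)" by linarith
      qed
    qed
    have hX: "has_slope (\<lambda>u. X e u - ?\<psi> e u) t s (outgoing_slope F d)"
    proof (rule slope_cong)
      show "has_slope (pull F e) t s (outgoing_slope F d)" using has_outgoing_slope[OF rF] d by simp
    qed (use s F_eq[OF e] in auto)
    have "has_slope (?\<psi> e) t s \<sigma>" unfolding \<sigma>_def using s convexifier(5,6)[OF fin e] by auto
    from has_slope_add[OF hX this] have "has_slope (X e) t s (outgoing_slope F d + \<sigma>)" by simp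
    from has_slope_ge[OF this \<epsilon> supp] show False unfolding k_def by simp
  qed
  have "0 \<le> D P + ord_at P F" if P: "P \<in> points" for P
  proof -
    \<comment> \<open>Only finitely many directions leave \<open>P\<close>, so a single index serves
      all of them.\<close>
    have "\<forall>\<^sub>F n in sequentially. \<forall>d\<in>directions P. outgoing_slope (f (r n)) d \<le> outgoing_slope F d"
      by (rule eventually_ball_finite[OF finite_directions[OF P]]) (use ev in blast)
    then obtain n where "\<forall>d\<in>directions P. outgoing_slope (f (r n)) d \<le> outgoing_slope F d"
      using eventually_happens' trivial_limit_sequentially by blast
    then have "ord_at P (f (r n)) \<le> ord_at P F" unfolding ord_at_def by (intro sum_mono) auto
    then show ?thesis using f[of "r n"] P unfolding sections_def by force
  qed
  then have "F \<in> sections D" using rF unfolding sections_def by blast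
  then show ?thesis using r limF by blast
qed

text \<open>Upper semicontinuity of slopes along moving base points, which may converge to an end of
  the edge. Where \<open>D\<close> is nonpositive in the open edge the sections are convex on it, so
  the supporting lines at the moving points pass to the limit.\<close>

lemma outgoing_slope_limit:
  assumes fin: "finite {P \<in> points. 0 < D P}" and e: "e \<in> arcs G"
    and D0: "\<And>t. 0 < t \<Longrightarrow> t < len e \<Longrightarrow> D (Inner e t) \<le> 0"
    and f: "\<And>n. f n \<in> sections D" and \<tau>: "\<And>n. 0 < \<tau> n" "\<And>n. \<tau> n < len e" "\<tau> \<longlonglongrightarrow> t"
    and s: "s = 1 \<and> 0 \<le> t \<and> t < len e \<or> s = -1 \<and> 0 < t \<and> t \<le> len e"
    and k: "\<And>n. k \<le> outgoing_slope (f n) (e, \<tau> n, s)"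
  obtains F where "F \<in> sections D" "k \<le> outgoing_slope F (e, t, s)"
proof -
  have ne: "arcs G \<noteq> {}" using e by blast
  obtain B where B: "\<And>f P Q. f \<in> sections D \<Longrightarrow> P \<in> points \<Longrightarrow> Q \<in> points \<Longrightarrow> \<bar>f P - f Q\<bar> \<le> B"
    using sections_bounded[OF fin ne] by blast
  \<comment> \<open>Sections are bounded only up to an additive constant; subtracting the value at a
    fixed point makes compactness applicable.\<close>
  define P0 where "P0 = edge_point e 0"
  have P0: "P0 \<in> points" unfolding P0_def using e len_pos[OF e] by (intro edge_point_in_points) auto
  define g where "g n = (\<lambda>P. f n P + (- f n P0))" for n
  have g: "g n \<in> sections D" for n unfolding g_def by (rule sections_add_const[OF f])
  have gB: "\<bar>g n P\<bar> \<le> B" if "P \<in> points" for n P using B[OF f that P0, of n] unfolding g_def by simp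
  obtain F r where r: "strict_mono r" and F: "F \<in> sections D"
    and lim: "\<And>P. P \<in> points \<Longrightarrow> (\<lambda>n. g (r n) P) \<longlonglongrightarrow> F P"
    using sections_compact[of D g, OF fin ne g gB] by blast
  have rg: "rational_function (g n)" for n using g unfolding sections_def by blast
  have rF: "rational_function F" using F unfolding sections_def by blast
  have t: "0 \<le> t" "t \<le> len e" using s len_pos[OF e] by auto
  have \<tau>r: "(\<lambda>n. \<tau> (r n)) \<longlonglongrightarrow> t" using LIMSEQ_subseq_LIMSEQ[OF \<tau>(3) r] by (simp add: o_def)
  \<comment> \<open>The common Lipschitz constant compares the values at the moving points with
    those at \<open>t\<close>.\<close>
  have "(\<lambda>n. pull (g (r n)) e (\<tau> (r n)) - pull (g (r n)) e t) \<longlonglongrightarrow> 0"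
  proof (rule Lim_null_comparison)
    show "\<forall>\<^sub>F n in sequentially. norm (pull (g (r n)) e (\<tau> (r n)) - pull (g (r n)) e t) \<le> of_int (pos_degree D) * \<bar>\<tau> (r n) - t\<bar>"
      using sections_lipschitz[OF fin g e t] \<tau>(1,2) by (intro always_eventually) (auto simp: less_imp_le)
    have "(\<lambda>n. of_int (pos_degree D) * \<bar>\<tau> (r n) - t\<bar>) \<longlonglongrightarrow> of_int (pos_degree D) * \<bar>t - t\<bar>"
      by (intro tendsto_intros \<tau>r)
    then show "(\<lambda>n. of_int (pos_degree D) * \<bar>\<tau> (r n) - t\<bar>) \<longlonglongrightarrow> 0" by simp
  qed
  from tendsto_add[OF this lim[OF edge_point_in_points[OF e t]]]
  have lim\<tau>: "(\<lambda>n. pull (g (r n)) e (\<tau> (r n))) \<longlonglongrightarrow> pull F e t" by simp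
  have kink: "0 \<le> kink (pull (g n) e) u" if u: "0 < u" "u < len e" for n u
  proof -
    have "0 \<le> D (Inner e u) + ord_at (Inner e u) (g n)"
      using g[of n] e u unfolding sections_def points_def by auto
    then show ?thesis using D0[OF u] unfolding ord_at_Inner[OF e u] by simp
  qed
  define \<epsilon> where "\<epsilon> = (if s = 1 then len e - t else t)"
  have \<epsilon>: "\<epsilon> > 0" using s unfolding \<epsilon>_def by auto
  have slg: "k \<le> slope (pull (g n) e) (\<tau> n) s" for n
  proof -
    have d: "(e, \<tau> n, s) \<in> directions (edge_point e (\<tau> n))"
      using e s \<tau>(1,2)[of n] by (auto simp: directions_iff)
    have rfn: "rational_function (f n)" using f unfolding sections_def by blast
    have "outgoing_slope (g n) (e, \<tau> n, s) = outgoing_slope (f n) (e, \<tau> n, s)"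
      unfolding g_def outgoing_slope_add[OF rfn rational_const d] outgoing_slope_const by simp
    then show ?thesis using k[of n] by (simp add: outgoing_slope_eq)
  qed
  have supp: "pull F e t + of_int k * h \<le> pull F e (t + s * h)" if h: "0 < h" "h < \<epsilon>" for h
  proof (rule tendsto_le[OF trivial_limit_sequentially])
    have u: "0 \<le> t + s * h" "t + s * h \<le> len e" using s h unfolding \<epsilon>_def by (auto split: if_splits)
    show "(\<lambda>n. pull (g (r n)) e (t + s * h)) \<longlonglongrightarrow> pull F e (t + s * h)"
      by (rule lim[OF edge_point_in_points[OF e u]])
    have "(\<lambda>n. pull (g (r n)) e (\<tau> (r n)) + of_int k * (s * (t + s * h - \<tau> (r n)))) \<longlonglongrightarrow>
        pull F e t + of_int k * (s * (t + s * h - t))"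
      by (intro tendsto_intros lim\<tau> \<tau>r)
    then show "(\<lambda>n. pull (g (r n)) e (\<tau> (r n)) + of_int k * (s * (t + s * h - \<tau> (r n)))) \<longlonglongrightarrow>
        pull F e t + of_int k * h" using s by auto
    \<comment> \<open>Once \<open>\<tau> (r n)\<close> is this close to \<open>t\<close>, the point
      \<open>t + s * h\<close> lies ahead of it in direction \<open>s\<close>, where the supporting
      line of slope at least \<open>k\<close> bounds the function from below.\<close>
    have "\<forall>\<^sub>F n in sequentially. \<bar>\<tau> (r n) - t\<bar> < h"
      using tendstoD[OF \<tau>r h(1)] by (simp add: dist_real_def)
    then show "\<forall>\<^sub>F n in sequentially. pull (g (r n)) e (\<tau> (r n)) + of_int k * (s * (t + s * h - \<tau> (r n)))
        \<le> pull (g (r n)) e (t + s * h)"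
    proof eventually_elim
      case (elim n)
      let ?\<tau> = "\<tau> (r n)" and ?m = "slope (pull (g (r n)) e) (\<tau> (r n)) s"
      have "0 \<le> s * (t + s * h - ?\<tau>)" using s elim by auto
      then have "of_int k * (s * (t + s * h - ?\<tau>)) \<le> of_int ?m * (s * (t + s * h - ?\<tau>))"
        using slg[of "r n"] by (intro mult_right_mono) auto
      moreover have "pull (g (r n)) e ?\<tau> + of_int ?m * (s * (t + s * h - ?\<tau>)) \<le> pull (g (r n)) e (t + s * h)"
        using s pl_convex[OF rational_pl[OF rg e] len_pos[OF e] kink less_imp_le[OF \<tau>(1)] less_imp_le[OF \<tau>(2)] u, of "r n" "r n"]
          \<tau>(1,2)[of "r n"] by (auto simp: algebra_simps)
      ultimately show ?case by linarith
    qed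
  qed
  have d: "(e, t, s) \<in> directions (edge_point e t)" using e s by (auto simp: directions_iff)
  have "k \<le> outgoing_slope F (e, t, s)"
    by (rule has_slope_ge[OF has_outgoing_slope[OF rF d] \<epsilon> supp])
  then show thesis using that F by blast
qed

section \<open>Maximal functions vanishing on a prescribed set\<close>

definition total :: "(('a, 'b) curve_point \<Rightarrow> real) \<Rightarrow> real" where
  "total f = (\<Sum>e\<in>arcs G. integral {0..len e} (pull f e))"

lemma rational_continuous: "rational_function f \<Longrightarrow> e \<in> arcs G \<Longrightarrow> continuous_on {0..len e} (pull f e)"
  using pl_continuous[OF rational_pl] len_pos by (simp add: less_imp_le)

text \<open>If \<open>F\<close> is a maximal element, then \<open>D + div F\<close> is reduced with respect to \<open>S\<close>: firing a set disjoint
  from \<open>S\<close> would enlarge \<open>F\<close>.\<close>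
definition constrained :: "(('a, 'b) curve_point \<Rightarrow> int) \<Rightarrow> ('a, 'b) curve_point set \<Rightarrow> (('a, 'b) curve_point \<Rightarrow> real) set" where
  "constrained D S = {f. rational_function f \<and> (\<forall>P\<in>S. f P = 0) \<and> (\<forall>P\<in>points. 0 \<le> f P) \<and>
     (\<forall>P\<in>points - S. 0 \<le> D P + ord_at P f)}"

text \<open>Vanishing on \<open>S\<close> and bounded oscillation bound \<open>total\<close>, and
  compactness attains its supremum. Integration is strictly monotone on continuous functions, so a
  maximiser of \<open>total\<close> is maximal for the pointwise order.\<close>

lemma constrained_maximal:
  assumes fin: "finite {P \<in> points. 0 < D P}" and ne: "arcs G \<noteq> {}"
    and S: "S \<subseteq> points" "S \<noteq> {}" and D: "\<And>P. P \<in> points - S \<Longrightarrow> 0 \<le> D P"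
  obtains F where "F \<in> constrained D S"
    "\<And>f. f \<in> constrained D S \<Longrightarrow> (\<And>P. P \<in> points \<Longrightarrow> F P \<le> f P) \<Longrightarrow> (\<And>P. P \<in> points \<Longrightarrow> f P = F P)"
proof -
  \<comment> \<open>On \<open>S\<close> no order is prescribed, but there the functions attain their
    minimum 0 and so have nonnegative order. Truncating \<open>D\<close> at 0 therefore makes all of
    them sections of one divisor.\<close>
  define D' where "D' P = max 0 (D P)" for P
  have "{P \<in> points. 0 < D' P} = {P \<in> points. 0 < D P}" unfolding D'_def by auto
  then have fin': "finite {P \<in> points. 0 < D' P}" using fin by simp
  have sub: "f \<in> sections D'" if "f \<in> constrained D S" for f
  proof -
    have rf: "rational_function f" using that unfolding constrained_def by simp
    have "0 \<le> D' P + ord_at P f" if P: "P \<in> points" for P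
    proof (cases "P \<in> S")
      case True
      have "ord_at P (\<lambda>P. 0) \<le> ord_at P f"
        by (rule ord_at_mono[OF rf rational_const, of 0])
          (use \<open>f \<in> constrained D S\<close> True in \<open>auto simp: constrained_def\<close>)
      then show ?thesis unfolding D'_def by (simp add: ord_at_const)
    next
      case False
      then show ?thesis using \<open>f \<in> constrained D S\<close> P unfolding constrained_def D'_def by force
    qed
    then show ?thesis using rf unfolding sections_def by simp
  qed
  obtain B where B: "\<And>f P Q. f \<in> sections D' \<Longrightarrow> P \<in> points \<Longrightarrow> Q \<in> points \<Longrightarrow> \<bar>f P - f Q\<bar> \<le> B"
    using sections_bounded[OF fin' ne] by blast
  obtain s where s: "s \<in> S" using S(2) by blast
  have bound: "\<bar>f P\<bar> \<le> B" if "f \<in> constrained D S" "P \<in> points" for f P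
  proof -
    have "\<bar>f P - f s\<bar> \<le> B" by (rule B[OF sub[OF that(1)] that(2)]) (use s S in auto)
    moreover have "f s = 0" using that(1) s unfolding constrained_def by simp
    ultimately show ?thesis by simp
  qed
  have cont: "continuous_on {0..len e} (pull f e)" if "f \<in> constrained D S" "e \<in> arcs G" for f e
    using that rational_continuous unfolding constrained_def by blast
  have total_le: "total f \<le> (\<Sum>e\<in>arcs G. B * len e)" if "f \<in> constrained D S" for f
    unfolding total_def
  proof (rule sum_mono)
    fix e assume e: "e \<in> arcs G"
    have "integral {0..len e} (pull f e) \<le> integral {0..len e} (\<lambda>t. B)"
    proof (rule integral_le)
      show "pull f e integrable_on {0..len e}" by (rule integrable_continuous_real[OF cont[OF that e]])
      fix t assume "t \<in> {0..len e}"
      then show "pull f e t \<le> B" using bound[OF that edge_point_in_points[OF e]] by fastforce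
    qed auto
    also have "\<dots> = B * len e" using len_pos[OF e] by simp
    finally show "integral {0..len e} (pull f e) \<le> B * len e" .
  qed
  have "(\<lambda>P. 0) \<in> constrained D S"
    unfolding constrained_def using rational_const D by (auto simp: ord_at_const)
  then have ne': "constrained D S \<noteq> {}" by blast
  have bdd: "bdd_above (total ` constrained D S)" using total_le by (rule bdd_aboveI2)
  define J where "J = (SUP f\<in>constrained D S. total f)"
  have "\<exists>f\<in>constrained D S. J - 1 / real (Suc n) < total f" for n
    using less_cSUP_iff[OF ne' bdd, of "J - 1 / real (Suc n)"] unfolding J_def by simp
  then obtain f where f: "\<And>n. f n \<in> constrained D S" "\<And>n. J - 1 / real (Suc n) < total (f n)" by metis
  obtain F r where r: "strict_mono r" and F: "F \<in> sections D'"
    and lim: "\<And>P. P \<in> points \<Longrightarrow> (\<lambda>n. f (r n) P) \<longlonglongrightarrow> F P"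
    using sections_compact[of D' f, OF fin' ne sub[OF f(1)] bound[OF f(1)]] by blast
  have rF: "rational_function F" using F unfolding sections_def by simp
  have Fc: "F \<in> constrained D S"
    unfolding constrained_def
  proof (intro CollectI conjI ballI)
    fix P assume P: "P \<in> S"
    then have "(\<lambda>n. f (r n) P) = (\<lambda>n. 0)" using f(1) unfolding constrained_def by auto
    then show "F P = 0" using lim[of P] P S(1) LIMSEQ_unique[OF _ tendsto_const] by force
  next
    fix P assume P: "P \<in> points"
    show "0 \<le> F P" by (rule LIMSEQ_le_const[OF lim[OF P]]) (use f(1) P in \<open>auto simp: constrained_def\<close>)
  next
    fix P assume P: "P \<in> points - S"
    then show "0 \<le> D P + ord_at P F" using F D[OF P] unfolding sections_def D'_def by auto
  qed (rule rF)
  have "(\<lambda>n. total (f (r n))) \<longlonglongrightarrow> total F"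
    unfolding total_def
  proof (rule tendsto_sum)
    fix e assume e: "e \<in> arcs G"
    show "(\<lambda>n. integral {0..len e} (pull (f (r n)) e)) \<longlonglongrightarrow> integral {0..len e} (pull F e)"
    proof (rule dominated_convergence(2))
      show "pull (f (r n)) e integrable_on {0..len e}" for n
        by (rule integrable_continuous_real[OF cont[OF f(1) e]])
      show "(\<lambda>t. B) integrable_on {0..len e}" by (rule integrable_const_ivl)
      show "norm (pull (f (r n)) e t) \<le> B" if "t \<in> {0..len e}" for n t
        using bound[OF f(1) edge_point_in_points[OF e]] that by simp
      show "(\<lambda>n. pull (f (r n)) e t) \<longlonglongrightarrow> pull F e t" if "t \<in> {0..len e}" for t
        using lim[OF edge_point_in_points[OF e]] that by simp
    qed
  qed
  moreover have "(\<lambda>n. J - 1 / real (Suc (r n))) \<longlonglongrightarrow> J - 0"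
  proof (intro tendsto_intros)
    show "(\<lambda>n. 1 / real (Suc (r n))) \<longlonglongrightarrow> 0"
      using LIMSEQ_subseq_LIMSEQ[OF LIMSEQ_inverse_real_of_nat r] by (simp add: o_def inverse_eq_divide)
  qed
  ultimately have JF: "J \<le> total F"
    using f(2) by (intro LIMSEQ_le) (auto intro: less_imp_le)
  show thesis
  proof (rule that[OF Fc])
    fix g P assume g: "g \<in> constrained D S" and le: "\<And>P. P \<in> points \<Longrightarrow> F P \<le> g P" and P: "P \<in> points"
    have "total g \<le> J" unfolding J_def by (rule cSUP_upper[OF g bdd])
    then have "total g - total F \<le> 0" using JF by simp
    moreover have int: "integral {0..len e} (pull g e) - integral {0..len e} (pull F e) =
        integral {0..len e} (\<lambda>t. pull g e t - pull F e t)" if "e \<in> arcs G" for e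
      using integral_diff[OF integrable_continuous_real[OF cont[OF g that]] integrable_continuous_real[OF cont[OF Fc that]]]
      by simp
    ultimately have sum0: "(\<Sum>e\<in>arcs G. integral {0..len e} (\<lambda>t. pull g e t - pull F e t)) \<le> 0"
      unfolding total_def sum_subtractf[symmetric] by simp
    have pos: "0 \<le> pull g e t - pull F e t" if "e \<in> arcs G" "t \<in> {0..len e}" for e t
      using le[OF edge_point_in_points[OF that(1)]] that(2) by simp
    have nonneg: "0 \<le> integral {0..len e} (\<lambda>t. pull g e t - pull F e t)" if "e \<in> arcs G" for e
      using pos[OF that] by (intro integral_nonneg integrable_continuous_real continuous_on_diff cont g Fc that) auto
    obtain e t where e: "e \<in> arcs G" and t: "0 \<le> t" "t \<le> len e" "edge_point e t = P"
      using point_on_arc[OF ne P] .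
    have "integral {0..len e} (\<lambda>t. pull g e t - pull F e t) \<le> (\<Sum>e\<in>arcs G. integral {0..len e} (\<lambda>t. pull g e t - pull F e t))"
      using nonneg e by (intro member_le_sum) auto
    then have "integral {0..len e} (\<lambda>t. pull g e t - pull F e t) = 0" using sum0 nonneg[OF e] by linarith
    then have "\<forall>t\<in>{0..len e}. pull g e t - pull F e t = 0"
      using integral_eq_0_iff[of 0 "len e" "\<lambda>t. pull g e t - pull F e t"] pos[OF e] len_pos[OF e]
        continuous_on_diff[OF cont[OF g e] cont[OF Fc e]] by blast
    then show "g P = F P" using t by auto
  qed
qed

end

section \<open>Burning and the rank of the canonical divisor\<close>

text \<open>Dhar's burning: let \<open>V\<close> burn one vertex at a time, each \<open>v\<close>
  satisfying \<open>D v + 1 \<le>\<close> the number of its edges to burnt vertices. These numbers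
  sum to at most \<open>card F\<close>, and by \<open>total\<close> the left sides sum to exactly
  that. So all estimates are sharp, and the claim can be read off at the last vertex of
  \<open>A\<close> to burn.\<close>

lemma burning_count:
  fixes x y :: "'f \<Rightarrow> 'v" and D :: "'v \<Rightarrow> int"
  assumes fin: "finite V" "finite F" and ends: "x ` F \<subseteq> V" "y ` F \<subseteq> V"
    and total: "(\<Sum>v\<in>V. D v) = int (card F) - int (card V)"
    and burn: "\<And>B. B \<subset> V \<Longrightarrow> \<exists>v\<in>V - B. D v < int (card {f \<in> F. x f = v \<and> y f \<in> B \<or> y f = v \<and> x f \<in> B})"
    and A: "A \<subseteq> V" "A \<noteq> {}"
  shows "\<exists>v\<in>A. int (card {f \<in> F. x f = v \<and> y f \<in> A}) + int (card {f \<in> F. y f = v \<and> x f \<in> A}) - 1 \<le> D v"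
proof (rule ccontr)
  assume "\<not> ?thesis"
  then have small: "D v + 2 \<le> int (card {f \<in> F. x f = v \<and> y f \<in> A}) + int (card {f \<in> F. y f = v \<and> x f \<in> A})"
    if "v \<in> A" for v using that by force
  \<comment> \<open>The slack accumulated once \<open>B\<close> has burnt. It starts at 0, never
    decreases, and must be 0 for \<open>V\<close>; under \<open>small\<close> it would grow by at
    least 1 when \<open>A\<close> is completed.\<close>
  define W where "W B = int (card {f \<in> F. x f \<in> B \<and> y f \<in> B}) - (\<Sum>v\<in>B. D v + 1)" for B
  have "k \<le> card V \<Longrightarrow> \<exists>B\<subseteq>V. card B = k \<and> (if A \<subseteq> B then 1 else 0) \<le> W B" for k
  proof (induction k)
    case 0
    show ?case using A by (intro exI[of _ "{}"]) (auto simp: W_def)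
  next
    case (Suc k)
    then obtain B where B: "B \<subseteq> V" "card B = k" "(if A \<subseteq> B then 1 else 0) \<le> W B" by auto
    have finB: "finite B" using B(1) fin(1) by (rule finite_subset)
    have "B \<subset> V" using B Suc.prems by auto
    from burn[OF this] obtain v where v: "v \<in> V" "v \<notin> B" and
      Dv: "D v < int (card {f \<in> F. x f = v \<and> y f \<in> B \<or> y f = v \<and> x f \<in> B})" by blast
    define b1 where "b1 = {f \<in> F. x f = v \<and> y f \<in> B}"
    define b2 where "b2 = {f \<in> F. y f = v \<and> x f \<in> B}"
    define l where "l = {f \<in> F. x f = v \<and> y f = v}"
    have fins: "finite b1" "finite b2" "finite l" using fin(2) unfolding b1_def b2_def l_def by auto
    have "{f \<in> F. x f = v \<and> y f \<in> B \<or> y f = v \<and> x f \<in> B} = b1 \<union> b2" unfolding b1_def b2_def by auto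
    moreover have "b1 \<inter> b2 = {}" using v(2) unfolding b1_def b2_def by auto
    ultimately have Dv': "D v < int (card b1) + int (card b2)" using Dv fins by (simp add: card_Un_disjoint)
    have "{f \<in> F. x f \<in> insert v B \<and> y f \<in> insert v B} = {f \<in> F. x f \<in> B \<and> y f \<in> B} \<union> (b1 \<union> (b2 \<union> l))"
      unfolding b1_def b2_def l_def by auto
    moreover have "card ({f \<in> F. x f \<in> B \<and> y f \<in> B} \<union> (b1 \<union> (b2 \<union> l))) =
        card {f \<in> F. x f \<in> B \<and> y f \<in> B} + (card b1 + (card b2 + card l))"
      using fins fin(2) v(2)
      by (subst card_Un_disjoint; (subst card_Un_disjoint)?; (subst card_Un_disjoint)?) (auto simp: b1_def b2_def l_def)
    ultimately have W: "W (insert v B) = W B + int (card b1) + int (card b2) + int (card l) - D v - 1"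
      unfolding W_def using v(2) finB by simp
    have "(if A \<subseteq> insert v B then 1 else 0) \<le> W (insert v B)"
    proof (cases "A \<subseteq> insert v B \<and> \<not> A \<subseteq> B")
      case True
      \<comment> \<open>\<open>v\<close> is the last vertex of \<open>A\<close> to burn, so its
        edges into \<open>A\<close> lead to burnt vertices or are loops.\<close>
      then have vA: "v \<in> A" by auto
      have "{f \<in> F. x f = v \<and> y f \<in> A} \<subseteq> b1 \<union> l" "{f \<in> F. y f = v \<and> x f \<in> A} \<subseteq> b2 \<union> l"
        using True unfolding b1_def b2_def l_def by auto
      then have "card {f \<in> F. x f = v \<and> y f \<in> A} \<le> card b1 + card l" "card {f \<in> F. y f = v \<and> x f \<in> A} \<le> card b2 + card l"
        using fins card_mono[of "b1 \<union> l"] card_mono[of "b2 \<union> l"] card_Un_le[of b1 l] card_Un_le[of b2 l]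
        by (meson finite_UnI order_trans)+
      then have "D v + 2 \<le> int (card b1) + int (card b2) + 2 * int (card l)" using small[OF vA] by linarith
      moreover have "0 \<le> W B" using B(3) by (auto split: if_splits)
      \<comment> \<open>A loop counts twice in \<open>small\<close> but once in \<open>W\<close>.
        Without loops \<open>small\<close> provides the gain of 1; otherwise a loop itself
        does.\<close>
      ultimately show ?thesis using W Dv' True by (cases "card l = 0") auto
    next
      case False
      then show ?thesis using W Dv' B(3) by (auto split: if_splits)
    qed
    moreover have "insert v B \<subseteq> V" "card (insert v B) = Suc k" using v B finB by auto
    ultimately show ?case by blast
  qed
  from this[of "card V"] obtain B where B: "B \<subseteq> V" "card B = card V" "(if A \<subseteq> B then 1 else 0) \<le> W B" by auto
  then have "B = V" using fin(1) card_subset_eq by blast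
  then have "1 \<le> W V" using B(3) A(1) by simp
  moreover have "{f \<in> F. x f \<in> V \<and> y f \<in> V} = F" using ends by auto
  then have "W V = 0" unfolding W_def using total by (simp add: sum.distrib)
  ultimately show False by simp
qed

context tropical_curve
begin

definition canonical :: "('a, 'b) curve_point \<Rightarrow> int" where
  "canonical P = int (card (directions P)) - 2"

lemma canonical_Inner: "e \<in> arcs G \<Longrightarrow> 0 < t \<Longrightarrow> t < len e \<Longrightarrow> canonical (Inner e t) = 0"
  unfolding canonical_def by (simp add: directions_Inner)

lemma sum_canonical:
  assumes "finite V" "Vertex ` verts G \<subseteq> V" "V \<subseteq> points"
  shows "(\<Sum>P\<in>V. canonical P) = 2 * genus - 2"
proof -
  have "(\<Sum>P\<in>V. canonical P) = (\<Sum>P\<in>Vertex ` verts G. canonical P)"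
  proof (rule sum.mono_neutral_right[OF assms(1,2)], intro ballI)
    fix P assume P: "P \<in> V - Vertex ` verts G"
    then have "P \<in> points" using assms by auto
    then show "canonical P = 0" by (cases rule: points_cases) (use P canonical_Inner in auto)
  qed
  also have "\<dots> = (\<Sum>v\<in>verts G. \<Sum>d\<in>directions (Vertex v). 1) - (\<Sum>v\<in>verts G. 2)"
    by (simp add: sum.reindex card_image inj_on_def canonical_def sum_subtractf)
  also have "\<dots> = 2 * genus - 2"
    unfolding sum_directions_verts genus_def by simp
  finally show ?thesis .
qed

section \<open>Finite models: subdivisions with a given vertex set\<close>

definition grid :: "('a, 'b) curve_point set \<Rightarrow> 'b \<Rightarrow> real set" where
  "grid V e = {t. 0 \<le> t \<and> t \<le> len e \<and> edge_point e t \<in> V}"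

text \<open>The edges of the model, as pairs of consecutive grid points. Keeping the underlying arc
  in the triple distinguishes parallel segments.\<close>

definition segments :: "('a, 'b) curve_point set \<Rightarrow> ('b \<times> real \<times> real) set" where
  "segments V = {(e, a, b). e \<in> arcs G \<and> a \<in> grid V e \<and> b \<in> grid V e \<and> a < b \<and> grid V e \<inter> {a<..<b} = {}}"

definition left_end :: "'b \<times> real \<times> real \<Rightarrow> ('a, 'b) curve_point" where
  "left_end = (\<lambda>(e, a, b). edge_point e a)"

definition right_end :: "'b \<times> real \<times> real \<Rightarrow> ('a, 'b) curve_point" where
  "right_end = (\<lambda>(e, a, b). edge_point e b)"

definition left_dir :: "'b \<times> real \<times> real \<Rightarrow> 'b \<times> real \<times> real" where
  "left_dir = (\<lambda>(e, a, b). (e, a, 1))"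

definition right_dir :: "'b \<times> real \<times> real \<Rightarrow> 'b \<times> real \<times> real" where
  "right_dir = (\<lambda>(e, a, b). (e, b, -1))"

lemma finite_grid:
  assumes "finite V"
  shows "finite (grid V e)"
proof -
  have "finite {t. Inner e t \<in> V}"
    using finite_vimageI[OF assms, of "Inner e"] by (simp add: inj_on_def vimage_def)
  moreover have "grid V e \<subseteq> insert 0 (insert (len e) {t. Inner e t \<in> V})"
    unfolding grid_def edge_point_def by auto
  ultimately show ?thesis using finite_subset by blast
qed

lemma finite_segments:
  assumes "finite V"
  shows "finite (segments V)"
proof (rule finite_subset)
  show "segments V \<subseteq> (SIGMA e:arcs G. grid V e \<times> grid V e)" unfolding segments_def by auto
qed (simp add: finite_grid[OF assms])

lemma segment_right_of:
  assumes V: "finite V" "Vertex ` verts G \<subseteq> V" and e: "e \<in> arcs G" and a: "a \<in> grid V e" "a < len e"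
  obtains b where "(e, a, b) \<in> segments V" "\<And>w. w \<in> grid V e \<Longrightarrow> a < w \<Longrightarrow> b \<le> w"
proof -
  let ?W = "{w \<in> grid V e. a < w}"
  have fin: "finite ?W" using finite_grid[OF V(1)] by simp
  have "len e \<in> ?W" using V(2) e a len_pos[OF e] unfolding grid_def edge_point_def by auto
  then have ne: "?W \<noteq> {}" by blast
  have "Min ?W \<in> ?W" using Min_in[OF fin ne] .
  moreover have "Min ?W \<le> w" if "w \<in> ?W" for w using Min_le[OF fin that] .
  ultimately have "(e, a, Min ?W) \<in> segments V" unfolding segments_def using e a by force
  then show thesis using that \<open>\<And>w. w \<in> ?W \<Longrightarrow> Min ?W \<le> w\<close> by blast
qed

lemma segment_left_of:
  assumes V: "finite V" "Vertex ` verts G \<subseteq> V" and e: "e \<in> arcs G" and b: "b \<in> grid V e" "0 < b"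
  obtains a where "(e, a, b) \<in> segments V"
proof -
  let ?W = "{w \<in> grid V e. w < b}"
  have fin: "finite ?W" using finite_grid[OF V(1)] by simp
  have "0 \<in> ?W" using V(2) e b len_pos[OF e] unfolding grid_def edge_point_def by auto
  then have ne: "?W \<noteq> {}" by blast
  have "Max ?W \<in> ?W" using Max_in[OF fin ne] .
  moreover have "w \<le> Max ?W" if "w \<in> ?W" for w using Max_ge[OF fin that] .
  ultimately have "(e, Max ?W, b) \<in> segments V" unfolding segments_def using e b by force
  then show thesis using that by blast
qed

lemma segments_unique:
  assumes "(e, a, b) \<in> segments V" "(e, a', b') \<in> segments V"
  shows "a = a' \<longleftrightarrow> b = b'"
proof -
  have "\<not> (a < b' \<and> b' < b)" "\<not> (a' < b \<and> b < b')" "\<not> (a < a' \<and> a' < b)" "\<not> (a' < a \<and> a < b')" "a < b" "a' < b'"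
    using assms unfolding segments_def by auto
  then show ?thesis by linarith
qed

lemma segment_bounds:
  assumes "(e, a, b) \<in> segments V"
  shows "e \<in> arcs G" "0 \<le> a" "a < b" "b \<le> len e"
  using assms unfolding segments_def grid_def by auto

text \<open>The directions at a model point are the segment ends there; a loop is met once from each
  side. The general summand serves both for counting valences and for orders of functions.\<close>

lemma sum_directions_segments:
  fixes \<phi> :: "_ \<Rightarrow> 'c::comm_monoid_add"
  assumes V: "finite V" "Vertex ` verts G \<subseteq> V" and P: "P \<in> V"
  shows "(\<Sum>d\<in>directions P. \<phi> d) =
    (\<Sum>q | q \<in> segments V \<and> left_end q = P. \<phi> (left_dir q)) + (\<Sum>q | q \<in> segments V \<and> right_end q = P. \<phi> (right_dir q))"
proof -
  let ?L = "{q \<in> segments V. left_end q = P}" and ?R = "{q \<in> segments V. right_end q = P}"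
  have "directions P = left_dir ` ?L \<union> right_dir ` ?R"
  proof (intro equalityI subsetI)
    fix d assume d: "d \<in> directions P"
    obtain e t s where [simp]: "d = (e, t, s)" by (cases d)
    have e: "e \<in> arcs G" "edge_point e t = P" and s: "s = 1 \<and> 0 \<le> t \<and> t < len e \<or> s = -1 \<and> 0 < t \<and> t \<le> len e"
      using d by (auto simp: directions_iff)
    have t: "t \<in> grid V e" unfolding grid_def using s e P by auto
    from s show "d \<in> left_dir ` ?L \<union> right_dir ` ?R"
    proof
      assume s: "s = 1 \<and> 0 \<le> t \<and> t < len e"
      then obtain b where "(e, t, b) \<in> segments V" using segment_right_of[OF V e(1) t] by blast
      then have "d \<in> left_dir ` ?L" using s e unfolding left_dir_def left_end_def by force
      then show ?thesis ..
    next
      assume s: "s = -1 \<and> 0 < t \<and> t \<le> len e"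
      then obtain a where "(e, a, t) \<in> segments V" using segment_left_of[OF V e(1) t] by blast
      then have "d \<in> right_dir ` ?R" using s e unfolding right_dir_def right_end_def by force
      then show ?thesis ..
    qed
  next
    fix d assume "d \<in> left_dir ` ?L \<union> right_dir ` ?R"
    then show "d \<in> directions P"
      using segment_bounds by (auto simp: left_dir_def left_end_def right_dir_def right_end_def directions_iff) fastforce+
  qed
  moreover have "left_dir ` ?L \<inter> right_dir ` ?R = {}" unfolding left_dir_def right_dir_def by auto
  moreover have "inj_on left_dir ?L" "inj_on right_dir ?R"
    unfolding left_dir_def right_dir_def inj_on_def by (auto, (metis segments_unique)+)
  ultimately show ?thesis
    using finite_segments[OF V(1)] by (simp add: sum.union_disjoint sum.reindex)
qed

lemma segment_ends:
  assumes "q \<in> segments V"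
  shows "left_end q \<in> V" "right_end q \<in> V"
  using assms unfolding segments_def left_end_def right_end_def grid_def by auto

text \<open>Subdivision preserves the genus: the valences sum to twice the number of segments, and
  \<open>sum_canonical\<close> evaluates the same sum.\<close>

lemma card_segments:
  assumes V: "finite V" "Vertex ` verts G \<subseteq> V" "V \<subseteq> points"
  shows "int (card (segments V)) - int (card V) = genus - 1"
proof -
  have "(\<Sum>P\<in>V. \<Sum>d\<in>directions P. 1 :: int) =
    (\<Sum>P\<in>V. \<Sum>q | q \<in> segments V \<and> left_end q = P. 1) + (\<Sum>P\<in>V. \<Sum>q | q \<in> segments V \<and> right_end q = P. 1)"
    by (simp only: sum_directions_segments[OF V(1,2)] sum.distrib cong: sum.cong)
  also have "(\<Sum>P\<in>V. \<Sum>q | q \<in> segments V \<and> left_end q = P. 1) = (\<Sum>q\<in>segments V. 1 :: int)"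
    by (rule sum.group[OF finite_segments[OF V(1)] V(1)]) (use segment_ends in auto)
  also have "(\<Sum>P\<in>V. \<Sum>q | q \<in> segments V \<and> right_end q = P. 1) = (\<Sum>q\<in>segments V. 1 :: int)"
    by (rule sum.group[OF finite_segments[OF V(1)] V(1)]) (use segment_ends in auto)
  finally have "(\<Sum>P\<in>V. int (card (directions P))) = 2 * int (card (segments V))" by simp
  then show ?thesis using sum_canonical[OF V] unfolding canonical_def by (simp add: sum_subtractf)
qed

text \<open>Chip firing of \<open>A\<close>: inside each edge, \<open>h\<close> is
  \<open>\<epsilon>\<close> minus the distance to the subgraph spanned by \<open>A\<close>, cut off
  at 0. At most one chip leaves along each segment end pointing out of \<open>A\<close>, and chips
  arrive where the flanks reach 0.\<close>

lemma firing_function: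
  assumes V: "finite V" "Vertex ` verts G \<subseteq> V" "V \<subseteq> points" and A: "A \<subseteq> V"
  shows "\<exists>h. rational_function h \<and> (\<forall>P\<in>points. 0 \<le> h P) \<and> (\<forall>P\<in>V - A. h P = 0) \<and>
    (\<forall>P\<in>A. 0 < h P) \<and> (\<forall>P\<in>points - A. 0 \<le> ord_at P h) \<and>
    (\<forall>P\<in>A. - int (card {q \<in> segments V. left_end q = P \<and> right_end q \<notin> A \<or> right_end q = P \<and> left_end q \<notin> A}) \<le> ord_at P h)"
proof -
  \<comment> \<open>At most the length of every segment, so a flank has come down to 0 when it meets
    a model point outside \<open>A\<close>. The 1 covers the case of no segments.\<close>
  define \<epsilon> where "\<epsilon> = Min (insert 1 ((\<lambda>(e, a, b). b - a) ` segments V))"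
  have \<epsilon>: "0 < \<epsilon>" unfolding \<epsilon>_def using finite_segments[OF V(1)] by (auto simp: segments_def)
  have \<epsilon>_le: "\<epsilon> \<le> b - a" if "(e, a, b) \<in> segments V" for e a b
    unfolding \<epsilon>_def using finite_segments[OF V(1)] that by (intro Min_le) force+
  have gap: "\<epsilon> \<le> w - u" if e: "e \<in> arcs G" and u: "u \<in> grid V e" and w: "w \<in> grid V e" "u < w" for e u w
  proof -
    have "u < len e" using w unfolding grid_def by simp
    then obtain b where "(e, u, b) \<in> segments V" "b \<le> w" using segment_right_of[OF V(1,2) e u] w by blast
    then show ?thesis using \<epsilon>_le by fastforce
  qed
  \<comment> \<open>The trace on \<open>e\<close> of the subgraph spanned by \<open>A\<close>;
    points of \<open>A\<close> appear as degenerate intervals.\<close>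
  define pieces where "pieces e = {(a, a) | a. a \<in> grid V e \<and> edge_point e a \<in> A} \<union>
      {(a, b). (e, a, b) \<in> segments V \<and> edge_point e a \<in> A \<and> edge_point e b \<in> A}" for e
  define tent where "tent q s = \<epsilon> - max 0 (max (fst q - s) (s - snd q))" for q s
  define \<phi> where "\<phi> e s = Max ((\<lambda>i. i s) ` insert (\<lambda>s. 0) (tent ` pieces e))" for e s
  define h where "h P = (case P of Vertex v \<Rightarrow> if Vertex v \<in> A then \<epsilon> else 0 | Inner e t \<Rightarrow> \<phi> e t)" for P
  have fin_p: "finite (pieces e)" for e
  proof (rule finite_subset)
    show "pieces e \<subseteq> grid V e \<times> grid V e" unfolding pieces_def segments_def by auto
  qed (simp add: finite_grid[OF V(1)])
  have p_grid: "x \<in> grid V e" "y \<in> grid V e" "edge_point e x \<in> A" "edge_point e y \<in> A" "x \<le> y" "grid V e \<inter> {x<..<y} = {}"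
    if "(x, y) \<in> pieces e" for x y e
    using that unfolding pieces_def segments_def by auto
  have \<phi>_ge0: "0 \<le> \<phi> e s" for e s
    unfolding \<phi>_def by (rule Max_ge) (use fin_p in auto)
  have \<phi>_ge: "tent q s \<le> \<phi> e s" if "q \<in> pieces e" for q e s
    unfolding \<phi>_def by (rule Max_ge) (use fin_p that in auto)
  have \<phi>_attained: "\<phi> e s = 0 \<or> (\<exists>q\<in>pieces e. \<phi> e s = tent q s)" for e s
  proof -
    have "\<phi> e s \<in> (\<lambda>i. i s) ` insert (\<lambda>s. 0) (tent ` pieces e)"
      unfolding \<phi>_def by (rule Max_in) (use fin_p in auto)
    then show ?thesis by auto
  qed
  have \<phi>_grid: "\<phi> e s = (if edge_point e s \<in> A then \<epsilon> else 0)" if e: "e \<in> arcs G" and s: "s \<in> grid V e" for e s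
  proof (cases "edge_point e s \<in> A")
    case True
    then have "(s, s) \<in> pieces e" unfolding pieces_def using s by blast
    from \<phi>_ge[OF this, of s] have "\<epsilon> \<le> \<phi> e s" unfolding tent_def by simp
    moreover have "tent q s \<le> \<epsilon>" for q unfolding tent_def by simp
    then have "\<phi> e s \<le> \<epsilon>" using \<phi>_attained[of e s] \<epsilon> by force
    ultimately show ?thesis using True by simp
  next
    case False
    have "tent q s \<le> 0" if "q \<in> pieces e" for q
    proof -
      obtain x y where q: "q = (x, y)" by (cases q)
      note g = p_grid[OF that[unfolded q]]
      have "s \<noteq> x" "s \<noteq> y" using False g by auto
      moreover have "\<not> (x < s \<and> s < y)" using g(6) s by auto
      ultimately consider "s < x" | "y < s" by linarith
      then show ?thesis
      proof cases
        case 1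
        then have "\<epsilon> \<le> x - s" by (rule gap[OF e s g(1)])
        then show ?thesis unfolding tent_def q by simp
      next
        case 2
        then have "\<epsilon> \<le> s - y" by (rule gap[OF e g(2) s])
        then show ?thesis unfolding tent_def q by simp
      qed
    qed
    then show ?thesis using \<phi>_attained[of e s] \<phi>_ge0[of e s] False by force
  qed
  have pull_h: "pull h e s = \<phi> e s" if e: "e \<in> arcs G" and s: "0 \<le> s" "s \<le> len e" for e s
  proof -
    have "0 \<in> grid V e" "len e \<in> grid V e"
      using V(2) e len_pos[OF e] unfolding grid_def edge_point_def by auto
    then show ?thesis using \<phi>_grid[OF e, of 0] \<phi>_grid[OF e, of "len e"] len_pos[OF e] unfolding h_def edge_point_def by auto
  qed
  have pl_tent: "pl L (tent q)" for L q
  proof -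
    have "pl L (\<lambda>s. \<epsilon> - max 0 (max (fst q + of_int (-1) * s) (- snd q + of_int 1 * s)))"
      by (intro pl_diff pl_max pl_const pl_affine)
    moreover have "(\<lambda>s. \<epsilon> - max 0 (max (fst q + of_int (-1) * s) (- snd q + of_int 1 * s))) = tent q"
      unfolding tent_def by auto
    ultimately show ?thesis by simp
  qed
  have pl_\<phi>: "pl L (\<phi> e)" for L e
    unfolding \<phi>_def by (rule pl_Max) (use fin_p pl_tent pl_const in auto)
  have rh: "rational_function h"
    unfolding rational_iff using pl_cong[OF pl_\<phi>] pull_h by metis
  have h_V: "h P = (if P \<in> A then \<epsilon> else 0)" if P: "P \<in> V" for P
  proof -
    have "P \<in> points" using P V(3) by blast
    then show ?thesis
    proof (cases rule: points_cases)
      case (1 v)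
      then show ?thesis by (simp add: h_def)
    next
      case (2 e t)
      then have "edge_point e t = P" "t \<in> grid V e" using P by (auto simp: edge_point_def grid_def)
      then show ?thesis using \<phi>_grid[OF 2(1), of t] pull_h[OF 2(1), of t] 2 by simp
    qed
  qed
  have h_ge0: "0 \<le> h P" if "P \<in> points" for P
    using that by (cases rule: points_cases) (use \<epsilon> \<phi>_ge0 in \<open>auto simp: h_def\<close>)
  \<comment> \<open>\<open>\<phi> e\<close> is a maximum, so its slope is at least that of any tent
    which attains it at \<open>t\<close>. All lower bounds on orders of \<open>h\<close> at positive
    values come from this.\<close>
  have sl_ge: "k \<le> outgoing_slope h (e, t, s)"
    if d: "(e, t, s) \<in> directions P" and \<delta>: "0 < \<delta>" and q: "q \<in> pieces e" "\<phi> e t = tent q t"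
      and t: "\<And>h. 0 < h \<Longrightarrow> h < \<delta> \<Longrightarrow> tent q t + of_int k * h \<le> tent q (t + s * h)" for e t s P q \<delta> k
  proof (rule has_slope_ge[OF has_outgoing_slope[OF rh d]])
    have e: "e \<in> arcs G" and s: "s = 1 \<and> 0 \<le> t \<and> t < len e \<or> s = -1 \<and> 0 < t \<and> t \<le> len e"
      using d by (auto simp: directions_iff)
    define \<eta> where "\<eta> = min \<delta> (if s = 1 then len e - t else t)"
    show "0 < \<eta>" unfolding \<eta>_def using \<delta> s by auto
    fix h' assume h': "0 < h'" "h' < \<eta>"
    then have "pull h e t = \<phi> e t" "pull h e (t + s * h') = \<phi> e (t + s * h')"
      using s e unfolding \<eta>_def by (auto intro!: pull_h split: if_splits)
    then show "pull h e t + of_int k * h' \<le> pull h e (t + s * h')"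
      using t[of h'] h' \<phi>_ge[OF q(1), of "t + s * h'"] q(2) unfolding \<eta>_def by simp
  qed
  have ordA: "- int (card {q \<in> segments V. left_end q = P \<and> right_end q \<notin> A \<or> right_end q = P \<and> left_end q \<notin> A}) \<le> ord_at P h"
    if P: "P \<in> A" for P
  proof -
    have PV: "P \<in> V" using A P by blast
    have l: "(if right_end q \<in> A then 0 else -1) \<le> outgoing_slope h (left_dir q)"
      if q: "q \<in> segments V" "left_end q = P" for q
    proof -
      obtain e a b where qq: "q = (e, a, b)" by (cases q)
      note bd = segment_bounds[OF q(1)[unfolded qq]]
      have a: "a \<in> grid V e" "edge_point e a = P" using q unfolding qq segments_def left_end_def by auto
      have d: "(e, a, 1) \<in> directions P" using bd a by (simp add: directions_iff)
      have \<phi>: "\<phi> e a = \<epsilon>" using \<phi>_grid[OF bd(1) a(1)] a(2) P by simp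
      show ?thesis
      proof (cases "right_end q \<in> A")
        case True
        then have "(a, b) \<in> pieces e" using q P unfolding pieces_def qq left_end_def right_end_def by auto
        then have "0 \<le> outgoing_slope h (e, a, 1)"
          using bd \<phi> by (intro sl_ge[OF d, of "b - a" "(a, b)"]) (auto simp: tent_def)
        then show ?thesis using True unfolding qq left_dir_def by simp
      next
        case False
        have "(a, a) \<in> pieces e" using a P unfolding pieces_def by auto
        then have "-1 \<le> outgoing_slope h (e, a, 1)"
          using bd \<phi> by (intro sl_ge[OF d, of 1 "(a, a)"]) (auto simp: tent_def)
        then show ?thesis using False unfolding qq left_dir_def by simp
      qed
    qed
    have r: "(if left_end q \<in> A then 0 else -1) \<le> outgoing_slope h (right_dir q)"
      if q: "q \<in> segments V" "right_end q = P" for q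
    proof -
      obtain e a b where qq: "q = (e, a, b)" by (cases q)
      note bd = segment_bounds[OF q(1)[unfolded qq]]
      have b: "b \<in> grid V e" "edge_point e b = P" using q unfolding qq segments_def right_end_def by auto
      have d: "(e, b, -1) \<in> directions P" using bd b by (simp add: directions_iff)
      have \<phi>: "\<phi> e b = \<epsilon>" using \<phi>_grid[OF bd(1) b(1)] b(2) P by simp
      show ?thesis
      proof (cases "left_end q \<in> A")
        case True
        then have "(a, b) \<in> pieces e" using q P unfolding pieces_def qq left_end_def right_end_def by auto
        then have "0 \<le> outgoing_slope h (e, b, -1)"
          using bd \<phi> by (intro sl_ge[OF d, of "b - a" "(a, b)"]) (auto simp: tent_def)
        then show ?thesis using True unfolding qq right_dir_def by simp
      next
        case False
        have "(b, b) \<in> pieces e" using b P unfolding pieces_def by auto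
        then have "-1 \<le> outgoing_slope h (e, b, -1)"
          using bd \<phi> by (intro sl_ge[OF d, of 1 "(b, b)"]) (auto simp: tent_def)
        then show ?thesis using False unfolding qq right_dir_def by simp
      qed
    qed
    let ?X = "{q \<in> segments V. left_end q = P \<and> right_end q \<notin> A}"
    let ?Y = "{q \<in> segments V. right_end q = P \<and> left_end q \<notin> A}"
    have fins: "finite (segments V)" by (rule finite_segments[OF V(1)])
    have "(\<Sum>q | q \<in> segments V \<and> left_end q = P. if right_end q \<in> A then 0 else -1 :: int) = - int (card ?X)"
      using fins by (simp add: sum.If_cases Int_def conj_ac)
    moreover have "(\<Sum>q | q \<in> segments V \<and> right_end q = P. if left_end q \<in> A then 0 else -1 :: int) = - int (card ?Y)"
      using fins by (simp add: sum.If_cases Int_def conj_ac)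
    moreover have "{q \<in> segments V. left_end q = P \<and> right_end q \<notin> A \<or> right_end q = P \<and> left_end q \<notin> A} = ?X \<union> ?Y"
      by auto
    moreover have "card (?X \<union> ?Y) = card ?X + card ?Y" using fins P by (intro card_Un_disjoint) auto
    moreover have "(\<Sum>q | q \<in> segments V \<and> left_end q = P. if right_end q \<in> A then 0 else -1 :: int) +
        (\<Sum>q | q \<in> segments V \<and> right_end q = P. if left_end q \<in> A then 0 else -1 :: int) \<le> ord_at P h"
      unfolding ord_at_def sum_directions_segments[OF V(1,2) PV] using l r by (intro add_mono sum_mono) auto
    ultimately show ?thesis by simp
  qed
  \<comment> \<open>Where \<open>h\<close> vanishes it is minimal. Elsewhere the point is not a
    model point, and the active tent is linear near it, on a flank or on its plateau.\<close>
  have ord_off: "0 \<le> ord_at P h" if P: "P \<in> points - A" for P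
  proof (cases "h P = 0")
    case True
    have "ord_at P (\<lambda>P. 0) \<le> ord_at P h"
      by (rule ord_at_mono[OF rh rational_const, of 0]) (use h_ge0 True in auto)
    then show ?thesis by (simp add: ord_at_const)
  next
    case False
    then have PV: "P \<notin> V" using h_V[of P] P by auto
    have "P \<in> points" using P by simp
    then show ?thesis
    proof (cases rule: points_cases)
      case (1 v)
      then show ?thesis using PV V(2) by auto
    next
      case (2 e t)
      then have "\<phi> e t \<noteq> 0" using False by (simp add: h_def)
      then obtain x y where q: "(x, y) \<in> pieces e" "\<phi> e t = tent (x, y) t" using \<phi>_attained[of e t] by auto
      note g = p_grid[OF q(1)]
      have "t \<notin> grid V e" using PV 2 unfolding grid_def edge_point_def by auto
      then have txy: "t \<noteq> x" "t \<noteq> y" using g by auto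
      have d: "(e, t, 1) \<in> directions P" "(e, t, -1) \<in> directions P" unfolding 2(4) directions_Inner[OF 2(1-3)] by auto
      have ord: "ord_at P h = outgoing_slope h (e, t, 1) + outgoing_slope h (e, t, -1)"
        unfolding ord_at_def 2(4) directions_Inner[OF 2(1-3)] by simp
      consider "t < x" | "y < t" | "x < t" "t < y" using txy by linarith
      then show ?thesis
      proof cases
        case 1
        have "1 \<le> outgoing_slope h (e, t, 1)"
          using 1 g(5) by (intro sl_ge[OF d(1) _ q, of "x - t"]) (auto simp: tent_def)
        moreover have "-1 \<le> outgoing_slope h (e, t, -1)"
          using 1 g(5) by (intro sl_ge[OF d(2) _ q, of 1]) (auto simp: tent_def)
        ultimately show ?thesis unfolding ord by simp
      next
        case 2
        have "-1 \<le> outgoing_slope h (e, t, 1)"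
          using 2 g(5) by (intro sl_ge[OF d(1) _ q, of 1]) (auto simp: tent_def)
        moreover have "1 \<le> outgoing_slope h (e, t, -1)"
          using 2 g(5) by (intro sl_ge[OF d(2) _ q, of "t - y"]) (auto simp: tent_def)
        ultimately show ?thesis unfolding ord by simp
      next
        case 3
        have "0 \<le> outgoing_slope h (e, t, 1)"
          using 3 by (intro sl_ge[OF d(1) _ q, of "y - t"]) (auto simp: tent_def)
        moreover have "0 \<le> outgoing_slope h (e, t, -1)"
          using 3 by (intro sl_ge[OF d(2) _ q, of "t - x"]) (auto simp: tent_def)
        ultimately show ?thesis unfolding ord by simp
      qed
    qed
  qed
  show ?thesis
    by (intro exI[of _ h] conjI ballI rh h_ge0 ord_off ordA) (use h_V A \<epsilon> in auto)
qed

lemma finite_pos_canonical: "finite {P \<in> points. 0 < canonical P}"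
proof (rule finite_subset)
  show "{P \<in> points. 0 < canonical P} \<subseteq> Vertex ` verts G"
  proof
    fix P assume "P \<in> {P \<in> points. 0 < canonical P}"
    then have "P \<in> points" "0 < canonical P" by auto
    then show "P \<in> Vertex ` verts G" by (cases rule: points_cases) (auto simp: canonical_Inner)
  qed
qed simp

lemma Vertex_in_points: "Vertex ` verts G \<subseteq> points"
  unfolding points_def by blast

text \<open>On a segment \<open>g\<close> is linear with integer slope, so from a maximum it stays
  level towards \<open>A\<close> and falls with slope at most -1 otherwise. Hence
  \<open>ord_at v g\<close> is at most minus the number of segment ends at \<open>v\<close> leading
  out of \<open>A\<close>, while \<open>canonical v + 2\<close> counts all segment ends at
  \<open>v\<close>.\<close>

lemma ord_at_max_le:
  assumes V: "finite V" "Vertex ` verts G \<subseteq> V" "V \<subseteq> points"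
    and g: "rational_function g" "\<And>P. P \<in> points \<Longrightarrow> ord_at P g \<noteq> 0 \<Longrightarrow> P \<in> V"
    and v: "v \<in> V" "\<And>P. P \<in> V \<Longrightarrow> g P \<le> g v"
  defines "A \<equiv> {P \<in> V. g P = g v}"
  shows "canonical v + ord_at v g + 2 \<le>
    int (card {q \<in> segments V. left_end q = v \<and> right_end q \<in> A}) + int (card {q \<in> segments V. right_end q = v \<and> left_end q \<in> A})"
proof -
  have lin: "pull g e b = pull g e a + of_int (slope (pull g e) a 1) * (b - a)"
    "slope (pull g e) b (-1) = - slope (pull g e) a 1" if q: "(e, a, b) \<in> segments V" for e a b
  proof -
    note bd = segment_bounds[OF q]
    have "kink (pull g e) t = 0" if t: "a < t" "t < b" for t
    proof (rule ccontr)
      assume k: "kink (pull g e) t \<noteq> 0"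
      have in01: "0 < t" "t < len e" using bd t by auto
      then have "Inner e t \<in> V"
        using g(2)[of "Inner e t"] k bd(1) ord_at_Inner[OF bd(1) in01] by (auto simp: points_def)
      then have "t \<in> grid V e" using in01 unfolding grid_def edge_point_def by auto
      then show False using q t unfolding segments_def by auto
    qed
    note between = pl_linear_between[OF rational_pl[OF g(1) bd(1)] len_pos[OF bd(1)] bd(2-4) this]
    show "pull g e b = pull g e a + of_int (slope (pull g e) a 1) * (b - a)"
      by (rule between(1)) (use bd(3) in auto)
    show "slope (pull g e) b (-1) = - slope (pull g e) a 1" by (rule between(2))
  qed
  \<comment> \<open>Integrality is used here: a negative slope is at most -1.\<close>
  have neg: "m \<le> (if g P = g v then 0 else -1)"
    if "g P \<le> g v" "g P = g v + of_int m * l" "0 < l" for P m and l :: real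
  proof (cases "g P = g v")
    case True
    then have "of_int m * l = 0" using that(2) by linarith
    then have "m = 0" using that(3) by simp
    then show ?thesis using True by simp
  next
    case False
    then have "of_int m * l < 0" using that by linarith
    then have "m < 0" using that(3) by (simp add: mult_less_0_iff)
    then show ?thesis using False by simp
  qed
  have l: "outgoing_slope g (left_dir q) \<le> (if right_end q \<in> A then 0 else -1)"
    if q: "q \<in> segments V" "left_end q = v" for q
  proof -
    obtain e a b where qq: "q = (e, a, b)" by (cases q)
    have "slope (pull g e) a 1 \<le> (if g (right_end q) = g v then 0 else -1)"
    proof (rule neg)
      show "g (right_end q) \<le> g v" by (rule v(2)) (rule segment_ends(2)[OF q(1)])
      show "g (right_end q) = g v + of_int (slope (pull g e) a 1) * (b - a)"
        using lin(1)[OF q(1)[unfolded qq]] q(2) unfolding qq left_end_def right_end_def by simp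
      show "0 < b - a" using segment_bounds[OF q(1)[unfolded qq]] by simp
    qed
    then show ?thesis using segment_ends(2)[OF q(1)] by (simp add: A_def qq left_dir_def outgoing_slope_eq)
  qed
  have r: "outgoing_slope g (right_dir q) \<le> (if left_end q \<in> A then 0 else -1)"
    if q: "q \<in> segments V" "right_end q = v" for q
  proof -
    obtain e a b where qq: "q = (e, a, b)" by (cases q)
    have "slope (pull g e) b (-1) \<le> (if g (left_end q) = g v then 0 else -1)"
    proof (rule neg)
      show "g (left_end q) \<le> g v" by (rule v(2)) (rule segment_ends(1)[OF q(1)])
      show "g (left_end q) = g v + of_int (slope (pull g e) b (-1)) * (b - a)"
        using lin[OF q(1)[unfolded qq]] q(2) unfolding qq left_end_def right_end_def by simp
      show "0 < b - a" using segment_bounds[OF q(1)[unfolded qq]] by simp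
    qed
    then show ?thesis using segment_ends(1)[OF q(1)] by (simp add: A_def qq right_dir_def outgoing_slope_eq)
  qed
  let ?L = "{q \<in> segments V. left_end q = v}" and ?R = "{q \<in> segments V. right_end q = v}"
  have fins: "finite (segments V)" by (rule finite_segments[OF V(1)])
  have cnt: "(\<Sum>q\<in>X. if Q q then 0 else -1) = int (card {q \<in> X. Q q}) - int (card X)" if "finite X" for X and Q :: "_ \<Rightarrow> bool"
  proof -
    have "(\<Sum>q\<in>X. if Q q then 0 else -1 :: int) = (\<Sum>q\<in>X. (if Q q then 1 else 0) - 1)" by (rule sum.cong) auto
    also have "\<dots> = (\<Sum>q\<in>X. if Q q then 1 else 0) - (\<Sum>q\<in>X. 1)" by (rule sum_subtractf)
    also have "(\<Sum>q\<in>X. if Q q then 1 else 0 :: int) = int (card {q \<in> X. Q q})"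
      using that by (simp add: sum.If_cases Int_def)
    finally show ?thesis by simp
  qed
  have "ord_at v g \<le> (\<Sum>q\<in>?L. if right_end q \<in> A then 0 else -1) + (\<Sum>q\<in>?R. if left_end q \<in> A then 0 else -1)"
    unfolding ord_at_def sum_directions_segments[OF V(1,2) v(1)] using l r by (intro add_mono sum_mono) auto
  also have "\<dots> = int (card {q \<in> ?L. right_end q \<in> A}) - int (card ?L) + (int (card {q \<in> ?R. left_end q \<in> A}) - int (card ?R))"
    by (intro arg_cong2[where f = "(+)"] cnt) (use fins in auto)
  finally have "ord_at v g + int (card ?L) + int (card ?R) \<le> int (card {q \<in> ?L. right_end q \<in> A}) + int (card {q \<in> ?R. left_end q \<in> A})"
    by simp
  moreover have "(\<Sum>d\<in>directions v. 1) = (\<Sum>q\<in>?L. 1) + (\<Sum>q\<in>?R. 1 :: nat)"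
    by (rule sum_directions_segments[OF V(1,2) v(1)])
  then have "card (directions v) = card ?L + card ?R" by simp
  ultimately show ?thesis unfolding canonical_def by (simp add: conj_assoc)
qed

text \<open>For all such \<open>E\<close> together this says that the canonical divisor has rank at
  least \<open>genus - 1\<close>. \<open>f0\<close> minimises the number of negative points, and
  \<open>F\<close> then reduces the divisor relative to their set \<open>S\<close>.\<close>

lemma canonical_rank:
  assumes ne: "arcs G \<noteq> {}"
    and E: "finite X" "X \<subseteq> points" "\<And>P. P \<in> points \<Longrightarrow> 0 \<le> E P" "\<And>P. P \<in> points \<Longrightarrow> E P \<noteq> 0 \<Longrightarrow> P \<in> X"
      "(\<Sum>P\<in>X. E P) = genus - 1"
  obtains f where "f \<in> sections (\<lambda>P. canonical P - E P)"
proof -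
  define neg where "neg f = {P \<in> points. canonical P - E P + ord_at P f < 0}" for f
  have canonical0: "P \<in> Vertex ` verts G" if "P \<in> points" "canonical P \<noteq> 0" for P
    using that by (cases rule: points_cases) (auto simp: canonical_Inner)
  have supp: "P \<in> Vertex ` verts G \<union> X \<union> {P \<in> points. ord_at P f \<noteq> 0}"
    if "P \<in> points" "canonical P - E P + ord_at P f \<noteq> 0" for P f
    using canonical0[of P] E(4)[of P] that by fastforce
  have fin_supp: "finite (Vertex ` verts G \<union> X \<union> {P \<in> points. ord_at P f \<noteq> 0})" if "rational_function f" for f
    using finite_ord_support[OF that] E(1) by simp
  have fin_neg: "finite (neg f)" if "rational_function f" for f
  proof (rule finite_subset[OF _ fin_supp[OF that]], rule subsetI)
    fix P assume "P \<in> neg f"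
    then show "P \<in> Vertex ` verts G \<union> X \<union> {P \<in> points. ord_at P f \<noteq> 0}"
      by (intro supp) (auto simp: neg_def)
  qed
  obtain f0 where f0: "rational_function f0" "\<And>f. rational_function f \<Longrightarrow> card (neg f0) \<le> card (neg f)"
    using exists_least_iff[of "\<lambda>n. \<exists>f. rational_function f \<and> card (neg f) = n"] rational_const
    by (metis not_le_imp_less)
  define S where "S = neg f0"
  show thesis
  proof (cases "S = {}")
    case True
    then show thesis using that[of f0] f0(1) unfolding S_def neg_def sections_def by force
  next
    case False
    define D1 where "D1 P = canonical P - E P + ord_at P f0" for P
    have fin1: "finite {P \<in> points. 0 < D1 P}"
    proof (rule finite_subset[OF _ fin_supp[OF f0(1)]], rule subsetI)
      fix P assume "P \<in> {P \<in> points. 0 < D1 P}"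
      then show "P \<in> Vertex ` verts G \<union> X \<union> {P \<in> points. ord_at P f0 \<noteq> 0}"
        by (intro supp) (auto simp: D1_def)
    qed
    have S: "S \<subseteq> points" "\<And>P. P \<in> points - S \<Longrightarrow> 0 \<le> D1 P" unfolding S_def neg_def D1_def by force+
    obtain F where F: "F \<in> constrained D1 S"
      and maxF: "\<And>f P. f \<in> constrained D1 S \<Longrightarrow> (\<And>P. P \<in> points \<Longrightarrow> F P \<le> f P) \<Longrightarrow> P \<in> points \<Longrightarrow> f P = F P"
      using constrained_maximal[OF fin1 ne S(1) False S(2)] by metis
    have rF: "rational_function F" using F unfolding constrained_def by simp
    define g where "g P = f0 P + F P" for P
    have rg: "rational_function g" unfolding g_def by (rule rational_add[OF f0(1) rF])
    have ord_g: "ord_at P g = ord_at P f0 + ord_at P F" for P unfolding g_def by (rule ord_at_add[OF f0(1) rF])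
    define D2 where "D2 P = canonical P - E P + ord_at P g" for P
    have D2: "D2 P = D1 P + ord_at P F" for P unfolding D2_def D1_def ord_g by simp
    \<comment> \<open>Adding \<open>F\<close> creates no negative point off \<open>S\<close>, and by
      minimality it removes none from \<open>S\<close>. So all of \<open>S\<close> keeps negative
      coefficients and burns unconditionally.\<close>
    have "neg g \<subseteq> S" using F unfolding neg_def constrained_def D2_def[symmetric] D2 by force
    then have neg_g: "neg g = S"
      using f0(2)[OF rg] fin_neg[OF f0(1)] unfolding S_def by (intro card_seteq) auto
    have D2_S: "D2 P < 0" if "P \<in> S" for P using that neg_g unfolding neg_def D2_def by blast
    have D2_off: "0 \<le> D2 P" if "P \<in> points - S" for P using that neg_g unfolding neg_def D2_def by force
    \<comment> \<open>All supports are included, so \<open>g\<close> is linear on every segment and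
      all degrees can be computed over \<open>V\<close>.\<close>
    define V where "V = Vertex ` verts G \<union> X \<union> S \<union> {P \<in> points. ord_at P g \<noteq> 0}"
    have V: "finite V" "Vertex ` verts G \<subseteq> V" "V \<subseteq> points"
      unfolding V_def using E(1,2) fin_neg[OF f0(1)] finite_ord_support[OF rg] S(1) Vertex_in_points
      by (auto simp: S_def)
    have sumE: "(\<Sum>P\<in>V. E P) = genus - 1"
    proof -
      have "(\<Sum>P\<in>V. E P) = (\<Sum>P\<in>X. E P)"
      proof (rule sum.mono_neutral_right[OF V(1)])
        show "\<forall>P\<in>V - X. E P = 0" using E(4) V(3) by blast
      qed (auto simp: V_def)
      then show ?thesis using E(5) by simp
    qed
    have sumord: "(\<Sum>P\<in>V. ord_at P g) = 0"
      by (rule sum_ord_eq_0[OF rg V(1,3)]) (auto simp: V_def)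
    have total: "(\<Sum>P\<in>V. D2 P) = int (card (segments V)) - int (card V)"
      unfolding D2_def sum.distrib sum_subtractf sumE sumord sum_canonical[OF V] card_segments[OF V] by simp
    define m where "m = Max (g ` V)"
    obtain e0 where "e0 \<in> arcs G" using ne by blast
    then have "Vertex (tail G e0) \<in> V" using V(2) by auto
    then have "m \<in> g ` V" unfolding m_def using V(1) by (intro Max_in) auto
    then have A: "{P \<in> V. g P = m} \<subseteq> V" "{P \<in> V. g P = m} \<noteq> {}" by auto
    have burn: "\<exists>v\<in>V - B. D2 v < int (card {q \<in> segments V. left_end q = v \<and> right_end q \<in> B \<or> right_end q = v \<and> left_end q \<in> B})"
      if B: "B \<subset> V" for B
    proof (cases "S \<subseteq> B")
      case False
      then obtain v where "v \<in> S" "v \<notin> B" by blast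
      then show ?thesis using D2_S[of v] by (intro bexI[of _ v]) (auto simp: V_def)
    next
      case True
      show ?thesis
      proof (rule ccontr)
        assume *: "\<not> ?thesis"
        \<comment> \<open>If the fire stops at \<open>B\<close>, the unburnt set can be fired
          without creating a negative coefficient off \<open>S\<close>; adding \<open>h\<close> to
          \<open>F\<close> then contradicts maximality.\<close>
        have VB: "V - B \<subseteq> V" by blast
        from firing_function[OF V VB] obtain h where firing: "rational_function h \<and> (\<forall>P\<in>points. 0 \<le> h P) \<and> (\<forall>P\<in>V - (V - B). h P = 0) \<and>
          (\<forall>P\<in>V - B. 0 < h P) \<and> (\<forall>P\<in>points - (V - B). 0 \<le> ord_at P h) \<and>
          (\<forall>P\<in>V - B. - int (card {q \<in> segments V. left_end q = P \<and> right_end q \<notin> V - B \<or> right_end q = P \<and> left_end q \<notin> V - B}) \<le> ord_at P h)" ..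
        then have h: "rational_function h" "\<And>P. P \<in> points \<Longrightarrow> 0 \<le> h P" "\<And>P. P \<in> V - (V - B) \<Longrightarrow> h P = 0"
          "\<And>P. P \<in> V - B \<Longrightarrow> 0 < h P" "\<And>P. P \<in> points - (V - B) \<Longrightarrow> 0 \<le> ord_at P h"
          "\<And>P. P \<in> V - B \<Longrightarrow> - int (card {q \<in> segments V. left_end q = P \<and> right_end q \<notin> V - B \<or> right_end q = P \<and> left_end q \<notin> V - B}) \<le> ord_at P h"
          by simp_all
        have "(\<lambda>P. F P + h P) \<in> constrained D1 S"
          unfolding constrained_def
        proof (intro CollectI conjI ballI)
          show "rational_function (\<lambda>P. F P + h P)" by (rule rational_add[OF rF h(1)])
          fix P assume P: "P \<in> S"
          then have "P \<in> V - (V - B)" using True by (auto simp: V_def)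
          then show "F P + h P = 0" using h(3) F P unfolding constrained_def by simp
        next
          fix P assume P: "P \<in> points"
          then show "0 \<le> F P + h P" using h(2) F unfolding constrained_def by simp
        next
          fix P assume P: "P \<in> points - S"
          have "0 \<le> D2 P + ord_at P h"
          proof (cases "P \<in> V - B")
            case True
            then have "int (card {q \<in> segments V. left_end q = P \<and> right_end q \<in> B \<or> right_end q = P \<and> left_end q \<in> B}) \<le> D2 P"
              using * by force
            moreover have "{q \<in> segments V. left_end q = P \<and> right_end q \<in> B \<or> right_end q = P \<and> left_end q \<in> B} =
              {q \<in> segments V. left_end q = P \<and> right_end q \<notin> V - B \<or> right_end q = P \<and> left_end q \<notin> V - B}"
              using segment_ends by blast
            ultimately show ?thesis using h(6)[OF True] by simp
          next
            case False
            then have "0 \<le> ord_at P h" using h(5) P by blast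
            then show ?thesis using D2_off[OF P] by simp
          qed
          then show "0 \<le> D1 P + ord_at P (\<lambda>P. F P + h P)" unfolding ord_at_add[OF rF h(1)] D2 by simp
        qed
        from maxF[OF this] have "h P = 0" if "P \<in> points" for P using h(2) that by simp
        moreover obtain v where "v \<in> V - B" using B by blast
        ultimately show False using h(4)[of v] V(3) by fastforce
      qed
    qed
    have ends: "left_end ` segments V \<subseteq> V" "right_end ` segments V \<subseteq> V" using segment_ends by auto
    from burning_count[OF V(1) finite_segments[OF V(1)] ends total burn A]
    obtain v where v: "v \<in> V" "g v = m" and
      ge: "int (card {q \<in> segments V. left_end q = v \<and> right_end q \<in> {P \<in> V. g P = m}}) +
        int (card {q \<in> segments V. right_end q = v \<and> left_end q \<in> {P \<in> V. g P = m}}) - 1 \<le> D2 v" by blast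
    \<comment> \<open>If \<open>n\<close> segment ends at \<open>v\<close> stay inside the maximum
      set of \<open>g\<close>, burning gives \<open>D2 v \<ge> n - 1\<close>, whereas this bound and
      \<open>E v \<ge> 0\<close> give \<open>D2 v \<le> n - 2\<close>.\<close>
    have "canonical v + ord_at v g + 2 \<le> int (card {q \<in> segments V. left_end q = v \<and> right_end q \<in> {P \<in> V. g P = g v}}) +
        int (card {q \<in> segments V. right_end q = v \<and> left_end q \<in> {P \<in> V. g P = g v}})"
    proof (rule ord_at_max_le[OF V rg _ v(1)])
      show "P \<in> V" if "P \<in> points" "ord_at P g \<noteq> 0" for P using that unfolding V_def by blast
      show "g P \<le> g v" if "P \<in> V" for P using that V(1) unfolding v(2) m_def by simp
    qed
    moreover have "0 \<le> E v" using E(3) v(1) V(3) by blast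
    ultimately show thesis using ge unfolding D2_def v(2) by simp
  qed
qed

section \<open>Weierstrass points\<close>

lemma lookup_div_of:
  assumes "rational_function f"
  shows "Poly_Mapping.lookup (div_of f) P = (if P \<in> points then ord_at P f else 0)"
proof -
  have "Poly_Mapping.lookup (div_of f) P = (\<Sum>Q | Q \<in> points \<and> ord_at Q f \<noteq> 0. if Q = P then ord_at Q f else 0)"
    unfolding div_of_def lookup_sum lookup_single by (rule sum.cong) (auto simp: when_def)
  also have "\<dots> = (if P \<in> points then ord_at P f else 0)"
    using finite_ord_support[OF assms] by (simp add: sum.delta')
  finally show ?thesis .
qed

lemma divisor_iff: "divisor D \<longleftrightarrow> (\<forall>P. P \<notin> points \<longrightarrow> Poly_Mapping.lookup D P = 0)"
  unfolding divisor_def by (auto simp: in_keys_iff)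

lemma linear_system_nonempty:
  assumes "divisor D" "f \<in> sections (Poly_Mapping.lookup D)"
  shows "linear_system D \<noteq> {}"
proof -
  have f: "rational_function f" "\<And>P. P \<in> points \<Longrightarrow> 0 \<le> Poly_Mapping.lookup D P + ord_at P f"
    using assms(2) unfolding sections_def by auto
  have "effective (D + div_of f)"
    unfolding effective_def divisor_iff lookup_add lookup_div_of[OF f(1)]
    using assms(1) f(2) by (auto simp: divisor_iff)
  moreover have "lin_equiv (D + div_of f) D" unfolding lin_equiv_def using f(1) by auto
  ultimately show ?thesis unfolding linear_system_def by blast
qed

text \<open>To see that a rank is at least 1, only degrees 0 and 1 have to be tested, and such
  divisors lie below a single point. \<open>P\<close> provides that point for the zero
  divisor.\<close>

lemma degree_le_1:
  assumes E: "effective E" "degree E = int n" "n < 2" and P: "P \<in> points"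
  obtains Q where "Q \<in> points" "\<And>R. Poly_Mapping.lookup E R \<le> (if R = Q then 1 else 0)"
proof -
  have pos: "0 \<le> Poly_Mapping.lookup E R" for R using E(1) unfolding effective_def by simp
  show thesis
  proof (cases "Poly_Mapping.keys E = {}")
    case True
    then show thesis using that[OF P] by (auto simp: in_keys_iff)
  next
    case False
    then obtain Q where Q: "Q \<in> Poly_Mapping.keys E" by blast
    have "Q \<in> points" using Q E(1) unfolding effective_def divisor_def by blast
    moreover have "Poly_Mapping.lookup E R \<le> (if R = Q then 1 else 0)" for R
    proof -
      have sum: "degree E = Poly_Mapping.lookup E Q + (\<Sum>R\<in>Poly_Mapping.keys E - {Q}. Poly_Mapping.lookup E R)"
        unfolding degree_def using Q by (simp add: sum.remove)
      have Q1: "1 \<le> Poly_Mapping.lookup E Q" using Q pos[of Q] by (auto simp: in_keys_iff order_le_less)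
      have rest: "0 \<le> (\<Sum>R\<in>Poly_Mapping.keys E - {Q}. Poly_Mapping.lookup E R)" using pos by (simp add: sum_nonneg)
      show ?thesis
      proof (cases "R = Q \<or> R \<notin> Poly_Mapping.keys E")
        case True
        then show ?thesis using sum rest E(2,3) by (auto simp: in_keys_iff)
      next
        case False
        then have "Poly_Mapping.lookup E R \<le> (\<Sum>R\<in>Poly_Mapping.keys E - {Q}. Poly_Mapping.lookup E R)"
          using pos by (intro member_le_sum) auto
        then show ?thesis using sum Q1 E(2,3) False by simp
      qed
    qed
    ultimately show thesis using that by blast
  qed
qed

text \<open>Linear equivalence preserves the degree, and effective divisors have nonnegative degree.
  This supplies a witness for the \<open>LEAST\<close> in \<open>rank\<close>.\<close>

lemma linear_system_negative:
  assumes "P \<in> points" "n < 0"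
  shows "linear_system (Poly_Mapping.single P n) = {}"
proof (rule ccontr)
  assume "linear_system (Poly_Mapping.single P n) \<noteq> {}"
  then obtain E f where E: "effective E" and f: "rational_function f" "E - Poly_Mapping.single P n = div_of f"
    unfolding linear_system_def lin_equiv_def by blast
  have pos: "0 \<le> Poly_Mapping.lookup E R" for R using E unfolding effective_def by simp
  have eq: "Poly_Mapping.lookup E R = (if R = P then n else 0) + (if R \<in> points then ord_at R f else 0)" for R
    using arg_cong[OF f(2), of "\<lambda>D. Poly_Mapping.lookup D R"]
    by (simp add: lookup_minus lookup_single lookup_div_of[OF f(1)] when_def split: if_splits)
  let ?X = "insert P {R \<in> points. ord_at R f \<noteq> 0}"
  have X: "finite ?X" "?X \<subseteq> points" using finite_ord_support[OF f(1)] assms(1) by auto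
  have "(\<Sum>R\<in>?X. Poly_Mapping.lookup E R) = (\<Sum>R\<in>?X. (if R = P then n else 0)) + (\<Sum>R\<in>?X. ord_at R f)"
    unfolding eq sum.distrib using X(2) by (intro arg_cong2[where f = "(+)"] refl sum.cong) auto
  also have "(\<Sum>R\<in>?X. ord_at R f) = 0" by (rule sum_ord_eq_0[OF f(1) X]) auto
  also have "(\<Sum>R\<in>?X. (if R = P then n else 0)) + 0 = n" using X(1) by (simp add: sum.delta')
  finally show False using sum_nonneg[of ?X "Poly_Mapping.lookup E"] pos assms(2) by simp
qed

lemma weierstrass_pointI:
  assumes g: "2 \<le> genus" and ne: "arcs G \<noteq> {}" and P: "P \<in> points"
    and f: "f \<in> sections canonical" "genus \<le> canonical P + ord_at P f"
  shows "weierstrass_point P"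
proof -
  have rf: "rational_function f" using f(1) unfolding sections_def by simp
  let ?D = "Poly_Mapping.single P genus"
  have main: "\<exists>f'. rational_function f' \<and>
      (\<forall>R\<in>points. 0 \<le> (if R = P then genus else 0) - (if R = Q then 1 else 0) + ord_at R f')" if Q: "Q \<in> points" for Q
  proof -
    \<comment> \<open>The divisor of \<open>f\<close> plus the canonical one, minus
      \<open>genus\<close> times \<open>P\<close>, plus \<open>Q\<close>: it is effective of degree
      \<open>(2 * genus - 2) - genus + 1 = genus - 1\<close>. Then canonical minus \<open>E\<close>
      is equivalent to \<open>genus\<close> times \<open>P\<close> minus \<open>Q\<close>.\<close>
    define E where "E R = canonical R + ord_at R f - (if R = P then genus else 0) + (if R = Q then 1 else 0)" for R
    define X where "X = Vertex ` verts G \<union> {R \<in> points. ord_at R f \<noteq> 0} \<union> {P, Q}"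
    have X: "finite X" "Vertex ` verts G \<subseteq> X" "X \<subseteq> points"
      unfolding X_def using finite_ord_support[OF rf] P Q Vertex_in_points by auto
    obtain f2 where f2: "f2 \<in> sections (\<lambda>R. canonical R - E R)"
    proof (rule canonical_rank[OF ne X(1,3)])
      show "0 \<le> E R" if "R \<in> points" for R using f that unfolding E_def sections_def by auto
      show "R \<in> X" if "R \<in> points" "E R \<noteq> 0" for R
        using that(1)
      proof (cases rule: points_cases)
        case (1 v)
        then show ?thesis unfolding X_def by simp
      next
        case (2 e t)
        then show ?thesis using that canonical_Inner[OF 2(1-3)] unfolding E_def X_def by (auto split: if_splits)
      qed
      have "(\<Sum>R\<in>X. ord_at R f) = 0" by (rule sum_ord_eq_0[OF rf X(1,3)]) (auto simp: X_def)
      moreover have "P \<in> X" "Q \<in> X" unfolding X_def by auto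
      ultimately show "(\<Sum>R\<in>X. E R) = genus - 1"
        unfolding E_def sum.distrib sum_subtractf sum_canonical[OF X] using X(1) by (simp add: sum.delta')
    qed
    have rf2: "rational_function f2" using f2 unfolding sections_def by simp
    show ?thesis
    proof (intro exI[of _ "\<lambda>R. f2 R - f R"] conjI ballI)
      show "rational_function (\<lambda>R. f2 R - f R)" by (rule rational_diff[OF rf2 rf])
      fix R assume "R \<in> points"
      then have "0 \<le> canonical R - E R + ord_at R f2" using f2 unfolding sections_def by simp
      then show "0 \<le> (if R = P then genus else 0) - (if R = Q then 1 else 0) + ord_at R (\<lambda>R. f2 R - f R)"
        unfolding E_def ord_at_diff[OF rf2 rf] by simp
    qed
  qed
  have small: "linear_system (?D - E) \<noteq> {}" if E: "effective E" "degree E = int n" "n < 2" for E n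
  proof -
    obtain Q where Q: "Q \<in> points" "\<And>R. Poly_Mapping.lookup E R \<le> (if R = Q then 1 else 0)"
      using degree_le_1[OF E P] by blast
    obtain f' where f': "rational_function f'"
      "\<And>R. R \<in> points \<Longrightarrow> 0 \<le> (if R = P then genus else 0) - (if R = Q then 1 else 0) + ord_at R f'"
      using main[OF Q(1)] by blast
    have "divisor (?D - E)"
      using E(1) P unfolding effective_def divisor_iff by (auto simp: lookup_minus lookup_single when_def)
    moreover have "f' \<in> sections (Poly_Mapping.lookup (?D - E))"
      unfolding sections_def
    proof (intro CollectI conjI ballI)
      fix R assume "R \<in> points"
      then show "0 \<le> Poly_Mapping.lookup (?D - E) R + ord_at R f'"
        using f'(2)[of R] Q(2)[of R] by (simp add: lookup_minus lookup_single when_def split: if_splits)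
    qed (rule f'(1))
    ultimately show ?thesis by (rule linear_system_nonempty)
  qed
  let ?Q = "\<lambda>n. \<exists>E. effective E \<and> degree E = int n \<and> linear_system (?D - E) = {}"
  \<comment> \<open>\<open>LEAST\<close> says something only if a witness exists; subtracting degree
    \<open>genus + 1\<close> leaves degree -1.\<close>
  have "?Q (nat (genus + 1))"
  proof (intro exI[of _ "Poly_Mapping.single P (genus + 1)"] conjI)
    show "effective (Poly_Mapping.single P (genus + 1))"
      using g P unfolding effective_def divisor_iff by (auto simp: lookup_single when_def)
    show "degree (Poly_Mapping.single P (genus + 1)) = int (nat (genus + 1))"
      using g unfolding degree_def by simp
    have "?D - Poly_Mapping.single P (genus + 1) = Poly_Mapping.single P (-1)"
      by (simp add: single_diff[symmetric])
    then show "linear_system (?D - Poly_Mapping.single P (genus + 1)) = {}"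
      using linear_system_negative[OF P, of "-1"] by simp
  qed
  then have "?Q (LEAST n. ?Q n)" by (rule LeastI)
  then have "2 \<le> (LEAST n. ?Q n)" using small by (meson not_less)
  then show ?thesis unfolding weierstrass_point_def rank_def using P by simp
qed

theorem exists_weierstrass_point:
  assumes g: "2 \<le> genus"
  shows "\<exists>P. weierstrass_point P"
proof (rule ccontr)
  assume none: "\<not> ?thesis"
  have verts: "verts G \<noteq> {}"
    using graph_connected unfolding Digraph_Component.connected_def strongly_connected_def by simp
  have cards: "int (card (arcs G)) = int (card (verts G)) + genus - 1" unfolding genus_def by simp
  have "0 < card (verts G)" using verts by (simp add: card_gt_0_iff)
  then have ne: "arcs G \<noteq> {}" using cards g by auto
  let ?R = "sections canonical" and ?C = "pos_degree canonical"
  have upper: "canonical P + ord_at P f \<le> genus - 1" if "P \<in> points" "f \<in> ?R" for P f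
    using weierstrass_pointI[OF g ne that] none by force
  \<comment> \<open>Apply \<open>canonical_rank\<close> to \<open>genus - 1\<close> times
    \<open>P\<close>; adding this effective divisor back makes the result a section of
    \<open>canonical\<close>.\<close>
  have lower: "\<exists>f\<in>?R. genus - 1 \<le> canonical P + ord_at P f" if P: "P \<in> points" for P
  proof -
    define E where "E R = (if R = P then genus - 1 else 0)" for R
    obtain f where f: "f \<in> sections (\<lambda>R. canonical R - E R)"
      by (rule canonical_rank[OF ne, of "{P}" E]) (use P g in \<open>auto simp: E_def split: if_splits\<close>)
    have ge: "0 \<le> canonical R - E R + ord_at R f" if "R \<in> points" for R using f that unfolding sections_def by simp
    have E0: "0 \<le> E R" for R unfolding E_def using g by simp
    have "0 \<le> canonical R + ord_at R f" if "R \<in> points" for R using ge[OF that] E0[of R] by linarith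
    then have "f \<in> ?R" using f unfolding sections_def by simp
    then show ?thesis using ge[OF P] unfolding E_def by force
  qed
  \<comment> \<open>The family is infinite, but its slopes are integers between \<open>- ?C\<close>
    and \<open>?C\<close>.\<close>
  define M where "M d = Max ((\<lambda>f. outgoing_slope f d) ` ?R)" for d
  have Rne: "?R \<noteq> {}" using lower[of "Vertex _"] verts unfolding points_def by blast
  have M_fin: "finite ((\<lambda>f. outgoing_slope f d) ` ?R)" if "P \<in> points" "d \<in> directions P" for P d
  proof (rule finite_subset)
    show "(\<lambda>f. outgoing_slope f d) ` ?R \<subseteq> {-?C..?C}"
      using abs_outgoing_slope_le[OF finite_pos_canonical _ that] by (fastforce simp: abs_le_iff)
  qed simp
  have M_ge: "outgoing_slope f d \<le> M d" if "P \<in> points" "d \<in> directions P" "f \<in> ?R" for P d f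
    unfolding M_def using M_fin[OF that(1,2)] that(3) by (intro Max_ge) auto
  have M_att: "\<exists>f\<in>?R. outgoing_slope f d = M d" if "P \<in> points" "d \<in> directions P" for P d
    using Max_in[OF M_fin[OF that]] Rne unfolding M_def by fastforce
  \<comment> \<open>Shift the functions to a common value at \<open>P\<close> and take the maximum:
    it touches each of them from above at \<open>P\<close>, so in every direction it rises at least
    as fast as each.\<close>
  have M_simult: "\<exists>F\<in>?R. \<forall>d\<in>I. M d \<le> outgoing_slope F d" if P: "P \<in> points" and I: "finite I" "I \<subseteq> directions P" for P I
    using I
  proof (induction I rule: finite_induct)
    case empty
    then show ?case using Rne by blast
  next
    case (insert d I)
    then obtain F where F: "F \<in> ?R" "\<forall>d\<in>I. M d \<le> outgoing_slope F d" by auto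
    obtain f where f: "f \<in> ?R" "outgoing_slope f d = M d" using M_att[OF P, of d] insert.prems by auto
    define f' where "f' = (\<lambda>Q. f Q + (F P - f P))"
    define h where "h = (\<lambda>Q. max (F Q) (f' Q))"
    have f': "f' \<in> ?R" unfolding f'_def by (rule sections_add_const[OF f(1)])
    have h: "h \<in> ?R" unfolding h_def by (rule sections_max[OF F(1) f'])
    have r: "rational_function h" "rational_function F" "rational_function f"
      using h F(1) f(1) unfolding sections_def by auto
    have "M d' \<le> outgoing_slope h d'" if d': "d' \<in> insert d I" for d'
    proof (cases "d' = d")
      case True
      have "outgoing_slope f d \<le> outgoing_slope h d"
        by (rule outgoing_slope_mono[OF r(1,3), of d P "F P - f P"]) (use insert.prems in \<open>auto simp: h_def f'_def\<close>)
      then show ?thesis using f(2) True by simp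
    next
      case False
      have "outgoing_slope F d' \<le> outgoing_slope h d'"
        by (rule outgoing_slope_mono[OF r(1,2), of d' P 0]) (use insert.prems d' in \<open>auto simp: h_def f'_def\<close>)
      then show ?thesis using F(2) d' False by force
    qed
    then show ?case using h by blast
  qed
  have local: "canonical P + (\<Sum>d\<in>directions P. M d) = genus - 1" if P: "P \<in> points" for P
  proof (rule antisym)
    obtain F where F: "F \<in> ?R" "\<forall>d\<in>directions P. M d \<le> outgoing_slope F d"
      using M_simult[OF P finite_directions[OF P]] by blast
    then have "(\<Sum>d\<in>directions P. M d) \<le> ord_at P F" unfolding ord_at_def by (intro sum_mono) auto
    then show "canonical P + (\<Sum>d\<in>directions P. M d) \<le> genus - 1" using upper[OF P F(1)] by simp
    obtain f where f: "f \<in> ?R" "genus - 1 \<le> canonical P + ord_at P f" using lower[OF P] by blast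
    have "ord_at P f \<le> (\<Sum>d\<in>directions P. M d)" unfolding ord_at_def using M_ge[OF P _ f(1)] by (intro sum_mono)
    then show "genus - 1 \<le> canonical P + (\<Sum>d\<in>directions P. M d)" using f(2) by simp
  qed
  have edge: "genus - 1 \<le> M (e, 0, 1) + M (e, len e, -1)" if e: "e \<in> arcs G" for e
  proof -
    let ?L = "len e"
    note L = len_pos[OF e]
    \<comment> \<open>One more than the largest slope at the start of the edge, so that points whose
      forward value is at least \<open>k\<close> cannot accumulate there.\<close>
    define k where "k = M (e, 0, 1) + 1"
    have sum: "M (e, t, 1) + M (e, t, -1) = genus - 1" if "0 < t" "t < ?L" for t
      using local[of "Inner e t"] that e canonical_Inner[OF e that] by (simp add: points_def directions_Inner)
    \<comment> \<open>Semicontinuity of \<open>M\<close>: its superlevel sets along the edge are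
      closed, including at the ends.\<close>
    have closed: "j \<le> M (e, t, s)"
      if s: "s = 1 \<and> 0 \<le> t \<and> t < ?L \<or> s = -1 \<and> 0 < t \<and> t \<le> ?L"
        and t: "t \<in> closure T" and T: "\<And>u. u \<in> T \<Longrightarrow> 0 < u \<and> u < ?L \<and> j \<le> M (e, u, s)" for t s j T
    proof -
      obtain \<tau> where \<tau>: "\<And>n. \<tau> n \<in> T" "\<tau> \<longlonglongrightarrow> t" using t unfolding closure_sequential by blast
      have "\<exists>f\<in>?R. outgoing_slope f (e, \<tau> n, s) = M (e, \<tau> n, s)" for n
        by (rule M_att[of "edge_point e (\<tau> n)"])
          (use T[OF \<tau>(1)] s e in \<open>auto simp: directions_iff less_imp_le intro: edge_point_in_points\<close>)
      then obtain f where f: "\<And>n. f n \<in> ?R" "\<And>n. outgoing_slope (f n) (e, \<tau> n, s) = M (e, \<tau> n, s)" by metis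
      obtain F where F: "F \<in> ?R" "j \<le> outgoing_slope F (e, t, s)"
      proof (rule outgoing_slope_limit[OF finite_pos_canonical e _ f(1) _ _ \<tau>(2) s])
        show "canonical (Inner e u) \<le> 0" if "0 < u" "u < ?L" for u using canonical_Inner[OF e that] by simp
        show "0 < \<tau> n" "\<tau> n < ?L" "j \<le> outgoing_slope (f n) (e, \<tau> n, s)" for n
          using T[OF \<tau>(1)[of n]] unfolding f(2) by auto
      qed
      have "outgoing_slope F (e, t, s) \<le> M (e, t, s)"
        by (rule M_ge[of "edge_point e t", OF _ _ F(1)])
          (use s e L in \<open>auto simp: directions_iff intro: edge_point_in_points\<close>)
      then show ?thesis using F(2) by simp
    qed
    define T where "T = {t. 0 < t \<and> t < ?L \<and> k \<le> M (e, t, 1)}"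
    have notT: "genus - k \<le> M (e, t, -1)" if "0 < t" "t < ?L" "t \<notin> T" for t
      using sum[OF that(1,2)] that unfolding T_def by auto
    \<comment> \<open>\<open>T\<close> and the set where the backward value is at least
      \<open>genus - k\<close> are closed in the open edge, cover it, and are disjoint because the
      two values sum to \<open>genus - 1\<close>. The infimum of \<open>T\<close> would lie in both
      sets or be 0, where the forward value is only \<open>k - 1\<close>.\<close>
    have "T = {}"
    proof (rule ccontr)
      assume "T \<noteq> {}"
      define p where "p = Inf T"
      have bdd: "bdd_below T" unfolding T_def by (rule bdd_belowI[of _ 0]) auto
      have p: "p \<in> closure T" unfolding p_def by (rule closure_contains_Inf[OF \<open>T \<noteq> {}\<close> bdd])
      obtain u where u: "u \<in> T" using \<open>T \<noteq> {}\<close> by blast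
      have "p \<le> u" unfolding p_def by (rule cInf_lower[OF u bdd])
      then have pL: "p < ?L" using u unfolding T_def by simp
      have p0: "0 \<le> p" unfolding p_def by (rule cInf_greatest[OF \<open>T \<noteq> {}\<close>]) (auto simp: T_def)
      have pk: "k \<le> M (e, p, 1)"
        by (rule closed[OF _ p]) (use p0 pL in \<open>auto simp: T_def\<close>)
      then have "p \<noteq> 0" unfolding k_def by auto
      then have p_pos: "0 < p" using p0 by simp
      have below: "u \<notin> T" if "u < p" for u using cInf_lower[OF _ bdd, of u] that unfolding p_def by force
      have "genus - k \<le> M (e, p, -1)"
      proof (rule closed)
        show "p \<in> closure {0<..<p}" using p_pos by simp
        show "0 < u \<and> u < ?L \<and> genus - k \<le> M (e, u, -1)" if "u \<in> {0<..<p}" for u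
          using notT[of u] below[of u] that pL by simp
      qed (use p_pos pL in auto)
      then show False using pk sum[OF p_pos pL] by simp
    qed
    \<comment> \<open>With \<open>T\<close> empty the backward bound holds on the whole open edge
      and passes to its far end.\<close>
    have "genus - k \<le> M (e, ?L, -1)"
    proof (rule closed)
      show "?L \<in> closure {0<..<?L}" using L by simp
      show "0 < u \<and> u < ?L \<and> genus - k \<le> M (e, u, -1)" if "u \<in> {0<..<?L}" for u
        using notT[of u] \<open>T = {}\<close> that by simp
    qed (use L in auto)
    then show ?thesis unfolding k_def by simp
  qed
  \<comment> \<open>Each vertex carries \<open>genus - 1\<close>, and each edge takes at least as
    much. The canonical divisor adds \<open>2 * genus - 2\<close>, the source of the 2 in the final
    inequality; yet there are more edges than vertices.\<close>
  have "int (card (verts G)) * (genus - 1) = (\<Sum>v\<in>verts G. canonical (Vertex v) + (\<Sum>d\<in>directions (Vertex v). M d))"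
    using local Vertex_in_points by (simp add: image_subset_iff)
  also have "\<dots> = (\<Sum>P\<in>Vertex ` verts G. canonical P) + (\<Sum>e\<in>arcs G. M (e, 0, 1) + M (e, len e, -1))"
    by (simp add: sum.distrib sum_directions_verts sum.reindex inj_on_def)
  also have "\<dots> \<ge> 2 * genus - 2 + int (card (arcs G)) * (genus - 1)"
    using sum_mono[of "arcs G" "\<lambda>e. genus - 1"] edge sum_canonical[of "Vertex ` verts G"] Vertex_in_points by simp
  finally have "(2 + int (card (arcs G))) * (genus - 1) \<le> int (card (verts G)) * (genus - 1)"
    by (simp add: algebra_simps)
  then have "2 + int (card (arcs G)) \<le> int (card (verts G))" using g by simp
  then show False using cards g by simp
qed

end

theorem theorem12:
  fixes G :: "('a, 'b) pre_digraph" and len :: "'b \<Rightarrow> real"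
  assumes "tropical_curve G len"
    and "tropical_curve.genus G \<ge> 2"
  shows "\<exists>P. tropical_curve.weierstrass_point G len P"
  using tropical_curve.exists_weierstrass_point[OF assms] .

end
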